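(* Let $\theta>0$ be fixed and $\sigma_T=\frac12+\frac{1}{(\log T)^{\theta}}$. Let $a<b$ and $c<d$ be real numbers. Define $$\kappa(\sigma_T,X)=\frac{\log\zeta(\sigma_T,X)}{\sqrt{\pi\psi_T}},\qquad \psi_T:=\sum_{p}\sum_{k\ge1}\frac{1}{k^2}p^{-2k\sigma_T}=\theta\log\log T+O(1),$$ where $p$ runs over primes. Then there exist polynomials $g_k(x,y)$, $0\le k\le 5$ (not depending on $T$), with $g_0(x,y)=1$ and $\deg g_k\le k$, such that for $T\ge 10$ $$\mathbf P\big[\kappa(\sigma_T,X)\in[a,b]\times[c,d]\big]=\sum_{0\le k\le5}\frac{1}{\sqrt{\psi_T}^{\,k}}\int_c^d\int_a^b g_k(x,y)e^{-\pi(x^2+y^2)}\,dx\,dy+O\bigg(\frac{1}{(\log\log T)^3}\bigg).$$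
   Context: Let $(X(p))_{p\text{ prime}}$ be independent random variables, each uniformly distributed on the unit circle $|z|=1$ in $\mathbf C$. For $\sigma>1/2$, $\zeta(\sigma,X):=\prod_p\big(1-\frac{X(p)}{p^{\sigma}}\big)^{-1}$, which converges almost surely, and $\log\zeta(\sigma,X)=-\sum_p\log\big(1-\frac{X(p)}{p^\sigma}\big)$ with principal logarithms. For complex $\kappa$, $\kappa\in[a,b]\times[c,d]$ means $\operatorname{Re}\kappa\in[a,b]$ and $\operatorname{Im}\kappa\in[c,d]$. The implied constants may depend on the fixed quantities $\theta,a,b,c,d$, but not on $T$. *)

theory Defs
  imports
    "HOL-Probability.Probability"
    "HOL-Computational_Algebra.Computational_Algebra"
begin

definition uniform_circle :: "complex measure" where
  "uniform_circle = distr (uniform_measure lborel {0..2 * pi}) borel cis"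

definition sigmaT :: "real \<Rightarrow> real \<Rightarrow> real" where
  "sigmaT \<theta> T = 1 / 2 + 1 / (ln T) powr \<theta>"

text \<open>
  For \<open>\<sigma> \<le> 1\<close> the series defining \<open>log \<zeta>(\<sigma>, X)\<close> converges almost surely but in general not
  absolutely, so the primes are taken in increasing order: \<open>suminf\<close> is the limit of the partial
  sums over \<open>n < N\<close>. The argument \<open>x\<close> is a realisation \<open>p \<mapsto> X p \<omega>\<close>; its values off the primes
  are irrelevant. On the null event where the series diverges, \<open>suminf\<close> is a fixed unspecified
  constant, so \<open>log_zeta\<close> is still measurable.
\<close>
definition log_zeta :: "real \<Rightarrow> (nat \<Rightarrow> complex) \<Rightarrow> complex" where
  "log_zeta \<sigma> x =
     - (\<Sum>n. if prime n then Ln (1 - x n / complex_of_real (real n powr \<sigma>)) else 0)"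

definition psiT :: "real \<Rightarrow> real \<Rightarrow> real" where
  "psiT \<theta> T = (\<Sum>\<^sub>\<infinity>p\<in>{p::nat. prime p}. \<Sum>\<^sub>\<infinity>k\<in>{1::nat..}.
     1 / (real k)\<^sup>2 * real p powr (- 2 * real k * sigmaT \<theta> T))"

definition kappa :: "real \<Rightarrow> real \<Rightarrow> (nat \<Rightarrow> complex) \<Rightarrow> complex" where
  "kappa \<theta> T x = log_zeta (sigmaT \<theta> T) x / complex_of_real (sqrt (pi * psiT \<theta> T))"

text \<open>
  A polynomial in \<open>x, y\<close> is a polynomial in \<open>y\<close> (outer) over the polynomials in \<open>x\<close> (inner):
  \<open>coeff (coeff g j) i\<close> is the coefficient of \<open>x ^ i * y ^ j\<close>. The degree bound is on the total
  degree, and the zero polynomial satisfies every bound.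
\<close>
definition eval2 :: "real poly poly \<Rightarrow> real \<Rightarrow> real \<Rightarrow> real" where
  "eval2 g x y = poly (poly g [:y:]) x"

definition total_degree_le :: "real poly poly \<Rightarrow> nat \<Rightarrow> bool" where
  "total_degree_le g d \<longleftrightarrow> (\<forall>i j. coeff (coeff g j) i \<noteq> 0 \<longrightarrow> i + j \<le> d)"

end

theory Submission
  imports Defs "HOL-Complex_Analysis.Cauchy_Integral_Theorem" "HOL-Real_Asymp.Real_Asymp"
begin

text \<open>
  Write \<open>t = u + \<i> v\<close>, \<open>b = |t|\<^sup>2 / 4\<close> and \<open>x = p powr (- 2 \<sigma>)\<close>. By the binomial series and
  Parseval, the characteristic function of the Euler factor at \<open>p\<close> is the hypergeometric value
  \<open>1 - b G(x, u, b)\<close> with \<open>G = \<Sum>n\<ge>1. x ^ n / n\<^sup>2 * \<Prod>1\<le>j<n. (1 + \<i> u / j - b / j\<^sup>2)\<close>. The linear term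
  of \<open>- b G\<close> at \<open>u = b = 0\<close> sums to \<open>- b \<psi>\<close>, and everything else is divisible by \<open>x\<^sup>2\<close>, hence
  summable over the primes uniformly for \<open>\<sigma> \<ge> 1 / 2\<close>. Thus the characteristic function of
  \<open>log \<zeta>(\<sigma>, X)\<close> is \<open>exp (- b \<psi>) (1 + P(t) + O(|t| ^ 6 + (2 \<sigma> - 1) |t| ^ 3))\<close> for \<open>|t| \<le> 1\<close>, where
  \<open>P\<close> has terms of degree 3, 4, 5 only and is taken at \<open>\<sigma> = 1 / 2\<close>. For larger \<open>t\<close>, up to any
  power of \<open>\<psi>\<close>, the primes with \<open>x |t|\<^sup>2\<close> small still give decay \<open>exp (- c \<psi> |t|\<^sup>2)\<close>. Smoothing by
  a Gaussian of width \<open>\<psi> powr (- 5)\<close> and Fourier inversion turn this into the expansion for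
  rectangles; the polynomials are combinations of Hermite polynomials.
\<close>

subsection \<open>The prime zeta function near 1\<close>

text \<open>Put \<open>t = (u, v) / sqrt (pi * psi)\<close>. A term of degree \<open>k\<close> in
  \<open>P\<close> then has size \<open>psi powr (- k / 2)\<close>: degrees 3, 4, 5 produce the
  polynomials of those indices (those of index 1 and 2 vanish), and degree 6 is exactly the
  permitted error. Coefficients independent of \<open>T\<close> require freezing \<open>P\<close> at
  \<sigma> = 1/2; this is cheap, since \<open>psi \<sigma>\<close> is
  \<open>ln (1 / (2 * \<sigma> - 1))\<close> up to a bounded error, so that
  \<open>2 * \<sigma> - 1\<close> is exponentially small in \<open>psi\<close>. The obstacle is the
  range of moderate and large \<open>t\<close>, where the expansion says nothing. Decay is available
  only from primes beyond a multiple of \<open>1 + |t| + |t| ^ 2\<close>. Discarding all primes up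
  to \<open>Y\<close> costs at most \<open>ln Y + 1\<close>, which is \<open>O(ln psi)\<close> as
  long as \<open>|t|\<close> is polynomially bounded in \<open>psi\<close>; hence a trivial harmonic
  sum replaces Mertens' theorem, and the pole of zeta at 1 is all that is needed about primes. Past
  \<open>|t| = psi ^ 10\<close> the smoothing Gaussian of width \<open>psi powr (- 5)\<close> takes
  over. Moving the sides of the rectangle by \<open>psi powr (- 3)\<close> costs an admissible
  \<open>psi powr (- 3)\<close>, and the Gaussian mass that escapes this margin is
  \<open>psi powr (- 4)\<close>.\<close>

definition rough :: "nat \<Rightarrow> nat set" where
  "rough m = {n. n \<ge> 1 \<and> (\<forall>p. prime p \<longrightarrow> p dvd n \<longrightarrow> m \<le> p)}"

text \<open>The sum over integers without prime factors below \<open>m\<close>: for prime \<open>m\<close>, passing to \<open>Suc m\<close> multiplies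
  it by the inverse Euler factor \<open>1 - m powr - s\<close>, and it tends to \<open>1\<close>. This gives the Euler product.\<close>

definition rough_zeta :: "real \<Rightarrow> nat \<Rightarrow> real" where
  "rough_zeta s m = infsum (\<lambda>n. real n powr - s) (rough m)"

lemma powr_summable_on:
  assumes "s > 1"
  shows "(\<lambda>n. real n powr - s) summable_on (A :: nat set)"
proof -
  have "summable (\<lambda>n. real n powr - s)"
    using assms summable_real_powr_iff[of "-s"] by simp
  then have "(\<lambda>n. real n powr - s) summable_on UNIV"
    by (intro summable_nonneg_imp_summable_on) auto
  then show ?thesis
    by (rule summable_on_subset_banach) simp
qed

lemma one_in_rough: "1 \<in> rough m"
  by (auto simp: rough_def)

text \<open>One step of the sieve of Eratosthenes: an element of \<open>rough m\<close> not
  divisible by \<open>m\<close> has all its prime factors above \<open>m\<close>, and one divisible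
  by \<open>m\<close> remains in \<open>rough m\<close> after division by \<open>m\<close>, because
  multiplicities are unrestricted.\<close>

lemma rough_Suc_prime:
  assumes "prime m"
  shows "rough m = rough (Suc m) \<union> (*) m ` rough m" "rough (Suc m) \<inter> (*) m ` rough m = {}"
proof -
  show "rough m = rough (Suc m) \<union> (*) m ` rough m"
  proof (intro set_eqI iffI)
    fix n assume n: "n \<in> rough m"
    show "n \<in> rough (Suc m) \<union> (*) m ` rough m"
    proof (cases "m dvd n")
      case True
      then obtain k where k: "n = m * k" by auto
      have "k \<in> rough m" using n k by (auto simp: rough_def)
      then show ?thesis using k by auto
    next
      case False
      have "Suc m \<le> p" if "prime p" "p dvd n" for p
        using n that False by (metis (mono_tags, lifting) mem_Collect_eq not_less_eq_eq le_antisym rough_def)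
      then show ?thesis using n by (auto simp: rough_def)
    qed
  next
    fix n assume "n \<in> rough (Suc m) \<union> (*) m ` rough m"
    then show "n \<in> rough m"
    proof
      assume "n \<in> rough (Suc m)" then show ?thesis by (auto simp: rough_def dest: Suc_leD)
    next
      assume "n \<in> (*) m ` rough m"
      then obtain k where k: "n = m * k" "k \<in> rough m" by auto
      have "m \<le> p" if "prime p" "p dvd n" for p
      proof -
        have "p dvd m \<or> p dvd k" using that k by (simp add: prime_dvd_mult_iff)
        then show ?thesis
          using k that assms primes_dvd_imp_eq by (auto simp: rough_def)
      qed
      moreover have "n \<ge> 1" using k assms prime_gt_0_nat[of m] by (auto simp: rough_def)
      ultimately show ?thesis by (auto simp: rough_def)
    qed
  qed
  show "rough (Suc m) \<inter> (*) m ` rough m = {}"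
  proof -
    have "Suc m \<le> m" if "m * k \<in> rough (Suc m)" for k
      using that assms unfolding rough_def by (metis (mono_tags, lifting) dvd_triv_left mem_Collect_eq)
    then show ?thesis by fastforce
  qed
qed

lemma rough_Suc_not_prime:
  assumes "\<not> prime m"
  shows "rough (Suc m) = rough m"
proof -
  have "prime p \<Longrightarrow> Suc m \<le> p \<longleftrightarrow> m \<le> p" for p
    using assms by (cases "p = m") auto
  then show ?thesis unfolding rough_def by blast
qed

lemma rough_zeta_Suc:
  assumes "s > 1"
  shows "rough_zeta s (Suc m) = rough_zeta s m * (if prime m then 1 - real m powr - s else 1)"
proof (cases "prime m")
  case True
  have inj: "inj_on ((*) m) (rough m)"
    using True by (auto simp: inj_on_def)
  have "rough_zeta s m = rough_zeta s (Suc m) + infsum (\<lambda>n. real n powr - s) ((*) m ` rough m)"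
    unfolding rough_zeta_def
    by (subst rough_Suc_prime(1)[OF True], rule infsum_Un_disjoint)
       (use rough_Suc_prime(2)[OF True] assms in \<open>auto intro: powr_summable_on\<close>)
  also have "infsum (\<lambda>n. real n powr - s) ((*) m ` rough m)
      = infsum (\<lambda>n. real m powr - s * real n powr - s) (rough m)"
    by (subst infsum_reindex[OF inj]) (auto simp: o_def powr_mult intro!: infsum_cong)
  also have "\<dots> = real m powr - s * rough_zeta s m"
    unfolding rough_zeta_def by (rule infsum_cmult_right') 
  finally show ?thesis using True by (simp add: algebra_simps)
next
  case False
  then show ?thesis by (simp add: rough_zeta_def rough_Suc_not_prime)
qed

lemma rough_zeta_prod:
  assumes "s > 1"
  shows "rough_zeta s N = rough_zeta s 0 * (\<Prod>n<N. if prime n then 1 - real n powr - s else 1)"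
  by (induction N) (simp_all add: rough_zeta_Suc[OF assms])

lemma rough_zeta_ge_1:
  assumes "s > 1"
  shows "rough_zeta s N \<ge> 1"
proof -
  have "infsum (\<lambda>n. real n powr - s) {1::nat} \<le> rough_zeta s N"
    unfolding rough_zeta_def
    by (rule infsum_mono_neutral) (use one_in_rough assms in \<open>auto intro: powr_summable_on\<close>)
  then show ?thesis by simp
qed

text \<open>An element of \<open>rough N\<close> other than 1 has a prime factor at least
  \<open>N\<close>, hence is itself at least \<open>N\<close>; so the excess over 1 is bounded by a
  tail of the convergent zeta series.\<close>

lemma rough_zeta_tendsto:
  assumes "s > 1"
  shows "rough_zeta s \<longlonglongrightarrow> 1"
proof (rule tendsto_sandwich[where f = "\<lambda>_. 1"])
  let ?f = "\<lambda>n. real n powr - s"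
  have sm: "summable ?f" using assms summable_real_powr_iff[of "-s"] by simp
  have lim: "(\<lambda>N. \<Sum>n. ?f (n + N)) \<longlonglongrightarrow> 0"
    using suminf_exist_split2[OF sm] by simp
  have "rough_zeta s N \<le> 1 + (\<Sum>n. ?f (n + N))" for N
  proof -
    have sub: "rough N \<subseteq> insert 1 {N..}"
    proof
      fix n assume n: "n \<in> rough N"
      show "n \<in> insert 1 {N..}"
      proof (cases "n = 1")
        case False
        then obtain p where "prime p" "p dvd n" using prime_factor_nat by blast
        then have "N \<le> p" "p \<le> n" using n by (auto simp: rough_def dvd_imp_le)
        then show ?thesis by auto
      qed auto
    qed
    have "rough_zeta s N \<le> infsum ?f (insert 1 {N..})"
      unfolding rough_zeta_def
      by (rule infsum_mono_neutral) (use sub assms in \<open>auto intro: powr_summable_on\<close>)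
    also have "\<dots> \<le> 1 + infsum ?f {N..}"
    proof (cases "1 \<in> {N..}")
      case True
      then have "insert 1 {N..} = {N..}" by auto
      then show ?thesis by simp
    next
      case False
      have "infsum ?f ({1} \<union> {N..}) = infsum ?f {1} + infsum ?f {N..}"
        by (rule infsum_Un_disjoint) (use False assms in \<open>auto intro: powr_summable_on\<close>)
      then show ?thesis by simp
    qed
    also have "infsum ?f {N..} = (\<Sum>n. ?f (n + N))"
    proof -
      have im: "{N..} = (\<lambda>n. n + N) ` UNIV" 
        using le_Suc_ex[of N] by (force simp: add.commute)
      have "infsum ?f {N..} = infsum (\<lambda>n. ?f (n + N)) UNIV"
        unfolding im by (subst infsum_reindex) (auto simp: inj_on_def o_def)
      also have "\<dots> = (\<Sum>n. ?f (n + N))"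
      proof -
        have "(\<lambda>n. ?f (n + N)) sums (\<Sum>n. ?f (n + N))"
          using sm by (intro summable_sums) (subst summable_iff_shift, simp)
        then have "((\<lambda>n. ?f (n + N)) has_sum (\<Sum>n. ?f (n + N))) UNIV"
          by (intro sums_nonneg_imp_has_sum) auto
        then show ?thesis by (rule infsumI)
      qed
      finally show ?thesis .
    qed
    finally show ?thesis .
  qed
  then show "\<forall>\<^sub>F N in sequentially. rough_zeta s N \<le> 1 + (\<Sum>n. ?f (n + N))" by simp
  show "(\<lambda>N. 1 + (\<Sum>n. ?f (n + N))) \<longlonglongrightarrow> 1"
    using tendsto_add[OF tendsto_const lim, of 1] by simp
  show "\<forall>\<^sub>F N in sequentially. 1 \<le> rough_zeta s N" using rough_zeta_ge_1[OF assms] by simp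
qed (rule tendsto_const)

text \<open>The integral test in telescoping form: the quotient is the integral of
  \<open>z powr - s\<close> over \<open>{x..x + 1}\<close>, which the mean value theorem turns into
  a value at an intermediate point.\<close>

lemma powr_diff_bounds:
  fixes s x :: real
  assumes "s > 1" "x > 0"
  shows "(x + 1) powr - s \<le> (x powr (1 - s) - (x + 1) powr (1 - s)) / (s - 1)"
    and "(x powr (1 - s) - (x + 1) powr (1 - s)) / (s - 1) \<le> x powr - s"
proof -
  have "\<exists>z. x < z \<and> z < x + 1 \<and> (x + 1) powr (1 - s) - x powr (1 - s) = (x + 1 - x) * ((1 - s) * z powr (1 - s - 1))"
    by (rule MVT2) (use assms in \<open>auto intro!: derivative_eq_intros\<close>)
  then obtain z where z: "x < z" "z < x + 1" "(x + 1) powr (1 - s) - x powr (1 - s) = (1 - s) * z powr - s"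
    by auto
  then have eq: "(x powr (1 - s) - (x + 1) powr (1 - s)) / (s - 1) = z powr - s"
    using assms by (simp add: field_simps)
  show "(x + 1) powr - s \<le> (x powr (1 - s) - (x + 1) powr (1 - s)) / (s - 1)"
    unfolding eq using z assms by (intro powr_mono2') auto
  show "(x powr (1 - s) - (x + 1) powr (1 - s)) / (s - 1) \<le> x powr - s"
    unfolding eq using z assms by (intro powr_mono2') auto
qed

text \<open>\<open>rough 0\<close> consists of all positive integers, so this is the Riemann zeta
  function at real \<open>s\<close>; both bounds come from summing the telescoping estimates, and
  they exhibit the simple pole at 1.\<close>

lemma rough_zeta_0_bounds:
  assumes "s > 1"
  shows "1 / (s - 1) \<le> rough_zeta s 0" "rough_zeta s 0 \<le> 1 + 1 / (s - 1)"
proof -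
  let ?f = "\<lambda>n. real n powr - s"
  let ?g = "\<lambda>n. real (Suc n) powr (1 - s) / (s - 1)"
  have sm: "summable (\<lambda>n. ?f (Suc n))"
    using assms summable_real_powr_iff[of "-s"] by (subst summable_Suc_iff) simp
  have eq: "rough_zeta s 0 = (\<Sum>n. ?f (Suc n))"
  proof -
    have im: "rough 0 = Suc ` UNIV"
      by (auto simp: rough_def image_iff Suc_le_eq gr0_conv_Suc)
    have "((\<lambda>n. ?f (Suc n)) has_sum (\<Sum>n. ?f (Suc n))) UNIV"
      by (intro sums_nonneg_imp_has_sum summable_sums sm) auto
    then show ?thesis
      unfolding rough_zeta_def im by (subst infsum_reindex) (auto simp: o_def intro: infsumI)
  qed
  have "filterlim (\<lambda>n. real (Suc n)) at_top sequentially"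
    using filterlim_real_sequentially filterlim_sequentially_Suc by blast
  then have "(\<lambda>n. real (Suc n) powr (1 - s)) \<longlonglongrightarrow> 0"
    using assms by (intro tendsto_neg_powr) auto
  then have "?g \<longlonglongrightarrow> 0" by (rule tendsto_divide_zero)
  then have tel: "(\<lambda>n. ?g n - ?g (Suc n)) sums (1 / (s - 1))"
    using telescope_sums'[of ?g 0] by simp
  have le1: "?f (Suc (Suc n)) \<le> ?g n - ?g (Suc n)" and le2: "?g n - ?g (Suc n) \<le> ?f (Suc n)" for n
    using powr_diff_bounds[OF assms, of "real (Suc n)"] by (auto simp: diff_divide_distrib add.commute)
  show "1 / (s - 1) \<le> rough_zeta s 0"
    unfolding eq by (rule sums_le[OF le2 tel summable_sums[OF sm]])
  have "(\<Sum>n. ?f (Suc (Suc n))) \<le> 1 / (s - 1)"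
    by (rule sums_le[OF le1 summable_sums tel]) (use sm in \<open>subst summable_Suc_iff\<close>)
  then show "rough_zeta s 0 \<le> 1 + 1 / (s - 1)"
    unfolding eq using suminf_split_head[OF sm] by simp
qed

definition prime_zeta :: "real \<Rightarrow> real" where
  "prime_zeta s = (\<Sum>n. if prime n then real n powr - s else 0)"

lemma summable_prime_powr:
  assumes "s > 1"
  shows "summable (\<lambda>n. if prime n then real n powr - s else 0)"
  by (rule summable_comparison_test'[of "\<lambda>n. real n powr - s" 0])
     (use assms summable_real_powr_iff[of "-s"] in auto)

text \<open>In the logarithm of the Euler product, \<open>ln (1 - a) + a\<close> is
  \<open>O(a ^ 2)\<close>, and \<open>a \<le> 1 / n\<close> makes these errors summable uniformly in
  \<open>s > 1\<close>. What remains is the logarithm of the pole. The cap 3 bounds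
  \<open>s / (s - 1)\<close> by \<open>3 / (s - 1)\<close> and corresponds to
  \<open>\<sigma> \<le> 3 / 2\<close> for \<open>s = 2 * \<sigma>\<close>.\<close>

lemma prime_zeta_asymp:
  "\<exists>C. \<forall>s>1. s \<le> 3 \<longrightarrow> \<bar>prime_zeta s - ln (1 / (s - 1))\<bar> \<le> C"
proof -
  define K where "K = (\<Sum>n. real n powr - 2)"
  have sm2: "summable (\<lambda>n. real n powr - 2)" using summable_real_powr_iff[of "-2"] by simp
  have main: "\<bar>prime_zeta s - ln (rough_zeta s 0)\<bar> \<le> 2 * K" if s: "s > 1" for s
  proof -
    let ?a = "\<lambda>n. if prime n then real n powr - s else 0"
    have a: "0 \<le> ?a n \<and> ?a n \<le> 1/2 \<and> (?a n)\<^sup>2 \<le> real n powr - 2" for n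
    proof (cases "prime n")
      case True
      then have n: "real n \<ge> 2" using prime_ge_2_nat by auto
      have le1: "real n powr - s \<le> real n powr - 1" using s n by (intro powr_mono) auto
      have "real n powr - 1 \<le> 1/2" using n by (simp add: powr_minus field_simps)
      moreover have "(real n powr - s)\<^sup>2 \<le> (real n powr - 1)\<^sup>2" using le1 by (intro power_mono) auto
      moreover have "(real n powr - 1)\<^sup>2 = real n powr - 2"
        by (simp only: power2_eq_square powr_add[symmetric]) simp
      ultimately have "(real n powr - s)\<^sup>2 \<le> real n powr - 2" "real n powr - s \<le> 1/2"
        using le1 by linarith+
      then show ?thesis using True by simp
    qed auto
    have lnr: "ln (rough_zeta s N) = ln (rough_zeta s 0) + (\<Sum>n<N. ln (1 - ?a n))" for N
    proof -
      have p: "(if prime n then 1 - real n powr - s else 1) = 1 - ?a n" for n by simp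
      have pos: "1 - ?a n > 0" for n using a[of n] by linarith
      have "ln (rough_zeta s N) = ln (rough_zeta s 0) + ln (\<Prod>n<N. 1 - ?a n)"
        using rough_zeta_prod[OF s, of N] rough_zeta_ge_1[OF s, of 0] unfolding p
        using prod_pos[of "{..<N}" "\<lambda>n. 1 - ?a n"] pos by (simp add: ln_mult_pos)
      also have "ln (\<Prod>n<N. 1 - ?a n) = (\<Sum>n<N. ln (1 - ?a n))"
        using pos by (intro ln_prod) (auto simp: less_imp_neq)
      finally show ?thesis .
    qed
    have "\<bar>(\<Sum>n<N. ?a n) - (ln (rough_zeta s 0) - ln (rough_zeta s N))\<bar> \<le> 2 * K" for N
    proof -
      have "(\<Sum>n<N. ?a n) - (ln (rough_zeta s 0) - ln (rough_zeta s N)) = (\<Sum>n<N. ln (1 + (- ?a n)) - (- ?a n))"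
        using lnr[of N] by (simp add: sum.distrib sum_subtractf sum_negf)
      also have "\<bar>\<dots>\<bar> \<le> (\<Sum>n<N. 2 * real n powr - 2)"
      proof (rule order_trans[OF sum_abs sum_mono])
        fix n
        have "\<bar>ln (1 + (- ?a n)) - (- ?a n)\<bar> \<le> 2 * (- ?a n)\<^sup>2"
          using a[of n] by (intro abs_ln_one_plus_x_minus_x_bound) auto
        also have "\<dots> \<le> 2 * real n powr - 2" using a[of n] by auto
        finally show "\<bar>ln (1 + (- ?a n)) - (- ?a n)\<bar> \<le> 2 * real n powr - 2" .
      qed
      also have "\<dots> = 2 * (\<Sum>n<N. real n powr - 2)" by (simp add: sum_distrib_left)
      also have "\<dots> \<le> 2 * K" unfolding K_def using sm2 by (intro mult_left_mono sum_le_suminf) auto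
      finally show ?thesis .
    qed
    moreover have "(\<lambda>N. \<bar>(\<Sum>n<N. ?a n) - (ln (rough_zeta s 0) - ln (rough_zeta s N))\<bar>)
       \<longlonglongrightarrow> \<bar>prime_zeta s - (ln (rough_zeta s 0) - ln 1)\<bar>"
      unfolding prime_zeta_def
      by (intro tendsto_intros rough_zeta_tendsto s summable_LIMSEQ summable_prime_powr) auto
    ultimately show ?thesis
      using LIMSEQ_le_const2 by (metis (no_types, lifting) diff_zero ln_one)
  qed
  have "\<bar>prime_zeta s - ln (1 / (s - 1))\<bar> \<le> 2 * K + ln 3" if s: "s > 1" "s \<le> 3" for s
  proof -
    have "ln (1 / (s - 1)) \<le> ln (rough_zeta s 0)"
      using rough_zeta_0_bounds(1)[OF s(1)] s by (intro ln_mono) auto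
    moreover have "ln (rough_zeta s 0) \<le> ln (3 * (1 / (s - 1)))"
    proof (intro ln_mono)
      show "0 < rough_zeta s 0" using rough_zeta_ge_1[OF s(1), of 0] by simp
      have "1 + 1 / (s - 1) = s / (s - 1)" using s by (simp add: field_simps)
      also have "\<dots> \<le> 3 / (s - 1)" using s by (intro divide_right_mono) auto
      finally have "1 + 1 / (s - 1) \<le> 3 * (1 / (s - 1))" by simp
      then show "rough_zeta s 0 \<le> 3 * (1 / (s - 1))" using rough_zeta_0_bounds(2)[OF s(1)] by simp
    qed
    moreover have "ln (3 * (1 / (s - 1))) = ln 3 + ln (1 / (s - 1))" using s by (intro ln_mult_pos) auto
    ultimately show ?thesis using main[OF s(1)] by linarith
  qed
  then show ?thesis by blast
qed

section \<open>The dilogarithm and the variance parameter psi\<close>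

definition dilog :: "real \<Rightarrow> real" where
  "dilog x = (\<Sum>n. x ^ Suc n / (real (Suc n))\<^sup>2)"

definition psi :: "real \<Rightarrow> real" where
  "psi \<sigma> = (\<Sum>n. if prime n then dilog (real n powr (- 2 * \<sigma>)) else 0)"

lemma dilog_sums:
  assumes "0 \<le> x" "x < 1"
  shows "(\<lambda>n. x ^ Suc n / (real (Suc n))\<^sup>2) sums dilog x"
proof -
  have "summable (\<lambda>n. x ^ Suc n / (real (Suc n))\<^sup>2)"
  proof (rule summable_comparison_test'[of "\<lambda>n. x ^ n" 0])
    show "summable ((^) x)" using assms by simp
    fix n
    have "x ^ Suc n / (real (Suc n))\<^sup>2 \<le> x ^ Suc n / 1"
      using assms by (intro divide_left_mono) auto
    also have "\<dots> \<le> x ^ n" using assms power_decreasing[of n "Suc n" x] by simp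
    finally show "norm (x ^ Suc n / (real (Suc n))\<^sup>2) \<le> x ^ n" using assms by simp
  qed
  then show ?thesis unfolding dilog_def by (rule summable_sums)
qed

lemma dilog_bounds:
  assumes "0 \<le> x" "x \<le> 1/2"
  shows "x \<le> dilog x" "dilog x \<le> x + x\<^sup>2" "dilog x \<le> 2 * x"
proof -
  have s: "(\<lambda>n. x ^ Suc (Suc n) / (real (Suc (Suc n)))\<^sup>2) sums (dilog x - x)"
    using dilog_sums[of x] assms by (subst sums_Suc_iff) simp
  have "0 \<le> dilog x - x" by (rule sums_le[OF _ sums_zero s]) (use assms in auto)
  then show "x \<le> dilog x" by simp
  have g: "(\<lambda>n. x\<^sup>2 / 2 * (1/2) ^ n) sums (x\<^sup>2 / 2 * (1 / (1 - 1/2)))"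
    by (intro sums_mult geometric_sums) auto
  have "dilog x - x \<le> x\<^sup>2 / 2 * (1 / (1 - 1/2))"
  proof (rule sums_le[OF _ s g])
    fix n
    have "x ^ Suc (Suc n) / (real (Suc (Suc n)))\<^sup>2 \<le> x ^ Suc (Suc n) / 2"
    proof (intro divide_left_mono)
      have "(1::real)\<^sup>2 + 1 \<le> (real (Suc (Suc n)))\<^sup>2"
        using power_mono[of 2 "real (Suc (Suc n))" 2] by simp
      then show "2 \<le> (real (Suc (Suc n)))\<^sup>2" by simp
    qed (use assms in auto)
    also have "\<dots> = x\<^sup>2 / 2 * x ^ n" by (simp add: power2_eq_square)
    also have "\<dots> \<le> x\<^sup>2 / 2 * (1/2) ^ n"
      using assms by (intro mult_left_mono power_mono) auto
    finally show "x ^ Suc (Suc n) / (real (Suc (Suc n)))\<^sup>2 \<le> x\<^sup>2 / 2 * (1/2) ^ n" .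
  qed
  then show b: "dilog x \<le> x + x\<^sup>2" by simp
  have "x\<^sup>2 \<le> x" using assms by (simp add: power2_eq_square mult_left_le)
  then show "dilog x \<le> 2 * x" using b by simp
qed

lemma prime_powr_bounds:
  assumes "prime p" "\<sigma> \<ge> 1/2"
  shows "0 < real p powr (- 2 * \<sigma>)" "real p powr (- 2 * \<sigma>) \<le> 1 / real p" "real p powr (- 2 * \<sigma>) \<le> 1/2"
proof -
  have p: "real p \<ge> 2" using prime_ge_2_nat[OF assms(1)] by simp
  then show "0 < real p powr (- 2 * \<sigma>)" by simp
  have "real p powr (- 2 * \<sigma>) \<le> real p powr - 1" using p assms by (intro powr_mono) auto
  also have "real p powr - 1 = 1 / real p" using p by (simp add: powr_minus field_simps)
  finally show le: "real p powr (- 2 * \<sigma>) \<le> 1 / real p" .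
  also have "1 / real p \<le> 1 / 2" using p by (intro divide_left_mono) auto
  finally show "real p powr (- 2 * \<sigma>) \<le> 1/2" .
qed

lemma summable_psi:
  assumes "\<sigma> > 1/2"
  shows "summable (\<lambda>n. if prime n then dilog (real n powr (- 2 * \<sigma>)) else 0)"
proof (rule summable_comparison_test'[of "\<lambda>n. 2 * (if prime n then real n powr - (2 * \<sigma>) else 0)" 0])
  show "summable (\<lambda>n. 2 * (if prime n then real n powr - (2 * \<sigma>) else 0))"
    using assms by (intro summable_mult summable_prime_powr) auto
  fix n
  show "norm (if prime n then dilog (real n powr (- 2 * \<sigma>)) else 0) \<le> 2 * (if prime n then real n powr - (2 * \<sigma>) else 0)"
    using dilog_bounds[of "real n powr (- 2 * \<sigma>)"] prime_powr_bounds[of n \<sigma>] assms by auto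
qed

text \<open>\<open>dilog x - x\<close> lies between 0 and \<open>x ^ 2\<close>, and
  \<open>x \<le> 1 / p\<close>; so the prime powers with \<open>k \<ge> 2\<close> contribute a
  bounded amount, uniformly as \<sigma> tends to 1/2.\<close>

lemma psi_prime_zeta:
  "\<exists>C. \<forall>\<sigma>>1/2. prime_zeta (2 * \<sigma>) \<le> psi \<sigma> \<and> psi \<sigma> \<le> prime_zeta (2 * \<sigma>) + C"
proof (intro exI allI impI)
  fix \<sigma> :: real assume s: "\<sigma> > 1/2"
  let ?a = "\<lambda>n. if prime n then real n powr - (2 * \<sigma>) else 0"
  let ?b = "\<lambda>n. if prime n then dilog (real n powr (- 2 * \<sigma>)) else 0"
  have sa: "summable ?a" and sb: "summable ?b" using s by (auto intro: summable_prime_powr summable_psi)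
  have s2: "summable (\<lambda>n. real n powr - 2)" using summable_real_powr_iff[of "-2"] by simp
  have 1: "?a n \<le> ?b n" for n
    using dilog_bounds[of "real n powr (- 2 * \<sigma>)"] prime_powr_bounds[of n \<sigma>] s by auto
  have 2: "?b n \<le> ?a n + real n powr - 2" for n
  proof (cases "prime n")
    case True
    let ?x = "real n powr (- 2 * \<sigma>)"
    have "?x\<^sup>2 \<le> (1 / real n)\<^sup>2" using prime_powr_bounds[OF True, of \<sigma>] s by (intro power_mono) auto
    also have "\<dots> = real n powr - 2" 
      using prime_gt_0_nat[OF True] by (simp add: powr_minus power_divide inverse_eq_divide)
    finally show ?thesis
      using dilog_bounds(2)[of ?x] prime_powr_bounds[OF True, of \<sigma>] s True by auto
  qed auto
  have "prime_zeta (2 * \<sigma>) \<le> psi \<sigma>"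
    unfolding prime_zeta_def psi_def using 1 sa sb by (intro suminf_le) auto
  moreover have "psi \<sigma> \<le> (\<Sum>n. ?a n + real n powr - 2)"
    unfolding psi_def using 2 sa sb s2 by (intro suminf_le summable_add) auto
  moreover have "(\<Sum>n. ?a n + real n powr - 2) = prime_zeta (2 * \<sigma>) + (\<Sum>n. real n powr - 2)"
    unfolding prime_zeta_def using sa s2 by (rule suminf_add[symmetric])
  ultimately show "prime_zeta (2 * \<sigma>) \<le> psi \<sigma> \<and> psi \<sigma> \<le> prime_zeta (2 * \<sigma>) + (\<Sum>n. real n powr - 2)"
    by simp
qed

lemma psi_asymp:
  "\<exists>C. \<forall>\<sigma>>1/2. \<sigma> \<le> 3/2 \<longrightarrow> \<bar>psi \<sigma> - ln (1 / (2 * \<sigma> - 1))\<bar> \<le> C"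
proof -
  obtain C1 where C1: "\<And>s. s > 1 \<Longrightarrow> s \<le> 3 \<Longrightarrow> \<bar>prime_zeta s - ln (1 / (s - 1))\<bar> \<le> C1"
    using prime_zeta_asymp by auto
  obtain C2 where C2: "\<And>\<sigma>. \<sigma> > 1/2 \<Longrightarrow> prime_zeta (2 * \<sigma>) \<le> psi \<sigma> \<and> psi \<sigma> \<le> prime_zeta (2 * \<sigma>) + C2"
    using psi_prime_zeta by auto
  have "\<bar>psi \<sigma> - ln (1 / (2 * \<sigma> - 1))\<bar> \<le> C1 + \<bar>C2\<bar>" if "\<sigma> > 1/2" "\<sigma> \<le> 3/2" for \<sigma>
    using C1[of "2 * \<sigma>"] C2[of \<sigma>] that by linarith
  then show ?thesis by blast
qed

text \<open>The prime 2 alone contributes at least \<open>2 powr - 3\<close>. A lower bound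
  independent of \<sigma> allows the range of bounded \<open>psi\<close> to be absorbed into
  constants.\<close>

lemma psi_ge:
  assumes "\<sigma> > 1/2" "\<sigma> \<le> 3/2"
  shows "psi \<sigma> \<ge> 1/8"
proof -
  let ?b = "\<lambda>n. if prime n then dilog (real n powr (- 2 * \<sigma>)) else 0"
  have nn: "?b n \<ge> 0" for n
    using dilog_bounds[of "real n powr (- 2 * \<sigma>)"] prime_powr_bounds[of n \<sigma>] assms by (cases "prime n") auto
  have "1/8 = (2::real) powr - 3" by (simp add: powr_minus)
  also have "\<dots> \<le> 2 powr (- 2 * \<sigma>)" using assms by (intro powr_mono) auto
  also have "\<dots> \<le> ?b 2"
    using dilog_bounds(1)[of "2 powr (- 2 * \<sigma>)"] prime_powr_bounds[of 2 \<sigma>] assms by auto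
  also have "\<dots> \<le> psi \<sigma>"
    unfolding psi_def using sum_le_suminf[OF summable_psi, of \<sigma> "{2}"] nn assms by auto
  finally show ?thesis .
qed

text \<open>The removed primes really contribute about \<open>ln (ln Y)\<close>; majorising them by
  the harmonic sum, hence by \<open>ln Y + 1\<close>, is enough, because \<open>Y\<close> will be
  polynomial in \<open>psi\<close>.\<close>

lemma sum_prime_powr_ge:
  "\<exists>C. \<forall>\<sigma>>1/2. \<forall>Y\<ge>1. psi \<sigma> - C - ln (real Y) \<le>
     (\<Sum>n. if prime n \<and> Y < n then real n powr (- 2 * \<sigma>) else 0)"
proof -
  obtain C2 where C2: "\<And>\<sigma>. \<sigma> > 1/2 \<Longrightarrow> prime_zeta (2 * \<sigma>) \<le> psi \<sigma> \<and> psi \<sigma> \<le> prime_zeta (2 * \<sigma>) + C2"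
    using psi_prime_zeta by auto
  have "psi \<sigma> - (C2 + 1) - ln (real Y) \<le> (\<Sum>n. if prime n \<and> Y < n then real n powr (- 2 * \<sigma>) else 0)"
    if s: "\<sigma> > 1/2" and Y: "Y \<ge> 1" for \<sigma> and Y :: nat
  proof -
    let ?a = "\<lambda>n. if prime n then real n powr - (2 * \<sigma>) else 0"
    let ?c = "\<lambda>n. if prime n \<and> Y < n then real n powr (- 2 * \<sigma>) else 0"
    have sa: "summable ?a" using s by (auto intro: summable_prime_powr)
    have sc: "summable ?c" by (rule summable_comparison_test'[OF sa, of 0]) auto
    have "prime_zeta (2 * \<sigma>) = (\<Sum>n. ?a (n + Suc Y)) + (\<Sum>n<Suc Y. ?a n)"
      unfolding prime_zeta_def by (rule suminf_split_initial_segment[OF sa])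
    also have "(\<Sum>n. ?a (n + Suc Y)) = (\<Sum>n. ?c n)"
      using suminf_split_initial_segment[OF sc, of "Suc Y"] by (auto intro!: suminf_cong)
    also have "(\<Sum>n<Suc Y. ?a n) \<le> harm Y"
    proof -
      have "(\<Sum>n<Suc Y. ?a n) = (\<Sum>n=1..Y. ?a n)"
        by (intro sum.mono_neutral_right) (auto simp: not_less_eq_eq)
      also have "\<dots> \<le> (\<Sum>n=1..Y. inverse (real n))"
      proof (intro sum_mono)
        fix n
        show "?a n \<le> inverse (real n)"
          using prime_powr_bounds(2)[of n \<sigma>] s by (cases "prime n") (simp_all add: inverse_eq_divide)
      qed
      also have "\<dots> = harm Y" by (simp add: harm_def)
      finally show ?thesis .
    qed
    also have "harm Y \<le> ln (real Y) + 1"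
      using euler_mascheroni_sequence_decreasing[of 1 Y] Y by (simp add: harm_def)
    finally show ?thesis using C2[OF s] by simp
  qed
  then show ?thesis by blast
qed

lemma psiT_eq:
  assumes "\<sigma> > 1/2" "sigmaT \<theta> T = \<sigma>"
  shows "psiT \<theta> T = psi \<sigma>"
proof -
  let ?b = "\<lambda>n. if prime n then dilog (real n powr (- 2 * \<sigma>)) else 0"
  have inner: "(\<Sum>\<^sub>\<infinity>k\<in>{1::nat..}. 1 / (real k)\<^sup>2 * real p powr (- 2 * real k * \<sigma>)) = dilog (real p powr (- 2 * \<sigma>))"
    if "prime p" for p
  proof -
    let ?x = "real p powr (- 2 * \<sigma>)"
    have x: "0 < ?x" "?x \<le> 1/2" using prime_powr_bounds[OF that, of \<sigma>] assms by auto
    have im: "{1::nat..} = Suc ` UNIV" by (auto simp: image_iff Suc_le_eq gr0_conv_Suc)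
    have "((\<lambda>n. ?x ^ Suc n / (real (Suc n))\<^sup>2) has_sum dilog ?x) UNIV"
      using x by (intro sums_nonneg_imp_has_sum dilog_sums) auto
    moreover have "?x ^ Suc n / (real (Suc n))\<^sup>2 = 1 / (real (Suc n))\<^sup>2 * real p powr (- 2 * real (Suc n) * \<sigma>)" for n
    proof -
      have "?x ^ Suc n = ?x powr real (Suc n)" using x by (simp only: powr_realpow)
      also have "\<dots> = real p powr (- 2 * real (Suc n) * \<sigma>)" by (simp add: powr_powr algebra_simps)
      finally show ?thesis by simp
    qed
    ultimately have "((\<lambda>n. 1 / (real (Suc n))\<^sup>2 * real p powr (- 2 * real (Suc n) * \<sigma>)) has_sum dilog ?x) UNIV"
      by (simp only:)
    then have "((\<lambda>k. 1 / (real k)\<^sup>2 * real p powr (- 2 * real k * \<sigma>)) has_sum dilog ?x) {1..}"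
      unfolding im by (subst has_sum_reindex) (simp_all only: o_def inj_Suc)
    then show ?thesis by (rule infsumI)
  qed
  have nn: "?b n \<ge> 0" for n
    using dilog_bounds[of "real n powr (- 2 * \<sigma>)"] prime_powr_bounds[of n \<sigma>] assms by (cases "prime n") auto
  have "psiT \<theta> T = (\<Sum>\<^sub>\<infinity>p\<in>{p. prime p}. dilog (real p powr (- 2 * \<sigma>)))"
    unfolding psiT_def assms(2) using inner by (intro infsum_cong) auto
  also have "\<dots> = infsum ?b UNIV"
    by (rule infsum_cong_neutral) auto
  also have "\<dots> = psi \<sigma>"
    unfolding psi_def
    using summable_sums[OF summable_psi[OF assms(1)]] nn
    by (intro infsumI sums_nonneg_imp_has_sum) auto
  finally show ?thesis .
qed

subsection \<open>The characteristic function of one Euler factor\<close>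

lemma cis_measurable [measurable]: "cis \<in> borel_measurable borel"
  by (intro borel_measurable_continuous_onI continuous_on_cis continuous_on_id)

lemma cnj_measurable [measurable]: "cnj \<in> borel_measurable borel"
  by (intro borel_measurable_continuous_onI continuous_intros)

lemma uniform_measure_circle_density:
  "uniform_measure lborel {0..2 * pi} = density lborel (\<lambda>x. ennreal (indicator {0..2 * pi} x / (2 * pi)))"
proof -
  have "indicator {0..2 * pi} x / emeasure lborel {0..2 * pi} = ennreal (indicator {0..2 * pi} x / (2 * pi))" for x :: real
    by (auto simp: indicator_def divide_ennreal simp flip: ennreal_1)
  then show ?thesis
    unfolding uniform_measure_def by simp
qed

lemma integral_uniform_circle:
  fixes f :: "complex \<Rightarrow> 'b :: {banach, second_countable_topology}"
  assumes [measurable]: "f \<in> borel_measurable borel"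
  shows "integral\<^sup>L uniform_circle f = (1 / (2 * pi)) *\<^sub>R (LBINT x:{0..2 * pi}. f (cis x))"
proof -
  have "integral\<^sup>L uniform_circle f = integral\<^sup>L (uniform_measure lborel {0..2 * pi}) (\<lambda>x. f (cis x))"
    unfolding uniform_circle_def by (subst integral_distr) auto
  also have "\<dots> = (LINT x|lborel. (indicator {0..2 * pi} x / (2 * pi)) *\<^sub>R f (cis x))"
    unfolding uniform_measure_circle_density by (subst integral_density) auto
  also have "\<dots> = (LINT x|lborel. (1 / (2 * pi)) *\<^sub>R (indicator {0..2 * pi} x *\<^sub>R f (cis x)))"
    by (intro Bochner_Integration.integral_cong) auto
  also have "\<dots> = (1 / (2 * pi)) *\<^sub>R (LBINT x:{0..2 * pi}. f (cis x))"
    unfolding set_lebesgue_integral_def by (rule Bochner_Integration.integral_scaleR_right)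
  finally show ?thesis .
qed

lemma sets_uniform_circle [measurable_cong, simp]: "sets uniform_circle = sets borel"
  and space_uniform_circle [simp]: "space uniform_circle = UNIV"
  by (simp_all add: uniform_circle_def)

lemma prob_space_uniform_circle: "prob_space uniform_circle"
proof -
  interpret prob_space "uniform_measure lborel {0..2 * pi}"
    by (rule prob_space_uniform_measure) auto
  show ?thesis unfolding uniform_circle_def by (rule prob_space_distr) simp
qed

lemma AE_uniform_circle: "AE X in uniform_circle. norm X = 1"
proof -
  show ?thesis
    unfolding uniform_circle_def by (subst AE_distr_iff) auto
qed

lemma AE_uniform_circleI:
  assumes "\<And>X. norm X = 1 \<Longrightarrow> P X"
  shows "AE X in uniform_circle. P X"
  using AE_uniform_circle by eventually_elim (rule assms)

lemma circle_moment:
  "(\<integral>X. X ^ m * cnj X ^ n \<partial>uniform_circle) = (if m = n then 1 else 0)"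
proof -
  have eq: "cis x ^ m * cnj (cis x) ^ n = cis ((real m - real n) * x)" for x
    by (simp add: cis_cnj Complex.DeMoivre cis_mult algebra_simps)
  have "(\<integral>X. X ^ m * cnj X ^ n \<partial>uniform_circle) = (1 / (2 * pi)) *\<^sub>R (LBINT x:{0..2 * pi}. cis ((real m - real n) * x))"
    by (subst integral_uniform_circle) (simp_all add: eq)
  also have "(LBINT x:{0..2 * pi}. cis ((real m - real n) * x)) = (if m = n then of_real (2 * pi) else 0)"
  proof (cases "m = n")
    case True
    then show ?thesis by (simp add: set_integral_const scaleR_conv_of_real)
  next
    case False
    define k where "k = real m - real n"
    have k: "k \<noteq> 0" using False by (simp add: k_def)
    have "((\<lambda>x. cis (k * x)) has_integral (cis (k * (2 * pi)) / (\<i> * k) - cis (k * 0) / (\<i> * k))) {0..2 * pi}"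
    proof (rule fundamental_theorem_of_calculus)
      fix x
      show "((\<lambda>x. cis (k * x) / (\<i> * k)) has_vector_derivative cis (k * x)) (at x within {0..2 * pi})"
      proof -
        have "((\<lambda>x. iexp (k * x)) has_vector_derivative k *\<^sub>R (\<i> * iexp (k * x))) (at x within {0..2 * pi})"
        proof (rule vector_diff_chain_within[of "\<lambda>x. k * x" k x "{0..2 * pi}" iexp "\<i> * iexp (k * x)", unfolded o_def])
          show "((*) k has_vector_derivative k) (at x within {0..2 * pi})"
            by (auto intro!: derivative_eq_intros)
          show "(iexp has_vector_derivative \<i> * iexp (k * x)) (at (k * x) within (*) k ` {0..2 * pi})"
            by (rule has_vector_derivative_iexp)
        qed
        then have "((\<lambda>x. iexp (k * x) / (\<i> * k)) has_vector_derivative k *\<^sub>R (\<i> * iexp (k * x)) / (\<i> * k)) (at x within {0..2 * pi})"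
          by (rule has_vector_derivative_divide)
        then show ?thesis using k by (simp add: cis_conv_exp scaleR_conv_of_real)
      qed
    qed simp
    moreover have "cis (k * (2 * pi)) = 1"
    proof -
      have "cis (2 * pi * of_int (int m - int n)) = 1" by (rule cis_multiple_2pi) simp
      then show ?thesis by (simp add: k_def mult_ac)
    qed
    ultimately have "((\<lambda>x. cis (k * x)) has_integral 0) {0..2 * pi}" by simp
    moreover have "set_integrable lborel {0..2 * pi} (\<lambda>x. cis (k * x))"
      unfolding set_integrable_def
      by (intro borel_integrable_compact continuous_intros continuous_on_cis) auto
    ultimately show ?thesis
      using False unfolding k_def by (metis (no_types, lifting) integral_unique set_borel_integral_eq_integral(2))
  qed
  finally show ?thesis by (simp add: scaleR_conv_of_real)
qed

text \<open>Integration term by term in two stages: the second series against a single monomial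
  \<open>X ^ m\<close> leaves \<open>b m\<close>, and the first series is then summed over
  \<open>m\<close>; absolute summability dominates both exchanges. The form is bilinear, with the
  conjugation on \<open>X\<close> and not on the coefficients, because the second factor in the
  application is a series in \<open>cnj X\<close> with its own complex exponent.\<close>

lemma circle_parseval:
  fixes a b :: "nat \<Rightarrow> complex"
  assumes a: "summable (\<lambda>n. norm (a n))" and b: "summable (\<lambda>n. norm (b n))"
  shows "(\<lambda>n. a n * b n) sums (\<integral>X. (\<Sum>n. a n * X ^ n) * (\<Sum>n. b n * cnj X ^ n) \<partial>uniform_circle)"
proof -
  interpret prob_space uniform_circle by (rule prob_space_uniform_circle)
  have [simp]: "measure uniform_circle UNIV = 1" using prob_space by simp
  define B where "B = (\<lambda>X. \<Sum>n. b n * cnj X ^ n)"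
  have Bm [measurable]: "B \<in> borel_measurable borel" unfolding B_def by measurable
  have Bb: "norm (B X) \<le> (\<Sum>n. norm (b n))" if "norm X = 1" for X
  proof -
    have "norm (B X) \<le> (\<Sum>n. norm (b n * cnj X ^ n))"
      unfolding B_def by (rule summable_norm) (use b that in \<open>simp add: norm_mult norm_power\<close>)
    then show ?thesis using that by (simp add: norm_mult norm_power)
  qed
  have int1: "integrable uniform_circle (\<lambda>X. X ^ m * (b n * cnj X ^ n))" for m n
    by (rule integrable_const_bound[where B = "norm (b n)"], rule AE_uniform_circleI)
       (simp_all add: norm_mult norm_power)
  have le1: "(\<integral>X. norm (X ^ m * (b n * cnj X ^ n)) \<partial>uniform_circle) = norm (b n)" for m n
  proof -
    have "(\<integral>X. norm (X ^ m * (b n * cnj X ^ n)) \<partial>uniform_circle) = (\<integral>X. norm (b n) \<partial>uniform_circle)"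
    proof (rule integral_cong_AE)
      show "AE X in uniform_circle. norm (X ^ m * (b n * cnj X ^ n)) = norm (b n)"
        by (rule AE_uniform_circleI) (simp add: norm_mult norm_power)
    qed measurable
    then show ?thesis by simp
  qed
  have in1: "(\<integral>X. X ^ m * B X \<partial>uniform_circle) = b m" for m
  proof -
    have s1: "(\<lambda>n. \<integral>X. X ^ m * (b n * cnj X ^ n) \<partial>uniform_circle) sums (\<integral>X. (\<Sum>n. X ^ m * (b n * cnj X ^ n)) \<partial>uniform_circle)"
      by (rule sums_integral[OF int1], rule AE_uniform_circleI)
         (simp_all only: le1 b, use b in \<open>simp add: norm_mult norm_power\<close>)
    have e1: "(\<integral>X. X ^ m * (b n * cnj X ^ n) \<partial>uniform_circle) = (if n = m then b m else 0)" for n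
    proof -
      have "(\<integral>X. X ^ m * (b n * cnj X ^ n) \<partial>uniform_circle) = (\<integral>X. b n * (X ^ m * cnj X ^ n) \<partial>uniform_circle)"
        by (simp add: mult_ac)
      also have "\<dots> = b n * (\<integral>X. X ^ m * cnj X ^ n \<partial>uniform_circle)" by simp
      finally show ?thesis by (simp add: circle_moment)
    qed
    have "(\<lambda>n. if n = m then b m else 0) sums b m" by (rule sums_single)
    with s1[unfolded e1] have "(\<integral>X. (\<Sum>n. X ^ m * (b n * cnj X ^ n)) \<partial>uniform_circle) = b m"
      by (rule sums_unique2)
    moreover have "(\<integral>X. (\<Sum>n. X ^ m * (b n * cnj X ^ n)) \<partial>uniform_circle) = (\<integral>X. X ^ m * B X \<partial>uniform_circle)"
    proof (rule integral_cong_AE)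
      show "AE X in uniform_circle. (\<Sum>n. X ^ m * (b n * cnj X ^ n)) = X ^ m * B X"
      proof (rule AE_uniform_circleI)
        fix X :: complex assume "norm X = 1"
        then have "summable (\<lambda>n. b n * cnj X ^ n)"
          by (intro summable_norm_cancel[of "\<lambda>n. b n * cnj X ^ n"]) (use b in \<open>simp add: norm_mult norm_power\<close>)
        then show "(\<Sum>n. X ^ m * (b n * cnj X ^ n)) = X ^ m * B X" unfolding B_def by (rule suminf_mult)
      qed
    qed measurable
    ultimately show ?thesis by simp
  qed
  define K where "K = (\<Sum>n. norm (b n))"
  have K0: "K \<ge> 0" unfolding K_def by (intro suminf_nonneg b) auto
  have int2: "integrable uniform_circle (\<lambda>X. a m * X ^ m * B X)" for m
  proof (rule integrable_const_bound[where B = "norm (a m) * K"])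
    show "AE X in uniform_circle. norm (a m * X ^ m * B X) \<le> norm (a m) * K"
      by (rule AE_uniform_circleI) (simp add: norm_mult norm_power K_def Bb mult_left_mono)
  qed measurable
  have le2: "(\<integral>X. norm (a m * X ^ m * B X) \<partial>uniform_circle) \<le> norm (a m) * K" for m
  proof -
    have "(\<integral>X. norm (a m * X ^ m * B X) \<partial>uniform_circle) \<le> (\<integral>X. norm (a m) * K \<partial>uniform_circle)"
    proof (rule integral_mono_AE)
      show "AE X in uniform_circle. norm (a m * X ^ m * B X) \<le> norm (a m) * K"
        by (rule AE_uniform_circleI) (simp add: norm_mult norm_power K_def Bb mult_left_mono)
    qed (use int2 in auto)
    then show ?thesis by simp
  qed
  have "(\<lambda>m. \<integral>X. a m * X ^ m * B X \<partial>uniform_circle) sums (\<integral>X. (\<Sum>m. a m * X ^ m * B X) \<partial>uniform_circle)"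
  proof (rule sums_integral[OF int2])
    show "AE X in uniform_circle. summable (\<lambda>m. norm (a m * X ^ m * B X))"
      by (rule AE_uniform_circleI)
         (use summable_mult2[OF a] in \<open>simp add: norm_mult norm_power\<close>)
    show "summable (\<lambda>m. \<integral>X. norm (a m * X ^ m * B X) \<partial>uniform_circle)"
      by (rule summable_comparison_test'[OF summable_mult2[OF a, of K], of 0]) (use le2 in simp)
  qed
  moreover have "(\<integral>X. a m * X ^ m * B X \<partial>uniform_circle) = a m * b m" for m
  proof -
    have "(\<integral>X. a m * X ^ m * B X \<partial>uniform_circle) = (\<integral>X. a m * (X ^ m * B X) \<partial>uniform_circle)"
      by (simp add: mult_ac)
    then show ?thesis by (simp add: in1)
  qed
  moreover have "(\<integral>X. (\<Sum>m. a m * X ^ m * B X) \<partial>uniform_circle) = (\<integral>X. (\<Sum>m. a m * X ^ m) * B X \<partial>uniform_circle)"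
  proof (rule integral_cong_AE)
    show "AE X in uniform_circle. (\<Sum>n. a n * X ^ n * B X) = (\<Sum>n. a n * X ^ n) * B X"
    proof (rule AE_uniform_circleI)
      fix X :: complex assume "norm X = 1"
      then have "summable (\<lambda>n. a n * X ^ n)"
        by (intro summable_norm_cancel[of "\<lambda>n. a n * X ^ n"]) (use a in \<open>simp add: norm_mult norm_power\<close>)
      then show "(\<Sum>n. a n * X ^ n * B X) = (\<Sum>n. a n * X ^ n) * B X" by (rule suminf_mult2[symmetric])
    qed
  qed measurable
  ultimately show ?thesis unfolding B_def by simp
qed

text \<open>The next two definitions give the hypergeometric series \<open>\<^sub>2F\<^sub>1(\<alpha>, \<beta>; 1; x)\<close> with
  \<open>\<alpha> + \<beta> = \<i> u\<close> and \<open>\<alpha> \<beta> = - b\<close>, written as \<open>1 - b * local_G x u b\<close>.\<close>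

definition local_prod :: "real \<Rightarrow> real \<Rightarrow> nat \<Rightarrow> complex" where
  "local_prod u b n = (\<Prod>j=1..<n. 1 + \<i> * of_real u / of_nat j - of_real b / (of_nat j)\<^sup>2)"

definition local_G :: "real \<Rightarrow> real \<Rightarrow> real \<Rightarrow> complex" where
  "local_G x u b = (\<Sum>n. of_real (x ^ Suc n / (real (Suc n))\<^sup>2) * local_prod u b (Suc n))"

lemma summable_binomial:
  fixes \<alpha> z :: complex
  assumes "norm z < 1"
  shows "summable (\<lambda>n. norm ((\<alpha> gchoose n) * z ^ n))"
proof -
  obtain r where r: "norm z < r" "r < 1" using dense[OF assms] by blast
  have r0: "r > 0" using r norm_ge_zero[of z] by linarith
  show ?thesis
    by (rule powser_insidea[where x = "of_real r"])
       (use gen_binomial_complex[of "of_real r" \<alpha>] r r0 in \<open>auto simp: sums_iff\<close>)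
qed

text \<open>With \<open>L\<close> the logarithm,
  \<open>\<i> * Re (cnj t * L) = \<alpha> * L + \<beta> * cnj L\<close> for
  \<open>\<alpha> = \<i> * cnj t / 2\<close> and \<open>\<beta> = \<i> * t / 2\<close>. The
  integrand is thus \<open>(1 - z X) powr - \<alpha>\<close> times
  \<open>(1 - z cnj X) powr - \<beta>\<close>, and Parseval pairs the two binomial series. Only
  \<open>\<alpha> + \<beta> = \<i> * Re t\<close> and \<open>\<alpha> * \<beta> = - b\<close>
  survive, which is why the result depends on \<open>t\<close> through \<open>Re t\<close> and its
  norm alone.\<close>

lemma local_char:
  fixes z :: real and t :: complex
  assumes z: "0 \<le> z" "z < 1"
  defines "b \<equiv> (cmod t)\<^sup>2 / 4"
  shows "(\<integral>X. cis (Re (cnj t * (- Ln (1 - of_real z * X)))) \<partial>uniform_circle) = 1 - of_real b * local_G (z\<^sup>2) (Re t) b"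
proof -
  define \<alpha> where "\<alpha> = \<i> * cnj t / 2"
  define \<beta> where "\<beta> = \<i> * t / 2"
  define f where "f n = (- \<alpha> gchoose n) * (- of_real z) ^ n" for n
  define g where "g n = (- \<beta> gchoose n) * (- of_real z) ^ n" for n
  have sf: "summable (\<lambda>n. norm (f n))" and sg: "summable (\<lambda>n. norm (g n))"
    unfolding f_def g_def by (rule summable_binomial, use z in simp)+
  have pt: "cis (Re (cnj t * (- Ln (1 - of_real z * X)))) = (\<Sum>n. f n * X ^ n) * (\<Sum>n. g n * cnj X ^ n)"
    if X: "norm X = 1" for X
  proof -
    define L where "L = - Ln (1 - of_real z * X)"
    have nX: "norm (- of_real z * X) < 1" "norm (- of_real z * cnj X) < 1" using X z by (simp_all add: norm_mult)
    have Rez: "Re (of_real z * X) < 1"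
      using complex_Re_le_cmod[of "of_real z * X"] X z by (simp add: norm_mult)
    have npos: "1 - of_real z * X \<notin> \<real>\<^sub>\<le>\<^sub>0"
      using Rez by (auto simp: complex_nonpos_Reals_iff)
    have n0: "1 - of_real z * X \<noteq> 0" "1 - of_real z * cnj X \<noteq> 0"
      using Rez by (auto simp: complex_eq_iff)
    have cL: "cnj L = - Ln (1 - of_real z * cnj X)"
      unfolding L_def using cnj_Ln[OF npos] by simp
    have "cis (Re (cnj t * L)) = exp (\<alpha> * L + \<beta> * cnj L)"
    proof -
      have "\<i> * of_real (Re (cnj t * L)) = \<alpha> * L + \<beta> * cnj L"
        unfolding \<alpha>_def \<beta>_def by (simp add: complex_eq_iff field_simps)
      then show ?thesis by (simp add: cis_conv_exp)
    qed
    also have "\<dots> = (1 + - of_real z * X) powr (- \<alpha>) * (1 + - of_real z * cnj X) powr (- \<beta>)"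
    proof -
      have "exp (\<alpha> * L) = (1 + - of_real z * X) powr (- \<alpha>)"
        using n0 by (simp add: powr_def L_def)
      moreover have "exp (\<beta> * cnj L) = (1 + - of_real z * cnj X) powr (- \<beta>)"
        using n0 unfolding cL by (simp add: powr_def)
      ultimately show ?thesis by (simp add: exp_add)
    qed
    also have "(1 + - of_real z * X) powr (- \<alpha>) = (\<Sum>n. f n * X ^ n)"
      using sums_unique[OF gen_binomial_complex[OF nX(1), of "- \<alpha>"]]
      by (simp only: f_def power_mult_distrib mult.assoc)
    also have "(1 + - of_real z * cnj X) powr (- \<beta>) = (\<Sum>n. g n * cnj X ^ n)"
      using sums_unique[OF gen_binomial_complex[OF nX(2), of "- \<beta>"]]
      by (simp only: g_def power_mult_distrib mult.assoc)
    finally show ?thesis unfolding L_def .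
  qed
  have I: "(\<integral>X. cis (Re (cnj t * (- Ln (1 - of_real z * X)))) \<partial>uniform_circle)
      = (\<integral>X. (\<Sum>n. f n * X ^ n) * (\<Sum>n. g n * cnj X ^ n) \<partial>uniform_circle)"
  proof (rule integral_cong_AE)
    show "AE X in uniform_circle. cis (Re (cnj t * (- Ln (1 - of_real z * X)))) = (\<Sum>n. f n * X ^ n) * (\<Sum>n. g n * cnj X ^ n)"
      by (rule AE_uniform_circleI) (rule pt)
  qed measurable
  have S: "(\<lambda>n. f n * g n) sums (\<integral>X. cis (Re (cnj t * (- Ln (1 - of_real z * X)))) \<partial>uniform_circle)"
    unfolding I by (rule circle_parseval[OF sf sg])
  \<comment> \<open>The ratio of consecutive terms is
    \<open>(- \<alpha> - n) * (- \<beta> - n) / (n + 1) ^ 2\<close> times the square of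
    \<open>z\<close>. Multiplied out, the numerator is symmetric in \<alpha> and \<beta>; dividing
    it by \<open>n ^ 2\<close> gives the factors of \<open>local_prod\<close>.\<close>
  have rec: "f (Suc n) * g (Suc n) = f n * g n * (of_real (z\<^sup>2) * ((of_nat n)\<^sup>2 + \<i> * Re t * of_nat n - b) / (of_nat (Suc n))\<^sup>2)" for n
  proof -
    have gS: "(a gchoose Suc n) = (a gchoose n) * (a - of_nat n) / of_nat (Suc n)" for a :: complex
      by (simp add: gbinomial_prod_rev mult.commute)
    have sum_eq: "\<alpha> + \<beta> = \<i> * Re t" unfolding \<alpha>_def \<beta>_def by (simp add: complex_eq_iff)
    have prod_eq: "\<alpha> * \<beta> = - of_real b"
    proof -
      have "\<alpha> * \<beta> = - (t * cnj t) / 4" unfolding \<alpha>_def \<beta>_def by (simp add: field_simps)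
      also have "\<dots> = - of_real b" by (simp add: b_def complex_norm_square[symmetric] flip: of_real_power)
      finally show ?thesis .
    qed
    have "(- \<alpha> - of_nat n) * (- \<beta> - of_nat n) = (of_nat n)\<^sup>2 + (\<alpha> + \<beta>) * of_nat n + \<alpha> * \<beta>"
      by (simp add: algebra_simps power2_eq_square)
    then have k: "(- \<alpha> - of_nat n) * (- \<beta> - of_nat n) = (of_nat n)\<^sup>2 + \<i> * Re t * of_nat n - b"
      unfolding sum_eq prod_eq by simp
    show ?thesis
      unfolding f_def g_def gS k[symmetric] by (simp add: power2_eq_square field_simps del: of_nat_Suc)
  qed
  have cf: "f (Suc n) * g (Suc n) = - (of_real b * (of_real ((z\<^sup>2) ^ Suc n / (real (Suc n))\<^sup>2) * local_prod (Re t) b (Suc n)))" for n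
  proof (induction n)
    case 0
    show ?case by (subst rec) (simp add: f_def g_def local_prod_def)
  next
    case (Suc n)
    have P: "local_prod (Re t) b (Suc (Suc n)) = local_prod (Re t) b (Suc n) *
       (((of_nat (Suc n))\<^sup>2 + \<i> * Re t * of_nat (Suc n) - b) / (of_nat (Suc n))\<^sup>2)"
    proof -
      have "1 + \<i> * of_real (Re t) / of_nat (Suc n) - of_real b / (of_nat (Suc n))\<^sup>2 = ((of_nat (Suc n))\<^sup>2 + \<i> * Re t * of_nat (Suc n) - b) / (of_nat (Suc n))\<^sup>2"
        by (simp add: field_simps power2_eq_square del: of_nat_Suc)
      then show ?thesis unfolding local_prod_def by (simp del: of_nat_Suc)
    qed
    show ?case
      by (subst rec, subst Suc.IH, subst P) (simp add: field_simps del: of_nat_Suc)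
  qed
  have S1: "(\<lambda>n. - (of_real b * (of_real ((z\<^sup>2) ^ Suc n / (real (Suc n))\<^sup>2) * local_prod (Re t) b (Suc n))))
    sums ((\<integral>X. cis (Re (cnj t * (- Ln (1 - of_real z * X)))) \<partial>uniform_circle) - 1)"
    using S unfolding cf[symmetric] by (subst sums_Suc_iff) (simp add: f_def g_def)
  have S2: "(\<lambda>n. of_real b * (of_real ((z\<^sup>2) ^ Suc n / (real (Suc n))\<^sup>2) * local_prod (Re t) b (Suc n)))
    sums (1 - (\<integral>X. cis (Re (cnj t * (- Ln (1 - of_real z * X)))) \<partial>uniform_circle))"
    using sums_minus[OF S1] by simp
  \<comment> \<open>The factor \<open>b\<close> has to be divided out of the series; for
    \<open>b = 0\<close> every term vanishes and the identity is read off directly.\<close>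
  have eq: "of_real b * local_G (z\<^sup>2) (Re t) b = 1 - (\<integral>X. cis (Re (cnj t * (- Ln (1 - of_real z * X)))) \<partial>uniform_circle)"
  proof (cases "b = 0")
    case True
    then show ?thesis using S2 by (simp add: sums_iff)
  next
    case False
    then have "(\<lambda>n. of_real ((z\<^sup>2) ^ Suc n / (real (Suc n))\<^sup>2) * local_prod (Re t) b (Suc n))
      sums ((1 - (\<integral>X. cis (Re (cnj t * (- Ln (1 - of_real z * X)))) \<partial>uniform_circle)) / of_real b)"
      using sums_divide[OF S2, of "of_real b"] by simp
    then show ?thesis using False unfolding local_G_def by (simp add: sums_iff)
  qed
  show "(\<integral>X. cis (Re (cnj t * (- Ln (1 - of_real z * X)))) \<partial>uniform_circle) = 1 - of_real b * local_G (z\<^sup>2) (Re t) b"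
    unfolding eq by simp
qed

section \<open>Size of the local factor\<close>

lemma local_prod_Suc:
  assumes "n \<ge> 1"
  shows "local_prod u b (Suc n) = local_prod u b n *
    (1 + \<i> * of_real u * of_real (inverse (real n)) + (- of_real b) * of_real ((inverse (real n))\<^sup>2))"
  using assms unfolding local_prod_def
  by (simp add: divide_inverse power_inverse)

lemma local_prod_1 [simp]: "local_prod u b (Suc 0) = 1"
  by (simp add: local_prod_def)

lemma norm_local_factor_le:
  fixes \<alpha> \<beta> :: complex
  assumes "0 \<le> r"
  shows "norm (1 + \<alpha> * of_real r + \<beta> * of_real (r\<^sup>2)) \<le> 1 + norm \<alpha> * r + norm \<beta> * r\<^sup>2"
proof -
  have "norm (1 + \<alpha> * of_real r + \<beta> * of_real (r\<^sup>2)) \<le> norm (1::complex) + norm (\<alpha> * of_real r) + norm (\<beta> * of_real (r\<^sup>2))"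
    by (intro norm_triangle_mono norm_triangle_ineq order_refl)
  then show ?thesis using assms by (simp add: norm_mult norm_power)
qed

lemma norm_local_prod_le:
  assumes "0 \<le> b" "1 + \<bar>u\<bar> + b \<le> s"
  shows "norm (local_prod u b (Suc n)) \<le> s ^ n"
proof (induction n)
  case (Suc n)
  define r where "r = inverse (real (Suc n))"
  have r: "0 \<le> r" "r \<le> 1" by (auto simp: r_def field_simps)
  have "norm (1 + \<i> * of_real u * of_real r + (- of_real b) * of_real (r\<^sup>2)) \<le> 1 + \<bar>u\<bar> * r + b * r\<^sup>2"
    using norm_local_factor_le[OF r(1), of "\<i> * of_real u" "- of_real b"] assms by (simp add: norm_mult)
  also have "\<dots> \<le> 1 + \<bar>u\<bar> * 1 + b * 1"
    using r assms by (intro add_mono mult_left_mono power_le_one) auto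
  also have "\<dots> \<le> s" using assms by simp
  finally have f: "norm (1 + \<i> * of_real u * of_real r + (- of_real b) * of_real (r\<^sup>2)) \<le> s" .
  have "norm (local_prod u b (Suc (Suc n))) \<le> s ^ n * s"
  proof (subst local_prod_Suc)
    have "s \<ge> 0" using assms by linarith
    then show "norm (local_prod u b (Suc n) * (1 + \<i> * of_real u * of_real (inverse (real (Suc n)))
        + (- of_real b) * of_real ((inverse (real (Suc n)))\<^sup>2))) \<le> s ^ n * s"
      unfolding norm_mult r_def[symmetric] using Suc f by (intro mult_mono) auto
  qed simp
  then show ?case by (simp add: mult.commute)
qed simp

text \<open>The first term of the series is \<open>x\<close>. Each factor of
  \<open>local_prod\<close> has norm at most \<open>s\<close>, so the remaining terms are dominated
  by a geometric series of ratio \<open>x * s \<le> 1/8\<close>, whose sum \<open>x / 7\<close>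
  stays below \<open>x / 2\<close>.\<close>

lemma local_G_near:
  assumes "0 \<le> x" "0 \<le> b" "1 + \<bar>u\<bar> + b \<le> s" "x * s \<le> 1/8"
  shows "norm (local_G x u b - of_real x) \<le> x / 2"
proof -
  define c where "c n = of_real (x ^ Suc n / (real (Suc n))\<^sup>2) * local_prod u b (Suc n)" for n
  have s0: "s \<ge> 0" using assms by linarith
  have bd: "norm (c (Suc n)) \<le> x * (1/8) ^ Suc n" for n
  proof -
    have "norm (c (Suc n)) = x ^ Suc (Suc n) / (real (Suc (Suc n)))\<^sup>2 * norm (local_prod u b (Suc (Suc n)))"
      using assms unfolding c_def norm_mult norm_of_real by simp
    also have "\<dots> \<le> x ^ Suc (Suc n) / 1 * s ^ Suc n"
      using assms norm_local_prod_le[OF assms(2,3), of "Suc n"]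
      by (intro mult_mono divide_left_mono) (auto simp del: power_Suc)
    also have "\<dots> = x * (x * s) ^ Suc n" by (simp add: power_mult_distrib)
    also have "\<dots> \<le> x * (1/8) ^ Suc n"
      using assms s0 by (intro mult_left_mono power_mono) auto
    finally show ?thesis .
  qed
  have g: "(\<lambda>n. x * (1/8) ^ Suc n) sums (x * (1/8) * (1 / (1 - 1/8)))"
    using sums_mult[OF geometric_sums[of "1/8::real"], of "x * (1/8)"] by (simp add: mult.assoc)
  have sc: "summable (\<lambda>n. c (Suc n))"
    by (rule summable_comparison_test'[OF sums_summable[OF g], of 0]) (rule bd)
  then have sc': "summable c" by (subst (asm) summable_Suc_iff)
  have "local_G x u b - of_real x = (\<Sum>n. c (Suc n))"
  proof -
    have "c 0 = of_real x" by (simp add: c_def)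
    then show ?thesis using suminf_split_head[OF sc'] unfolding local_G_def c_def[symmetric] by simp
  qed
  also have "norm \<dots> \<le> (\<Sum>n. x * (1/8) ^ Suc n)"
    by (rule norm_suminf_le[OF bd sums_summable[OF g]])
  also have "\<dots> = x / 7" using sums_unique[OF g] by simp
  finally show ?thesis using assms by simp
qed

text \<open>The factor is \<open>1 - b * x\<close> up to half of its deviation from 1. Since
  \<open>b \<le> s\<close>, the product \<open>b * x\<close> is at most 1/8, so
  \<open>1 - b * x\<close> is its own absolute value and the bound \<open>1 - b * x / 2\<close>
  results.\<close>

lemma local_factor_decay:
  assumes "0 \<le> x" "0 \<le> b" "1 + \<bar>u\<bar> + b \<le> s" "x * s \<le> 1/8"
  shows "norm (1 - of_real b * local_G x u b) \<le> exp (- b * x / 2)"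
proof -
  have "x * b \<le> x * s" using assms by (intro mult_left_mono) auto
  then have bx: "b * x \<le> 1/8" using assms by (simp add: mult.commute)
  have "1 - of_real b * local_G x u b = of_real (1 - b * x) - of_real b * (local_G x u b - of_real x)"
    by (simp add: algebra_simps)
  then have "norm (1 - of_real b * local_G x u b) \<le> norm (of_real (1 - b * x) :: complex) + norm (of_real b * (local_G x u b - of_real x))"
    using norm_triangle_ineq4 by metis
  also have "\<dots> \<le> (1 - b * x) + b * (x / 2)"
  proof (intro add_mono)
    show "norm (of_real (1 - b * x) :: complex) \<le> 1 - b * x"
      using bx by (subst norm_of_real) simp
    show "norm (of_real b * (local_G x u b - of_real x)) \<le> b * (x / 2)"
      using mult_left_mono[OF local_G_near[OF assms] assms(2)] assms by (simp add: norm_mult)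
  qed
  also have "\<dots> = 1 + (- b * x / 2)" by simp
  also have "\<dots> \<le> exp (- b * x / 2)" by (rule exp_ge_add_one_self)
  finally show ?thesis .
qed

text \<open>\<open>c\<close> with indices \<open>k\<close>, \<open>l\<close> is the coefficient of \<open>\<alpha> ^ k * \<beta> ^ l\<close> in
  \<open>\<Prod>1\<le>j<n. (1 + \<alpha> / j + \<beta> / j\<^sup>2)\<close>. Here \<open>\<alpha>\<close> has weight 1 and \<open>\<beta>\<close> has weight 2, and weights up to 3 are kept;
  the excess terms of one multiplication step are collected in \<open>extra\<close> below.\<close>

definition c10 :: "nat \<Rightarrow> real" where "c10 n = (\<Sum>j=1..<n. inverse (real j))"
definition c01 :: "nat \<Rightarrow> real" where "c01 n = (\<Sum>j=1..<n. (inverse (real j))\<^sup>2)"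
definition c20 :: "nat \<Rightarrow> real" where "c20 n = (\<Sum>j=1..<n. c10 j * inverse (real j))"
definition c30 :: "nat \<Rightarrow> real" where "c30 n = (\<Sum>j=1..<n. c20 j * inverse (real j))"
definition c11 :: "nat \<Rightarrow> real" where
  "c11 n = (\<Sum>j=1..<n. c10 j * (inverse (real j))\<^sup>2 + c01 j * inverse (real j))"

text \<open>Polymorphic for a purpose: complex arguments give the expansion of
  \<open>local_prod\<close>, while the real value at \<open>(1, 1)\<close> is the sum of the
  nonnegative coefficients and serves as its majorant.\<close>

definition trunc :: "nat \<Rightarrow> 'a \<Rightarrow> 'a \<Rightarrow> 'a :: real_normed_field" where
  "trunc n \<alpha> \<beta> = 1 + of_real (c10 n) * \<alpha> + of_real (c20 n) * \<alpha>\<^sup>2 + of_real (c30 n) * \<alpha> ^ 3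
     + of_real (c01 n) * \<beta> + of_real (c11 n) * (\<alpha> * \<beta>)"

definition extra :: "nat \<Rightarrow> 'a \<Rightarrow> 'a \<Rightarrow> 'a :: real_normed_field" where
  "extra n \<alpha> \<beta> = of_real (c30 n * inverse (real n)) * \<alpha> ^ 4
     + of_real (c20 n * (inverse (real n))\<^sup>2 + c11 n * inverse (real n)) * (\<alpha>\<^sup>2 * \<beta>)
     + of_real (c30 n * (inverse (real n))\<^sup>2) * (\<alpha> ^ 3 * \<beta>)
     + of_real (c01 n * (inverse (real n))\<^sup>2) * \<beta>\<^sup>2
     + of_real (c11 n * (inverse (real n))\<^sup>2) * (\<alpha> * \<beta>\<^sup>2)"

lemma trunc_Suc:
  fixes \<alpha> \<beta> :: "'a :: real_normed_field"
  assumes "n \<ge> 1"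
  shows "trunc n \<alpha> \<beta> * (1 + \<alpha> * of_real (inverse (real n)) + \<beta> * of_real ((inverse (real n))\<^sup>2))
     = trunc (Suc n) \<alpha> \<beta> + extra n \<alpha> \<beta>"
proof -
  define r where "r = inverse (real n)"
  have c: "c10 (Suc n) = c10 n + r" "c01 (Suc n) = c01 n + r\<^sup>2" "c20 (Suc n) = c20 n + c10 n * r"
    "c30 (Suc n) = c30 n + c20 n * r" "c11 (Suc n) = c11 n + (c10 n * r\<^sup>2 + c01 n * r)"
    using assms by (simp_all add: c10_def c01_def c20_def c30_def c11_def r_def)
  show ?thesis
    unfolding trunc_def extra_def c r_def[symmetric] of_real_add of_real_mult of_real_power
    by algebra
qed

lemma coeffs_nonneg: "c10 n \<ge> 0" "c01 n \<ge> 0" "c20 n \<ge> 0" "c30 n \<ge> 0" "c11 n \<ge> 0"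
proof -
  show 1: "c10 n \<ge> 0" for n unfolding c10_def by (intro sum_nonneg) auto
  show 2: "c01 n \<ge> 0" for n unfolding c01_def by (intro sum_nonneg) auto
  show 3: "c20 n \<ge> 0" for n unfolding c20_def using 1 by (intro sum_nonneg) auto
  show "c30 n \<ge> 0" unfolding c30_def using 3 by (intro sum_nonneg) auto
  show "c11 n \<ge> 0" unfolding c11_def using 1 2 by (intro sum_nonneg) auto
qed

text \<open>Every monomial in \<open>extra\<close> has weight at least 4, hence is at most
  \<open>\<tau> ^ 4\<close> for \<open>\<tau> \<le> 1\<close>; the coefficients are nonnegative, so
  they add up to the value at \<open>(1, 1)\<close>.\<close>

lemma norm_extra_le:
  fixes \<alpha> \<beta> :: "'a :: real_normed_field"
  assumes "norm \<alpha> \<le> \<tau>" "norm \<beta> \<le> \<tau>\<^sup>2" "0 \<le> \<tau>" "\<tau> \<le> 1"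
  shows "norm (extra n \<alpha> \<beta>) \<le> \<tau> ^ 4 * extra n 1 1"
proof -
  have t5: "\<tau> ^ 5 \<le> \<tau> ^ 4" using assms by (intro power_decreasing) auto
  have m1: "norm (\<alpha> ^ 4) \<le> \<tau> ^ 4" using assms by (simp add: norm_power power_mono)
  have m2: "norm (\<alpha>\<^sup>2 * \<beta>) \<le> \<tau> ^ 4"
  proof -
    have "norm (\<alpha>\<^sup>2 * \<beta>) \<le> \<tau>\<^sup>2 * \<tau>\<^sup>2" unfolding norm_mult norm_power
      using assms by (intro mult_mono power_mono) auto
    then show ?thesis by (simp flip: power_add)
  qed
  have m3: "norm (\<alpha> ^ 3 * \<beta>) \<le> \<tau> ^ 4"
  proof -
    have "norm (\<alpha> ^ 3 * \<beta>) \<le> \<tau> ^ 3 * \<tau>\<^sup>2" unfolding norm_mult norm_power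
      using assms by (intro mult_mono power_mono) auto
    then show ?thesis using t5 by (simp flip: power_add)
  qed
  have m4: "norm (\<beta>\<^sup>2) \<le> \<tau> ^ 4"
  proof -
    have "norm (\<beta>\<^sup>2) \<le> (\<tau>\<^sup>2)\<^sup>2" unfolding norm_power using assms by (intro power_mono) auto
    then show ?thesis by (simp flip: power_mult)
  qed
  have m5: "norm (\<alpha> * \<beta>\<^sup>2) \<le> \<tau> ^ 4"
  proof -
    have "norm (\<alpha> * \<beta>\<^sup>2) \<le> \<tau> * (\<tau>\<^sup>2)\<^sup>2" unfolding norm_mult norm_power
      using assms by (intro mult_mono power_mono) auto
    also have "\<dots> = \<tau> ^ 5" by (simp add: power2_eq_square power_numeral_reduce)
    finally show ?thesis using t5 by simp
  qed
  have k: "norm (of_real k * m) \<le> k * \<tau> ^ 4" if "k \<ge> 0" "norm m \<le> \<tau> ^ 4" for k and m :: 'a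
    using that by (simp add: norm_mult mult_left_mono)
  have "norm (extra n \<alpha> \<beta>) \<le>
      c30 n * inverse (real n) * \<tau> ^ 4
     + (c20 n * (inverse (real n))\<^sup>2 + c11 n * inverse (real n)) * \<tau> ^ 4
     + c30 n * (inverse (real n))\<^sup>2 * \<tau> ^ 4
     + c01 n * (inverse (real n))\<^sup>2 * \<tau> ^ 4
     + c11 n * (inverse (real n))\<^sup>2 * \<tau> ^ 4"
    unfolding extra_def
    by (intro norm_triangle_mono k m1 m2 m3 m4 m5 add_nonneg_nonneg mult_nonneg_nonneg coeffs_nonneg) auto
  also have "\<dots> = \<tau> ^ 4 * extra n 1 1" unfolding extra_def by (simp add: algebra_simps)
  finally show ?thesis .
qed

text \<open>The product with \<alpha> = \<beta> = 1, which majorises all coefficients at once. It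
  grows at most like \<open>n ^ 2\<close>, since
  \<open>m ^ 2 * (1 + 1 / m + 1 / m ^ 2) \<le> (m + 1) ^ 2\<close>, and this is exactly compensated
  by the weights \<open>x ^ n / n ^ 2\<close> of the hypergeometric series.\<close>

definition maj_prod :: "nat \<Rightarrow> real" where
  "maj_prod n = (\<Prod>j=1..<n. 1 + 1 * of_real (inverse (real j)) + 1 * of_real ((inverse (real j))\<^sup>2))"

lemma maj_prod_le: "maj_prod (Suc n) \<le> (real (Suc n))\<^sup>2"
proof (induction n)
  case (Suc n)
  let ?m = "real (Suc n)"
  have "maj_prod (Suc (Suc n)) = maj_prod (Suc n) * (1 + inverse ?m + (inverse ?m)\<^sup>2)"
    by (simp add: maj_prod_def)
  also have "\<dots> \<le> ?m\<^sup>2 * (1 + inverse ?m + (inverse ?m)\<^sup>2)"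
    using Suc by (intro mult_right_mono add_nonneg_nonneg) auto
  also have "\<dots> = ?m\<^sup>2 + ?m + 1" by (simp add: field_simps power2_eq_square del: of_nat_Suc)
  also have "\<dots> \<le> (real (Suc (Suc n)))\<^sup>2" by (simp add: power2_eq_square algebra_simps)
  finally show ?case .
qed (simp add: maj_prod_def)

text \<open>Majorant principle: the omitted part is a polynomial in \<alpha> and \<beta> with
  nonnegative coefficients and weights at least 4, so for \<open>|\<alpha>| \<le> \<tau>\<close> and
  \<open>|\<beta>| \<le> \<tau> ^ 2\<close> it is at most \<open>\<tau> ^ 4\<close> times its value
  at \<open>(1, 1)\<close>. The induction carries this comparison through one factor at a
  time.\<close>

lemma local_prod_trunc:
  assumes "\<bar>u\<bar> \<le> \<tau>" "0 \<le> b" "b \<le> \<tau>\<^sup>2" "0 \<le> \<tau>" "\<tau> \<le> 1"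
  shows "norm (local_prod u b (Suc n) - trunc (Suc n) (\<i> * of_real u) (- of_real b))
     \<le> \<tau> ^ 4 * (maj_prod (Suc n) - trunc (Suc n) 1 1)"
proof (induction n)
  case 0
  show ?case by (simp add: trunc_def maj_prod_def c10_def c01_def c20_def c30_def c11_def)
next
  case (Suc n)
  define \<alpha> where "\<alpha> = \<i> * of_real u"
  define \<beta> where "\<beta> = - complex_of_real b"
  have ab: "norm \<alpha> \<le> \<tau>" "norm \<beta> \<le> \<tau>\<^sup>2" using assms by (simp_all add: \<alpha>_def \<beta>_def norm_mult)
  define r where "r = inverse (real (Suc n))"
  have r: "r \<ge> 0" by (simp add: r_def)
  define f where "f = 1 + \<alpha> * of_real r + \<beta> * of_real (r\<^sup>2)"
  have nf: "norm f \<le> 1 + r + r\<^sup>2"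
  proof -
    have "norm f \<le> 1 + norm \<alpha> * r + norm \<beta> * r\<^sup>2" unfolding f_def by (rule norm_local_factor_le[OF r])
    also have "\<dots> \<le> 1 + 1 * r + 1 * r\<^sup>2"
      using ab assms r power_le_one[of \<tau> 2] by (intro add_mono mult_right_mono) auto
    finally show ?thesis by simp
  qed
  let ?T = "trunc (Suc n) \<alpha> \<beta>"
  have "local_prod u b (Suc (Suc n)) - trunc (Suc (Suc n)) \<alpha> \<beta> = (local_prod u b (Suc n) - ?T) * f + extra (Suc n) \<alpha> \<beta>"
    using trunc_Suc[of "Suc n" \<alpha> \<beta>] local_prod_Suc[of "Suc n" u b]
    unfolding f_def r_def \<alpha>_def \<beta>_def by (simp add: algebra_simps)
  then have "norm (local_prod u b (Suc (Suc n)) - trunc (Suc (Suc n)) \<alpha> \<beta>)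
      \<le> norm (local_prod u b (Suc n) - ?T) * norm f + norm (extra (Suc n) \<alpha> \<beta>)"
    by (metis norm_mult norm_triangle_ineq)
  also have "\<dots> \<le> (\<tau> ^ 4 * (maj_prod (Suc n) - trunc (Suc n) 1 1)) * (1 + r + r\<^sup>2) + \<tau> ^ 4 * extra (Suc n) 1 1"
    using Suc nf norm_extra_le[OF ab assms(4,5), of "Suc n"] unfolding \<alpha>_def \<beta>_def
    by (intro add_mono mult_mono) (auto intro: order_trans[OF norm_ge_zero])
  also have "\<dots> = \<tau> ^ 4 * (maj_prod (Suc n) * (1 + r + r\<^sup>2) - (trunc (Suc n) 1 1 * (1 + r + r\<^sup>2) - extra (Suc n) 1 1))"
    by (simp add: algebra_simps)
  also have "trunc (Suc n) 1 1 * (1 + r + r\<^sup>2) - extra (Suc n) 1 1 = trunc (Suc (Suc n)) 1 1"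
    using trunc_Suc[of "Suc n" "1::real" 1] by (simp add: r_def)
  also have "maj_prod (Suc n) * (1 + r + r\<^sup>2) = maj_prod (Suc (Suc n))"
    by (simp add: maj_prod_def r_def)
  finally show ?case unfolding \<alpha>_def \<beta>_def .
qed

section \<open>Power series with no linear term\<close>

definition coef_seq :: "(nat \<Rightarrow> real) \<Rightarrow> bool" where
  "coef_seq c \<longleftrightarrow> (\<forall>n. 0 \<le> c (Suc n) \<and> c (Suc n) \<le> (real (Suc n))\<^sup>2)"

lemma coef_seqs: "coef_seq c10" "coef_seq c01" "coef_seq c20" "coef_seq c30" "coef_seq c11"
proof -
  \<comment> \<open>The remainder estimate at \<open>u = b = 0\<close>, \<open>\<tau> = 1\<close>
    bounds a norm, so its right-hand side is nonnegative; this already says that the truncation at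
    \<open>(1, 1)\<close> does not exceed the full product.\<close>
  have "trunc (Suc n) 1 1 \<le> (real (Suc n))\<^sup>2" for n
    using order_trans[OF norm_ge_zero local_prod_trunc[of 0 1 0 n]] maj_prod_le[of n] by simp
  then have "1 + c10 (Suc n) + c20 (Suc n) + c30 (Suc n) + c01 (Suc n) + c11 (Suc n) \<le> (real (Suc n))\<^sup>2" for n
    unfolding trunc_def by simp
  then have "c10 (Suc n) \<le> (real (Suc n))\<^sup>2 \<and> c20 (Suc n) \<le> (real (Suc n))\<^sup>2 \<and> c30 (Suc n) \<le> (real (Suc n))\<^sup>2
    \<and> c01 (Suc n) \<le> (real (Suc n))\<^sup>2 \<and> c11 (Suc n) \<le> (real (Suc n))\<^sup>2" for n
  proof -
    have "1 + c10 (Suc n) + c20 (Suc n) + c30 (Suc n) + c01 (Suc n) + c11 (Suc n) \<le> (real (Suc n))\<^sup>2" by fact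
    then show ?thesis using coeffs_nonneg[of "Suc n"] by (intro conjI) linarith+
  qed
  then show "coef_seq c10" "coef_seq c01" "coef_seq c20" "coef_seq c30" "coef_seq c11"
    using coeffs_nonneg unfolding coef_seq_def by blast+
qed


definition wsum :: "(nat \<Rightarrow> real) \<Rightarrow> real \<Rightarrow> real" where
  "wsum c x = (\<Sum>n. x ^ Suc n / (real (Suc n))\<^sup>2 * c (Suc n))"

lemma weighted_term_le:
  assumes "0 \<le> x" "0 \<le> c" "c \<le> (real (Suc n))\<^sup>2"
  shows "x ^ Suc n / (real (Suc n))\<^sup>2 * c \<le> x ^ Suc n"
proof -
  have "x ^ Suc n / (real (Suc n))\<^sup>2 * c \<le> x ^ Suc n / (real (Suc n))\<^sup>2 * (real (Suc n))\<^sup>2"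
    using assms by (intro mult_left_mono) auto
  then show ?thesis by (simp del: of_nat_Suc power_Suc)
qed

lemma wsum_sums:
  assumes "coef_seq c" "0 \<le> x" "x \<le> 1/2"
  shows "(\<lambda>n. x ^ Suc n / (real (Suc n))\<^sup>2 * c (Suc n)) sums wsum c x"
proof -
  have "summable (\<lambda>n. x ^ Suc n / (real (Suc n))\<^sup>2 * c (Suc n))"
  proof (rule summable_comparison_test'[of "\<lambda>n. x ^ Suc n" 0])
    show "summable (\<lambda>n. x ^ Suc n)" using assms by (subst summable_Suc_iff) auto
    fix n
    have "0 \<le> x ^ Suc n / (real (Suc n))\<^sup>2 * c (Suc n)" using assms by (auto simp: coef_seq_def)
    then show "norm (x ^ Suc n / (real (Suc n))\<^sup>2 * c (Suc n)) \<le> x ^ Suc n"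
      using weighted_term_le[of x "c (Suc n)" n] assms by (simp add: coef_seq_def)
  qed
  then show ?thesis unfolding wsum_def by (rule summable_sums)
qed

lemma power_diff_le:
  fixes x y :: real
  assumes "0 \<le> y" "y \<le> x"
  shows "x ^ Suc m - y ^ Suc m \<le> real (Suc m) * x ^ m * (x - y)"
proof (induction m)
  case (Suc m)
  have "x ^ Suc (Suc m) - y ^ Suc (Suc m) = x * (x ^ Suc m - y ^ Suc m) + y ^ Suc m * (x - y)"
    by (simp add: algebra_simps)
  also have "\<dots> \<le> x * (real (Suc m) * x ^ m * (x - y)) + x ^ Suc m * (x - y)"
    using Suc assms by (intro add_mono mult_left_mono mult_right_mono power_mono) auto
  also have "\<dots> = real (Suc (Suc m)) * x ^ Suc m * (x - y)" by (simp add: algebra_simps)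
  finally show ?case .
qed simp

text \<open>The two bounds shared by power series starting at \<open>x ^ 2\<close>, and their two
  uses: the quadratic bound makes the sum of \<open>f (1 / p)\<close> over primes converge, and the
  Lipschitz bound with its extra factor \<open>x\<close> controls the replacement of
  \<open>p powr (- 2 * \<sigma>)\<close> by \<open>1 / p\<close>.\<close>

definition quad_small :: "(real \<Rightarrow> real) \<Rightarrow> bool" where
  "quad_small f \<longleftrightarrow> (\<exists>C\<ge>0. \<forall>x y. 0 \<le> y \<longrightarrow> y \<le> x \<longrightarrow> x \<le> 1/2 \<longrightarrow>
     \<bar>f x - f y\<bar> \<le> C * x * (x - y) \<and> \<bar>f x\<bar> \<le> C * x\<^sup>2)"

text \<open>\<open>c 1 = 0\<close> removes the linear term. In the others,
  \<open>x ^ m - y ^ m \<le> m * x ^ (m - 1) * (x - y)\<close> with \<open>m \<ge> 2\<close> still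
  contains a factor \<open>x\<close>, and the remaining powers of \<open>x \<le> 1/2\<close> are
  summed against the weight \<open>m\<close>; this sum is the constant \<open>K\<close>.\<close>

lemma wsum_quad_small:
  assumes c: "coef_seq c" and c1: "c 1 = 0"
  shows "quad_small (wsum c)"
proof -
  define K where "K = (\<Sum>n. real (Suc (Suc n)) * (1/2) ^ n :: real)"
  have sK: "summable (\<lambda>n. real (Suc (Suc n)) * (1/2) ^ n :: real)"
  proof -
    have "summable (\<lambda>n. real (Suc n) * (1/2) ^ n :: real)"
      using geometric_deriv_sums[of "1/2::real"] by (simp add: sums_iff)
    moreover have "summable (\<lambda>n. (1/2) ^ n :: real)" by simp
    ultimately have "summable (\<lambda>n. real (Suc n) * (1/2) ^ n + (1/2) ^ n :: real)" by (rule summable_add)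
    then show ?thesis by (simp add: algebra_simps)
  qed
  have K0: "K \<ge> 0" unfolding K_def by (intro suminf_nonneg sK) auto
  have L: "\<bar>wsum c x - wsum c y\<bar> \<le> K * x * (x - y)" if xy: "0 \<le> y" "y \<le> x" "x \<le> 1/2" for x y
  proof -
    define d where "d n = (x ^ Suc n / (real (Suc n))\<^sup>2 * c (Suc n)) - (y ^ Suc n / (real (Suc n))\<^sup>2 * c (Suc n))" for n
    have "d sums (wsum c x - wsum c y)"
      unfolding d_def using xy by (intro sums_diff wsum_sums c) auto
    moreover have "d 0 = 0" using c1 by (simp add: d_def)
    ultimately have S: "(\<lambda>n. d (Suc n)) sums (wsum c x - wsum c y)"
      by (subst sums_Suc_iff) simp
    have G: "(\<lambda>n. (x * (x - y)) * (real (Suc (Suc n)) * (1/2) ^ n)) sums ((x * (x - y)) * K)"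
      unfolding K_def by (intro sums_mult summable_sums sK)
    have dn: "d n = (x ^ Suc n - y ^ Suc n) / (real (Suc n))\<^sup>2 * c (Suc n)" for n
      by (simp add: d_def diff_divide_distrib left_diff_distrib)
    have pd: "0 \<le> x ^ Suc n - y ^ Suc n" for n using xy by (simp add: power_mono del: power_Suc)
    have "0 \<le> wsum c x - wsum c y"
      by (rule sums_le[OF _ sums_zero S]) (use pd c in \<open>auto simp only: dn coef_seq_def intro!: mult_nonneg_nonneg divide_nonneg_nonneg\<close>, simp_all)
    moreover have "wsum c x - wsum c y \<le> (x * (x - y)) * K"
    proof (rule sums_le[OF _ S G])
      fix n
      have "d (Suc n) \<le> (x ^ Suc (Suc n) - y ^ Suc (Suc n)) / (real (Suc (Suc n)))\<^sup>2 * (real (Suc (Suc n)))\<^sup>2"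
        unfolding dn using pd[of "Suc n"] c by (intro mult_left_mono) (auto simp only: coef_seq_def intro!: divide_nonneg_nonneg, simp_all)
      also have "\<dots> = x ^ Suc (Suc n) - y ^ Suc (Suc n)" by (simp del: of_nat_Suc power_Suc)
      also have "\<dots> \<le> real (Suc (Suc n)) * x ^ Suc n * (x - y)" using xy by (intro power_diff_le) auto
      also have "\<dots> = x * (x - y) * real (Suc (Suc n)) * x ^ n" by (simp add: algebra_simps)
      also have "\<dots> \<le> x * (x - y) * real (Suc (Suc n)) * (1/2) ^ n"
        using xy by (intro mult_left_mono power_mono mult_nonneg_nonneg) auto
      finally show "d (Suc n) \<le> (x * (x - y)) * (real (Suc (Suc n)) * (1/2) ^ n)" by (simp add: mult.assoc)
    qed
    ultimately show ?thesis by (simp add: mult_ac)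
  qed
  have z: "wsum c 0 = 0" by (simp add: wsum_def)
  show ?thesis unfolding quad_small_def
  proof (intro exI[of _ K] conjI K0 allI impI)
    fix x y :: real assume xy: "0 \<le> y" "y \<le> x" "x \<le> 1/2"
    show "\<bar>wsum c x - wsum c y\<bar> \<le> K * x * (x - y)" by (rule L[OF xy])
    show "\<bar>wsum c x\<bar> \<le> K * x\<^sup>2" using L[of 0 x] xy z by (simp add: power2_eq_square mult.assoc)
  qed
qed

lemma coef_at_1: "c10 1 = 0" "c01 1 = 0" "c20 1 = 0" "c30 1 = 0" "c11 1 = 0"
  by (simp_all add: c10_def c01_def c20_def c30_def c11_def)

lemmas coef_quad_small =
  wsum_quad_small[OF coef_seqs(1) coef_at_1(1)] wsum_quad_small[OF coef_seqs(2) coef_at_1(2)]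
  wsum_quad_small[OF coef_seqs(3) coef_at_1(3)] wsum_quad_small[OF coef_seqs(4) coef_at_1(4)]
  wsum_quad_small[OF coef_seqs(5) coef_at_1(5)]

lemma quad_small_diff:
  assumes "quad_small f" "quad_small g"
  shows "quad_small (\<lambda>x. f x - g x)"
proof -
  obtain C1 where C1: "C1 \<ge> 0" "\<And>x y. 0 \<le> y \<Longrightarrow> y \<le> x \<Longrightarrow> x \<le> 1/2 \<Longrightarrow> \<bar>f x - f y\<bar> \<le> C1 * x * (x - y) \<and> \<bar>f x\<bar> \<le> C1 * x\<^sup>2"
    using assms(1) unfolding quad_small_def by blast
  obtain C2 where C2: "C2 \<ge> 0" "\<And>x y. 0 \<le> y \<Longrightarrow> y \<le> x \<Longrightarrow> x \<le> 1/2 \<Longrightarrow> \<bar>g x - g y\<bar> \<le> C2 * x * (x - y) \<and> \<bar>g x\<bar> \<le> C2 * x\<^sup>2"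
    using assms(2) unfolding quad_small_def by blast
  show ?thesis unfolding quad_small_def
  proof (intro exI[of _ "C1 + C2"] conjI allI impI)
    fix x y :: real assume xy: "0 \<le> y" "y \<le> x" "x \<le> 1/2"
    have "(C1 + C2) * x * (x - y) = C1 * x * (x - y) + C2 * x * (x - y)" "(C1 + C2) * x\<^sup>2 = C1 * x\<^sup>2 + C2 * x\<^sup>2"
      by (simp_all add: algebra_simps)
    then show "\<bar>(f x - g x) - (f y - g y)\<bar> \<le> (C1 + C2) * x * (x - y)" "\<bar>f x - g x\<bar> \<le> (C1 + C2) * x\<^sup>2"
      using C1(2)[OF xy] C2(2)[OF xy] by auto
  qed (use C1 C2 in auto)
qed

lemma dilog_lipschitz:
  "\<exists>L\<ge>0. \<forall>x y. 0 \<le> y \<longrightarrow> y \<le> x \<longrightarrow> x \<le> 1/2 \<longrightarrow> \<bar>dilog x - dilog y\<bar> \<le> L * (x - y)"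
proof -
  \<comment> \<open>With these coefficients \<open>wsum c\<close> is \<open>dilog\<close> without
    its linear term, so the Lipschitz bound is inherited from the quadratic case.\<close>
  define c :: "nat \<Rightarrow> real" where "c n = (if n = 1 then 0 else 1)" for n
  have c: "coef_seq c"
  proof -
    have "1 \<le> (real (Suc n))\<^sup>2" for n by simp
    then show ?thesis unfolding coef_seq_def c_def by auto
  qed
  have dl: "dilog x = x + wsum c x" if "0 \<le> x" "x \<le> 1/2" for x
  proof -
    have "(\<lambda>n. x ^ Suc n / (real (Suc n))\<^sup>2 - (if n = 0 then x else 0)) sums (dilog x - x)"
      using that by (intro sums_diff dilog_sums sums_single) auto
    moreover have "x ^ Suc n / (real (Suc n))\<^sup>2 - (if n = 0 then x else 0) = x ^ Suc n / (real (Suc n))\<^sup>2 * c (Suc n)" for n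
      by (auto simp: c_def)
    ultimately have "(\<lambda>n. x ^ Suc n / (real (Suc n))\<^sup>2 * c (Suc n)) sums (dilog x - x)" by simp
    from sums_unique2[OF this wsum_sums[OF c that]] show ?thesis by simp
  qed
  obtain C where C: "C \<ge> 0" "\<And>x y. 0 \<le> y \<Longrightarrow> y \<le> x \<Longrightarrow> x \<le> 1/2 \<Longrightarrow> \<bar>wsum c x - wsum c y\<bar> \<le> C * x * (x - y)"
    using wsum_quad_small[OF c] unfolding quad_small_def c_def by auto
  show ?thesis
  proof (intro exI[of _ "1 + C"] conjI allI impI)
    fix x y :: real assume xy: "0 \<le> y" "y \<le> x" "x \<le> 1/2"
    have "\<bar>dilog x - dilog y\<bar> \<le> (x - y) + \<bar>wsum c x - wsum c y\<bar>" using xy by (simp add: dl)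
    also have "\<dots> \<le> (x - y) + C * x * (x - y)" using C(2)[OF xy] by simp
    also have "C * x * (x - y) \<le> C * 1 * (x - y)" using xy C by (intro mult_right_mono mult_left_mono) auto
    finally show "\<bar>dilog x - dilog y\<bar> \<le> (1 + C) * (x - y)" by (simp add: algebra_simps)
  qed (use C in auto)
qed

lemma dilog_abs:
  assumes "0 \<le> x" "x \<le> 1/2"
  shows "\<bar>dilog x\<bar> \<le> 2 * x"
  using dilog_bounds[OF assms] assms by simp

text \<open>A product of two functions that are both Lipschitz and \<open>O(x)\<close> gains a
  factor \<open>x\<close> in either bound. The alternative in the hypothesis covers the square of
  \<open>dilog\<close> together with its products with \<open>quad_small\<close> functions; both
  cases enter only through these two properties.\<close>

lemma quad_small_dilog_mult:
  assumes "quad_small f \<or> f = dilog"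
  shows "quad_small (\<lambda>x. dilog x * f x)"
proof -
  obtain L where L: "L \<ge> 0" "\<And>x y. 0 \<le> y \<Longrightarrow> y \<le> x \<Longrightarrow> x \<le> 1/2 \<Longrightarrow> \<bar>dilog x - dilog y\<bar> \<le> L * (x - y)"
    using dilog_lipschitz by blast
  have "\<exists>C\<ge>0. \<forall>x y. 0 \<le> y \<longrightarrow> y \<le> x \<longrightarrow> x \<le> 1/2 \<longrightarrow> \<bar>f x - f y\<bar> \<le> C * (x - y) \<and> \<bar>f x\<bar> \<le> C * x"
    using assms
  proof
    assume "quad_small f"
    then obtain C where C: "C \<ge> 0" "\<And>x y. 0 \<le> y \<Longrightarrow> y \<le> x \<Longrightarrow> x \<le> 1/2 \<Longrightarrow> \<bar>f x - f y\<bar> \<le> C * x * (x - y) \<and> \<bar>f x\<bar> \<le> C * x\<^sup>2"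
      unfolding quad_small_def by blast
    show ?thesis
    proof (intro exI[of _ C] conjI allI impI C(1))
      fix x y :: real assume xy: "0 \<le> y" "y \<le> x" "x \<le> 1/2"
      have "C * x * (x - y) \<le> C * 1 * (x - y)" using xy C by (intro mult_right_mono mult_left_mono) auto
      then show "\<bar>f x - f y\<bar> \<le> C * (x - y)" using C(2)[OF xy] by simp
      have "C * x\<^sup>2 \<le> C * x" using xy C by (intro mult_left_mono) (auto simp: power2_eq_square mult_left_le)
      then show "\<bar>f x\<bar> \<le> C * x" using C(2)[OF xy] by simp
    qed
  next
    assume f: "f = dilog"
    show ?thesis unfolding f
    proof (intro exI[of _ "L + 2"] conjI allI impI)
      fix x y :: real assume xy: "0 \<le> y" "y \<le> x" "x \<le> 1/2"
      have "(L + 2) * (x - y) = L * (x - y) + 2 * (x - y)" "(L + 2) * x = L * x + 2 * x" by (simp_all add: algebra_simps)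
      moreover have "\<bar>dilog x\<bar> \<le> 2 * x" "L * x \<ge> 0" using dilog_abs[of x] xy L by auto
      ultimately show "\<bar>dilog x - dilog y\<bar> \<le> (L + 2) * (x - y)" "\<bar>dilog x\<bar> \<le> (L + 2) * x"
        using L(2)[OF xy] xy by simp_all
    qed (use L in auto)
  qed
  then obtain C where C: "C \<ge> 0" "\<And>x y. 0 \<le> y \<Longrightarrow> y \<le> x \<Longrightarrow> x \<le> 1/2 \<Longrightarrow> \<bar>f x - f y\<bar> \<le> C * (x - y) \<and> \<bar>f x\<bar> \<le> C * x"
    by blast
  show ?thesis unfolding quad_small_def
  proof (intro exI[of _ "2 * C + C * L"] conjI allI impI)
    fix x y :: real assume xy: "0 \<le> y" "y \<le> x" "x \<le> 1/2"
    have CL: "C * L \<ge> 0" using C L by simp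
    have fy: "\<bar>f y\<bar> \<le> C * x"
      using C(2)[of y y] xy mult_left_mono[OF xy(2) C(1)] by simp
    have "\<bar>dilog x * f x - dilog y * f y\<bar> = \<bar>dilog x * (f x - f y) + (dilog x - dilog y) * f y\<bar>"
      by (simp add: algebra_simps)
    also have "\<dots> \<le> \<bar>dilog x\<bar> * \<bar>f x - f y\<bar> + \<bar>dilog x - dilog y\<bar> * \<bar>f y\<bar>"
      by (metis abs_triangle_ineq abs_mult)
    also have "\<dots> \<le> (2 * x) * (C * (x - y)) + (L * (x - y)) * (C * x)"
      using C(2)[OF xy] L(2)[OF xy] fy dilog_abs[of x] xy L C by (intro add_mono mult_mono) auto
    also have "\<dots> = (2 * C + C * L) * x * (x - y)" by (simp add: algebra_simps)
    finally show "\<bar>dilog x * f x - dilog y * f y\<bar> \<le> (2 * C + C * L) * x * (x - y)" .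
    have "\<bar>dilog x * f x\<bar> \<le> (2 * x) * (C * x)"
      unfolding abs_mult using C(2)[OF xy] dilog_abs[of x] xy by (intro mult_mono) auto
    also have "\<dots> \<le> (2 * C + C * L) * x\<^sup>2"
      using mult_nonneg_nonneg[OF CL, of "x * x"] by (simp add: power2_eq_square algebra_simps)
    finally show "\<bar>dilog x * f x\<bar> \<le> (2 * C + C * L) * x\<^sup>2" .
  qed (use C L in auto)
qed

lemma quad_small_scale:
  assumes "quad_small f"
  shows "quad_small (\<lambda>x. c * f x)"
proof -
  obtain C1 where C1: "C1 \<ge> 0" "\<And>x y. 0 \<le> y \<Longrightarrow> y \<le> x \<Longrightarrow> x \<le> 1/2 \<Longrightarrow> \<bar>f x - f y\<bar> \<le> C1 * x * (x - y) \<and> \<bar>f x\<bar> \<le> C1 * x\<^sup>2"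
    using assms(1) unfolding quad_small_def by blast
  show ?thesis unfolding quad_small_def
  proof (intro exI[of _ "\<bar>c\<bar> * C1"] conjI allI impI)
    fix x y :: real assume xy: "0 \<le> y" "y \<le> x" "x \<le> 1/2"
    show "\<bar>c * f x - c * f y\<bar> \<le> \<bar>c\<bar> * C1 * x * (x - y)"
      using mult_left_mono[OF conjunct1[OF C1(2)[OF xy]], of "\<bar>c\<bar>"]
      by (simp add: abs_mult[symmetric] right_diff_distrib mult.assoc)
    show "\<bar>c * f x\<bar> \<le> \<bar>c\<bar> * C1 * x\<^sup>2"
      using mult_left_mono[OF conjunct2[OF C1(2)[OF xy]], of "\<bar>c\<bar>"]
      by (simp add: abs_mult mult.assoc)
  qed (use C1 in auto)
qed

text \<open>The coefficients, up to powers of the imaginary unit, of \<open>u b\<close>,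
  \<open>u^2 b\<close>, \<open>b^2\<close>, \<open>u^3 b\<close> and \<open>u b^2\<close> in
  \<open>(1 - b G) * exp (b * dilog x) - 1\<close>. The \<open>wsum\<close> terms come from
  \<open>- b G\<close> with \<open>\<alpha> = \<i> * u\<close> and \<open>\<beta> = - b\<close>; the
  products with \<open>dilog\<close> come from the exponential.\<close>

definition cf1 :: "real \<Rightarrow> real" where "cf1 x = (-1) * wsum c10 x"
definition cf2 :: "real \<Rightarrow> real" where "cf2 x = wsum c20 x"
definition cf3 :: "real \<Rightarrow> real" where "cf3 x = wsum c01 x - 1/2 * (dilog x * dilog x)"
definition cf4 :: "real \<Rightarrow> real" where "cf4 x = wsum c30 x"
definition cf5 :: "real \<Rightarrow> real" where "cf5 x = wsum c11 x - dilog x * wsum c10 x"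

lemma cf_quad_small: "quad_small cf1" "quad_small cf2" "quad_small cf3" "quad_small cf4" "quad_small cf5"
  unfolding cf1_def[abs_def] cf2_def[abs_def] cf3_def[abs_def] cf4_def[abs_def] cf5_def[abs_def]
  by (intro quad_small_scale quad_small_diff quad_small_dilog_mult disjI1 coef_quad_small
        quad_small_dilog_mult[OF disjI2, OF refl])+



section \<open>Expansion of one local factor up to weight five\<close>

definition edge_poly :: "real \<Rightarrow> real \<Rightarrow> real \<Rightarrow> real \<Rightarrow> real \<Rightarrow> real \<Rightarrow> real \<Rightarrow> complex" where
  "edge_poly k1 k2 k3 k4 k5 u b =
     \<i> * of_real (u * b * k1) + of_real (u\<^sup>2 * b * k2) + of_real (b\<^sup>2 * k3)
     + \<i> * of_real (u ^ 3 * b * k4) + \<i> * of_real (u * b\<^sup>2 * k5)"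

definition local_poly :: "real \<Rightarrow> real \<Rightarrow> real \<Rightarrow> complex" where
  "local_poly x = edge_poly (cf1 x) (cf2 x) (cf3 x) (cf4 x) (cf5 x)"

lemma norm_edge_poly_le:
  assumes "\<bar>u\<bar> \<le> \<tau>" "0 \<le> b" "b \<le> \<tau>\<^sup>2" "\<tau> \<le> 1"
    and "\<bar>k1\<bar> \<le> K" "\<bar>k2\<bar> \<le> K" "\<bar>k3\<bar> \<le> K" "\<bar>k4\<bar> \<le> K" "\<bar>k5\<bar> \<le> K"
  shows "norm (edge_poly k1 k2 k3 k4 k5 u b) \<le> 5 * K * \<tau> ^ 3"
proof -
  have t: "0 \<le> \<tau>" using assms(1) by linarith
  have dec: "\<tau> ^ n \<le> \<tau> ^ 3" if "3 \<le> n" for n using that t assms by (intro power_decreasing) auto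
  have m: "\<bar>u\<bar> ^ i * b ^ j \<le> \<tau> ^ 3" if "3 \<le> i + 2 * j" for i j
  proof -
    have "\<bar>u\<bar> ^ i * b ^ j \<le> \<tau> ^ i * (\<tau>\<^sup>2) ^ j"
      using assms t by (intro mult_mono power_mono) auto
    also have "\<dots> = \<tau> ^ (i + 2 * j)" by (simp add: power_add power_mult)
    also have "\<dots> \<le> \<tau> ^ 3" using that by (rule dec)
    finally show ?thesis .
  qed
  have K: "K \<ge> 0" using assms(5) by linarith
  have mk: "\<bar>u\<bar> ^ i * b ^ j * \<bar>k\<bar> \<le> K * \<tau> ^ 3" if "3 \<le> i + 2 * j" "\<bar>k\<bar> \<le> K" for i j k
  proof -
    have "\<bar>u\<bar> ^ i * b ^ j * \<bar>k\<bar> \<le> \<tau> ^ 3 * K"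
      using m[OF that(1)] that(2) K t by (intro mult_mono) auto
    then show ?thesis by (simp add: mult.commute)
  qed
  have "norm (edge_poly k1 k2 k3 k4 k5 u b) \<le> K * \<tau> ^ 3 + K * \<tau> ^ 3 + K * \<tau> ^ 3 + K * \<tau> ^ 3 + K * \<tau> ^ 3"
    unfolding edge_poly_def
  proof (intro norm_triangle_mono)
    show "norm (\<i> * of_real (u * b * k1)) \<le> K * \<tau> ^ 3"
      using mk[of 1 1 k1] assms by (simp add: norm_mult abs_mult)
    show "norm (of_real (u\<^sup>2 * b * k2) :: complex) \<le> K * \<tau> ^ 3"
      using mk[of 2 1 k2] assms by (simp add: norm_mult abs_mult norm_power)
    show "norm (of_real (b\<^sup>2 * k3) :: complex) \<le> K * \<tau> ^ 3"
      using mk[of 0 2 k3] assms by (simp add: norm_mult abs_mult norm_power)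
    show "norm (\<i> * of_real (u ^ 3 * b * k4)) \<le> K * \<tau> ^ 3"
      using mk[of 3 1 k4] assms by (simp add: norm_mult abs_mult norm_power power_abs)
    show "norm (\<i> * of_real (u * b\<^sup>2 * k5)) \<le> K * \<tau> ^ 3"
      using mk[of 1 2 k5] assms by (simp add: norm_mult abs_mult norm_power)
  qed
  then show ?thesis by simp
qed

text \<open>The linear terms of \<open>(1 - y) * exp y\<close> cancel and \<open>- y ^ 2 / 2\<close>
  is left; with \<open>y = b * dilog x\<close> this is the source of the square of
  \<open>dilog\<close> in \<open>cf3\<close>.\<close>

lemma exp_cubic_remainder:
  fixes y :: real
  assumes "0 \<le> y" "y \<le> 1"
  shows "\<bar>(1 - y) * exp y - 1 + y\<^sup>2 / 2\<bar> \<le> y ^ 3" "\<bar>exp y - 1 - y\<bar> \<le> y\<^sup>2"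
proof -
  define E where "E = exp y - (1 + y + y\<^sup>2 / 2)"
  obtain t where t: "\<bar>t\<bar> \<le> \<bar>y\<bar>" "exp y = (\<Sum>m<3. y ^ m / fact m) + exp t / fact 3 * y ^ 3"
    using Maclaurin_exp_le[of y 3] by blast
  have "exp t \<le> exp 1" using t assms by simp
  then have "exp t \<le> 3" using exp_le by linarith
  then have "exp t * y ^ 3 \<le> 3 * y ^ 3" using assms by (intro mult_right_mono) auto
  moreover have Eq: "E = exp t * y ^ 3 / 6"
    using t(2) unfolding E_def by (simp add: eval_nat_numeral)
  moreover have "0 \<le> exp t * y ^ 3" using assms by simp
  ultimately have E: "\<bar>E\<bar> \<le> y ^ 3 / 2" unfolding Eq by linarith
  have "(1 - y) * exp y - 1 + y\<^sup>2 / 2 = - (y ^ 3) / 2 + (1 - y) * E"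
    unfolding E_def by (simp add: field_simps power2_eq_square power3_eq_cube)
  moreover have "\<bar>(1 - y) * E\<bar> \<le> 1 * (y ^ 3 / 2)"
    unfolding abs_mult using assms E by (intro mult_mono) auto
  moreover have "y ^ 3 \<ge> 0" using assms by simp
  ultimately show "\<bar>(1 - y) * exp y - 1 + y\<^sup>2 / 2\<bar> \<le> y ^ 3" by linarith
  show "\<bar>exp y - 1 - y\<bar> \<le> y\<^sup>2"
    using exp_bound[OF assms] exp_ge_add_one_self[of y] by linarith
qed

text \<open>The truncation of \<open>local_prod\<close> is summed against the weights
  \<open>x ^ n / n ^ 2\<close>, which cancel the growth \<open>n ^ 2\<close> of its remainder. For
  \<open>n = 1\<close> the product is empty and the truncation exact, so the error starts at
  \<open>x ^ 2\<close>.\<close>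

lemma local_G_expansion:
  assumes "\<bar>u\<bar> \<le> \<tau>" "0 \<le> b" "b \<le> \<tau>\<^sup>2" "0 \<le> \<tau>" "\<tau> \<le> 1" "0 \<le> x" "x \<le> 1/2"
  defines "\<alpha> \<equiv> \<i> * of_real u" and "\<beta> \<equiv> - complex_of_real b"
  shows "norm (local_G x u b - (of_real (dilog x) + of_real (wsum c10 x) * \<alpha> + of_real (wsum c20 x) * \<alpha>\<^sup>2
    + of_real (wsum c30 x) * \<alpha> ^ 3 + of_real (wsum c01 x) * \<beta> + of_real (wsum c11 x) * (\<alpha> * \<beta>))) \<le> 2 * \<tau> ^ 4 * x\<^sup>2"
proof -
  define w where "w n = x ^ Suc n / (real (Suc n))\<^sup>2" for n
  define S where "S = of_real (dilog x) + of_real (wsum c10 x) * \<alpha> + of_real (wsum c20 x) * \<alpha>\<^sup>2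
    + of_real (wsum c30 x) * \<alpha> ^ 3 + of_real (wsum c01 x) * \<beta> + of_real (wsum c11 x) * (\<alpha> * \<beta>)"
  have cs: "(\<lambda>n. of_real (w n * c (Suc n)) * z) sums (of_real (wsum c x) * z)" if "coef_seq c" for c and z :: complex
    unfolding w_def by (intro sums_mult2 sums_of_real wsum_sums that assms)
  have S: "(\<lambda>n. of_real (w n) * trunc (Suc n) \<alpha> \<beta>) sums S"
  proof -
    have "(\<lambda>n. of_real (w n) + of_real (w n * c10 (Suc n)) * \<alpha> + of_real (w n * c20 (Suc n)) * \<alpha>\<^sup>2
      + of_real (w n * c30 (Suc n)) * \<alpha> ^ 3 + of_real (w n * c01 (Suc n)) * \<beta> + of_real (w n * c11 (Suc n)) * (\<alpha> * \<beta>)) sums S"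
      unfolding S_def
    proof (intro sums_add cs coef_seqs)
      show "(\<lambda>n. of_real (w n)) sums complex_of_real (dilog x)"
        unfolding w_def by (intro sums_of_real dilog_sums) (use assms in auto)
    qed
    then show ?thesis unfolding trunc_def by (simp add: algebra_simps)
  qed
  define R where "R n = of_real (w n) * (local_prod u b (Suc n) - trunc (Suc n) \<alpha> \<beta>)" for n
  have w0: "w n \<ge> 0" for n using assms by (simp add: w_def)
  have R0: "R 0 = 0" unfolding R_def using local_prod_trunc[OF assms(1-5), of 0]
    by (simp add: \<alpha>_def \<beta>_def trunc_def coef_at_1[unfolded One_nat_def])
  have Rb: "norm (R n) \<le> \<tau> ^ 4 * x ^ Suc n" for n
  proof -
    have T0: "trunc (Suc n) 1 1 \<ge> (0::real)" unfolding trunc_def using coeffs_nonneg[of "Suc n"] by simp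
    have "norm (R n) = w n * norm (local_prod u b (Suc n) - trunc (Suc n) \<alpha> \<beta>)"
      unfolding R_def norm_mult using w0[of n] by simp
    also have "\<dots> \<le> w n * (\<tau> ^ 4 * (real (Suc n))\<^sup>2)"
    proof (intro mult_left_mono w0)
      have "norm (local_prod u b (Suc n) - trunc (Suc n) \<alpha> \<beta>) \<le> \<tau> ^ 4 * (maj_prod (Suc n) - trunc (Suc n) 1 1)"
        unfolding \<alpha>_def \<beta>_def by (rule local_prod_trunc[OF assms(1-5)])
      also have "\<dots> \<le> \<tau> ^ 4 * (real (Suc n))\<^sup>2"
        using T0 maj_prod_le[of n] by (intro mult_left_mono) auto
      finally show "norm (local_prod u b (Suc n) - trunc (Suc n) \<alpha> \<beta>) \<le> \<tau> ^ 4 * (real (Suc n))\<^sup>2" .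
    qed
    also have "\<dots> = \<tau> ^ 4 * x ^ Suc n" unfolding w_def by (simp del: of_nat_Suc power_Suc)
    finally show ?thesis .
  qed
  have g: "(\<lambda>n. \<tau> ^ 4 * x\<^sup>2 * (1/2) ^ n) sums (\<tau> ^ 4 * x\<^sup>2 * (1 / (1 - 1/2)))"
    by (intro sums_mult geometric_sums) auto
  have Rb': "norm (R (Suc n)) \<le> \<tau> ^ 4 * x\<^sup>2 * (1/2) ^ n" for n
  proof -
    have "norm (R (Suc n)) \<le> \<tau> ^ 4 * x\<^sup>2 * x ^ n" using Rb[of "Suc n"] by (simp add: power2_eq_square mult_ac)
    also have "\<dots> \<le> \<tau> ^ 4 * x\<^sup>2 * (1/2) ^ n" using assms by (intro mult_left_mono power_mono) auto
    finally show ?thesis .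
  qed
  have sR: "summable (\<lambda>n. R (Suc n))"
    by (rule summable_comparison_test'[OF sums_summable[OF g], of 0]) (rule Rb')
  then have sR': "summable R" by (subst (asm) summable_Suc_iff)
  have "(\<lambda>n. of_real (w n) * local_prod u b (Suc n)) sums (S + suminf R)"
    using sums_add[OF S summable_sums[OF sR']] unfolding R_def by (simp add: algebra_simps)
  then have "local_G x u b = S + suminf R"
    unfolding local_G_def w_def by (rule sums_unique[symmetric])
  then have "norm (local_G x u b - S) = norm (\<Sum>n. R (Suc n))"
    using suminf_split_head[OF sR'] R0 by simp
  also have "\<dots> \<le> (\<Sum>n. \<tau> ^ 4 * x\<^sup>2 * (1/2) ^ n)"
    by (rule norm_suminf_le[OF Rb' sums_summable[OF g]])
  also have "\<dots> = 2 * \<tau> ^ 4 * x\<^sup>2" using sums_unique[OF g] by simp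
  finally show ?thesis unfolding S_def .
qed

lemma quad_small_boundD:
  assumes "quad_small f"
  obtains C where "C \<ge> 0" "\<And>x. 0 \<le> x \<Longrightarrow> x \<le> 1/2 \<Longrightarrow> \<bar>f x\<bar> \<le> C * x\<^sup>2"
  using assms unfolding quad_small_def by blast

lemma quad_small5_bound:
  assumes "quad_small f1" "quad_small f2" "quad_small f3" "quad_small f4" "quad_small f5"
  obtains C where "C \<ge> 0" "\<And>x y f. f \<in> {f1, f2, f3, f4, f5} \<Longrightarrow> 0 \<le> y \<Longrightarrow> y \<le> x \<Longrightarrow> x \<le> 1/2 \<Longrightarrow>
    \<bar>f x - f y\<bar> \<le> C * x * (x - y) \<and> \<bar>f x\<bar> \<le> C * x\<^sup>2"
proof -
  have "\<exists>C. \<forall>f\<in>F. C \<ge> 0 \<and> (\<forall>x y. 0 \<le> y \<longrightarrow> y \<le> x \<longrightarrow> x \<le> 1/2 \<longrightarrow>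
    \<bar>f x - f y\<bar> \<le> C * x * (x - y) \<and> \<bar>f x\<bar> \<le> C * x\<^sup>2)" if "finite F" "\<And>f. f \<in> F \<Longrightarrow> quad_small f" for F
    using that
  proof (induction F rule: finite_induct)
    case (insert g F)
    then obtain C where C: "\<forall>f\<in>F. C \<ge> 0 \<and> (\<forall>x y. 0 \<le> y \<longrightarrow> y \<le> x \<longrightarrow> x \<le> 1/2 \<longrightarrow>
        \<bar>f x - f y\<bar> \<le> C * x * (x - y) \<and> \<bar>f x\<bar> \<le> C * x\<^sup>2)" by auto
    obtain C' where C': "C' \<ge> 0" "\<And>x y. 0 \<le> y \<Longrightarrow> y \<le> x \<Longrightarrow> x \<le> 1/2 \<Longrightarrow> \<bar>g x - g y\<bar> \<le> C' * x * (x - y) \<and> \<bar>g x\<bar> \<le> C' * x\<^sup>2"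
      using insert.prems[of g] unfolding quad_small_def by blast
    have mono: "c * x * (x - y) \<le> max C C' * x * (x - y) \<and> c * x\<^sup>2 \<le> max C C' * x\<^sup>2"
      if "0 \<le> y" "y \<le> x" "c \<in> {C, C'}" for c x y :: real
      using that by (intro conjI mult_right_mono) auto
    show ?case
    proof (intro exI[of _ "max C C'"] ballI conjI allI impI)
      fix f x y :: "real" and h assume h: "h \<in> insert g F" and xy: "0 \<le> y" "y \<le> x" "x \<le> 1/2"
      consider "h = g" | "h \<in> F" using h by auto
      then have "\<exists>c\<in>{C, C'}. \<bar>h x - h y\<bar> \<le> c * x * (x - y) \<and> \<bar>h x\<bar> \<le> c * x\<^sup>2"
        using C C'(2)[OF xy] xy by cases auto
      then obtain c where c: "c \<in> {C, C'}" "\<bar>h x - h y\<bar> \<le> c * x * (x - y)" "\<bar>h x\<bar> \<le> c * x\<^sup>2" by blast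
      show "\<bar>h x - h y\<bar> \<le> max C C' * x * (x - y)" "\<bar>h x\<bar> \<le> max C C' * x\<^sup>2"
        using mono[OF xy(1,2) c(1)] c by auto
    qed (use C' in auto)
  qed auto
  from this[of "{f1, f2, f3, f4, f5}"] assms obtain C where
    C: "\<forall>f\<in>{f1, f2, f3, f4, f5}. C \<ge> 0 \<and> (\<forall>x y. 0 \<le> y \<longrightarrow> y \<le> x \<longrightarrow> x \<le> 1/2 \<longrightarrow>
    \<bar>f x - f y\<bar> \<le> C * x * (x - y) \<and> \<bar>f x\<bar> \<le> C * x\<^sup>2)" by blast
  show ?thesis by (rule that[of C]) (use C in blast)+
qed

text \<open>The term \<open>- b * x\<close> of a single factor is the only one whose sum over primes
  diverges at \<sigma> = 1/2. Multiplication by \<open>exp (b * dilog x)\<close> removes it,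
  together with the rest of \<open>- b * dilog x\<close>; everything left carries
  \<open>x ^ 2\<close>, in the main term as well as in the error.\<close>

lemma local_expansion:
  "\<exists>C\<ge>0. \<forall>x u b \<tau>. \<bar>u\<bar> \<le> \<tau> \<longrightarrow> 0 \<le> b \<longrightarrow> b \<le> \<tau>\<^sup>2 \<longrightarrow> \<tau> \<le> 1 \<longrightarrow> 0 \<le> x \<longrightarrow> x \<le> 1/2 \<longrightarrow>
     norm ((1 - of_real b * local_G x u b) * of_real (exp (b * dilog x)) - 1 - local_poly x u b) \<le> C * \<tau> ^ 6 * x\<^sup>2 \<and>
     norm (local_poly x u b) \<le> C * \<tau> ^ 3 * x\<^sup>2"
proof -
  obtain C where C: "C \<ge> 0" "\<And>x y f. f \<in> {cf1, cf2, cf3, cf4, cf5} \<Longrightarrow> 0 \<le> y \<Longrightarrow> y \<le> x \<Longrightarrow> x \<le> 1/2 \<Longrightarrow>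
    \<bar>f x - f y\<bar> \<le> C * x * (x - y) \<and> \<bar>f x\<bar> \<le> C * x\<^sup>2"
    using quad_small5_bound[OF cf_quad_small] by metis
  obtain W where W: "W \<ge> 0" "\<And>x y f. f \<in> {wsum c10, wsum c01, wsum c20, wsum c30, wsum c11} \<Longrightarrow> 0 \<le> y \<Longrightarrow> y \<le> x \<Longrightarrow> x \<le> 1/2 \<Longrightarrow>
    \<bar>f x - f y\<bar> \<le> W * x * (x - y) \<and> \<bar>f x\<bar> \<le> W * x\<^sup>2"
    using quad_small5_bound[OF coef_quad_small] by metis
  define D where "D = 5 * W + 2"
  define B where "B = 4 + (2 + 2 * D + 4 * D)"
  have D0: "D \<ge> 0" using W by (simp add: D_def)
  have "norm ((1 - of_real b * local_G x u b) * of_real (exp (b * dilog x)) - 1 - local_poly x u b) \<le> B * \<tau> ^ 6 * x\<^sup>2 \<and>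
     norm (local_poly x u b) \<le> 5 * C * \<tau> ^ 3 * x\<^sup>2"
    if h: "\<bar>u\<bar> \<le> \<tau>" "0 \<le> b" "b \<le> \<tau>\<^sup>2" "\<tau> \<le> 1" "0 \<le> x" "x \<le> 1/2" for x u b \<tau> :: real
  proof
    have t: "0 \<le> \<tau>" using h by linarith
    have x1: "x\<^sup>2 \<le> x" "x ^ 2 \<le> 1" using h by (auto simp: power2_eq_square mult_left_le mult_le_one)
    show "norm (local_poly x u b) \<le> 5 * C * \<tau> ^ 3 * x\<^sup>2"
      unfolding local_poly_def using norm_edge_poly_le[OF h(1-4), of _ "C * x\<^sup>2"] C(2)[of _ 0 x] h
      by (simp add: mult_ac)
    define \<alpha> where "\<alpha> = \<i> * of_real u"
    define \<beta> where "\<beta> = - complex_of_real b"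
    define p where "p = dilog x"
    define y where "y = b * p"
    define A where "A = complex_of_real (wsum c10 x) * \<alpha>"
    define \<delta>' where "\<delta>' = A + of_real (wsum c20 x) * \<alpha>\<^sup>2
      + of_real (wsum c30 x) * \<alpha> ^ 3 + of_real (wsum c01 x) * \<beta> + of_real (wsum c11 x) * (\<alpha> * \<beta>)"
    define \<delta> where "\<delta> = local_G x u b - of_real p"
    have p: "0 \<le> p" "p \<le> 2 * x" "p \<le> 1" using dilog_bounds[OF h(5,6)] h by (auto simp: p_def)
    have t2: "\<tau>\<^sup>2 \<le> 1" using t h by (simp add: power_le_one)
    have y: "0 \<le> y" "y \<le> 2 * \<tau>\<^sup>2 * x" "y \<le> 1"
    proof -
      show "0 \<le> y" using p h by (simp add: y_def)
      show "y \<le> 2 * \<tau>\<^sup>2 * x" unfolding y_def using mult_mono[OF h(3) p(2)] p t by simp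
      show "y \<le> 1" unfolding y_def using mult_mono[of b 1 p 1] h(3) t2 p h by simp
    qed
    have ab: "norm \<alpha> \<le> \<tau>" "norm \<beta> \<le> \<tau>\<^sup>2" using h by (simp_all add: \<alpha>_def \<beta>_def norm_mult)
    have dd: "norm (\<delta> - \<delta>') \<le> 2 * \<tau> ^ 4 * x\<^sup>2"
      using local_G_expansion[OF h(1-3) t h(4-6)]
      unfolding \<delta>_def \<delta>'_def A_def p_def \<alpha>_def \<beta>_def by (simp add: algebra_simps)
    have wb: "\<bar>wsum c10 x\<bar> \<le> W * x\<^sup>2" "\<bar>wsum c20 x\<bar> \<le> W * x\<^sup>2" "\<bar>wsum c30 x\<bar> \<le> W * x\<^sup>2"
       "\<bar>wsum c01 x\<bar> \<le> W * x\<^sup>2" "\<bar>wsum c11 x\<bar> \<le> W * x\<^sup>2" using W(2)[of _ 0 x] h by auto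
    have tm: "norm (of_real k * m) \<le> W * x\<^sup>2 * \<tau> ^ i" if "\<bar>k\<bar> \<le> W * x\<^sup>2" "norm m \<le> \<tau> ^ i" for k i and m :: complex
      unfolding norm_mult norm_of_real using that t by (intro mult_mono) auto
    have dec: "\<tau> ^ j \<le> \<tau> ^ i" if "i \<le> j" for i j using that t h by (intro power_decreasing) auto
    have dA: "norm (\<delta>' - A) \<le> 4 * W * x\<^sup>2 * \<tau>\<^sup>2"
    proof -
      have "norm (\<delta>' - A) = norm (of_real (wsum c20 x) * \<alpha>\<^sup>2
        + of_real (wsum c30 x) * \<alpha> ^ 3 + of_real (wsum c01 x) * \<beta> + of_real (wsum c11 x) * (\<alpha> * \<beta>))"
        unfolding \<delta>'_def by (simp add: algebra_simps)
      also have "\<dots> \<le> W * x\<^sup>2 * \<tau>\<^sup>2 + W * x\<^sup>2 * \<tau>\<^sup>2 + W * x\<^sup>2 * \<tau>\<^sup>2 + W * x\<^sup>2 * \<tau>\<^sup>2"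
      proof (intro norm_triangle_mono tm wb)
        show "norm (\<alpha>\<^sup>2) \<le> \<tau>\<^sup>2" "norm \<beta> \<le> \<tau>\<^sup>2" using ab by (auto simp: norm_power power_mono)
        have "norm (\<alpha> ^ 3) \<le> \<tau> ^ 3" using ab by (auto simp: norm_power power_mono)
        then show "norm (\<alpha> ^ 3) \<le> \<tau>\<^sup>2" using dec[of 2 3] by simp
        have "norm (\<alpha> * \<beta>) \<le> \<tau> * \<tau>\<^sup>2" unfolding norm_mult using ab t by (intro mult_mono) auto
        then show "norm (\<alpha> * \<beta>) \<le> \<tau>\<^sup>2" using dec[of 2 3] by (simp add: power2_eq_square power3_eq_cube mult.assoc)
      qed
      finally show ?thesis by (simp add: mult_ac)
    qed
    have nA: "norm A \<le> W * x\<^sup>2 * \<tau>" unfolding A_def using tm[OF wb(1), of \<alpha> 1] ab by simp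
    have dmA: "norm (\<delta> - A) \<le> D * \<tau>\<^sup>2 * x\<^sup>2"
    proof -
      have "norm (\<delta> - A) \<le> norm (\<delta> - \<delta>') + norm (\<delta>' - A)" using norm_triangle_ineq[of "\<delta> - \<delta>'" "\<delta>' - A"] by simp
      also have "\<dots> \<le> 2 * \<tau> ^ 4 * x\<^sup>2 + 4 * W * x\<^sup>2 * \<tau>\<^sup>2" using dd dA by simp
      also have "\<dots> \<le> 2 * \<tau>\<^sup>2 * x\<^sup>2 + 5 * W * x\<^sup>2 * \<tau>\<^sup>2"
        using dec[of 2 4] W by (intro add_mono mult_right_mono mult_left_mono) auto
      finally show ?thesis by (simp add: D_def algebra_simps)
    qed
    have nd: "norm \<delta> \<le> D * x\<^sup>2"
    proof -
      have "norm \<delta> \<le> norm (\<delta> - \<delta>') + norm (\<delta>' - A) + norm A"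
        using norm_triangle_ineq[of "\<delta> - \<delta>'" "\<delta>' - A"] norm_triangle_ineq[of "\<delta> - A" A] by simp
      also have "\<dots> \<le> 2 * \<tau> ^ 4 * x\<^sup>2 + 4 * W * x\<^sup>2 * \<tau>\<^sup>2 + W * x\<^sup>2 * \<tau>" using dd dA nA by simp
      also have "\<dots> \<le> 2 * 1 * x\<^sup>2 + 4 * W * x\<^sup>2 * 1 + W * x\<^sup>2 * 1"
        using t t2 h W by (intro add_mono mult_right_mono mult_left_mono) (auto simp: power_le_one)
      finally show ?thesis by (simp add: D_def algebra_simps)
    qed
    define E1 where "E1 = (1 - y) * exp y - 1 + y\<^sup>2 / 2"
    define E2 where "E2 = exp y - 1 - y"
    have E1: "\<bar>E1\<bar> \<le> y ^ 3" and E2: "\<bar>E2\<bar> \<le> y\<^sup>2" using exp_cubic_remainder[OF y(1,3)] by (auto simp: E1_def E2_def)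
    have lp: "local_poly x u b = - of_real b * \<delta>' - of_real (y\<^sup>2 / 2) - of_real b * of_real y * A"
      unfolding local_poly_def edge_poly_def cf1_def cf2_def cf3_def cf4_def cf5_def \<delta>'_def A_def y_def p_def[symmetric] \<alpha>_def \<beta>_def
      by (simp add: complex_eq_iff power2_eq_square power3_eq_cube algebra_simps)
    \<comment> \<open>An exact identity after writing \<open>G = p + \<delta>\<close> and
      \<open>exp y = 1 + y + E2\<close>. The 1 is paired with the full truncation
      \<open>\<delta>'\<close>, the \<open>y\<close> only with its weight-one part \<open>A\<close>,
      and \<open>E2\<close> with no main term at all; so each bracketed term is of order
      \<open>\<tau> ^ 4 * x ^ 2\<close>, to which the outer \<open>b\<close> adds
      \<open>\<tau> ^ 2\<close>.\<close>
    have "(1 - of_real b * local_G x u b) * of_real (exp y) - 1 - local_poly x u b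
       = of_real E1 - of_real b * ((\<delta> - \<delta>') + of_real y * (\<delta> - A) + of_real E2 * \<delta>)"
      unfolding lp E1_def E2_def \<delta>_def y_def by (simp add: algebra_simps)
    also have "norm \<dots> \<le> 4 * \<tau> ^ 6 * x\<^sup>2 + \<tau>\<^sup>2 * ((2 + 2 * D + 4 * D) * \<tau> ^ 4 * x\<^sup>2)"
    proof (rule order_trans[OF norm_triangle_ineq4 add_mono])
      have "y ^ 3 \<le> (2 * \<tau>\<^sup>2 * x) ^ 3" using y by (intro power_mono) auto
      also have "\<dots> = 4 * \<tau> ^ 6 * x\<^sup>2 * (2 * x)" by (simp add: power_mult_distrib power2_eq_square power3_eq_cube power_numeral_reduce)
      also have "\<dots> \<le> 4 * \<tau> ^ 6 * x\<^sup>2 * 1" using h by (intro mult_left_mono) auto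
      finally show "norm (complex_of_real E1) \<le> 4 * \<tau> ^ 6 * x\<^sup>2" using E1 by simp
      have "norm ((\<delta> - \<delta>') + of_real y * (\<delta> - A) + of_real E2 * \<delta>) \<le> 2 * \<tau> ^ 4 * x\<^sup>2 + 2 * D * \<tau> ^ 4 * x\<^sup>2 + 4 * D * \<tau> ^ 4 * x\<^sup>2"
      proof (intro norm_triangle_mono dd)
        have "norm (of_real y * (\<delta> - A)) \<le> (2 * \<tau>\<^sup>2 * x) * (D * \<tau>\<^sup>2 * x\<^sup>2)"
          unfolding norm_mult norm_of_real using y dmA h by (intro mult_mono) auto
        also have "\<dots> = 2 * D * \<tau> ^ 4 * x\<^sup>2 * x" by (simp add: power2_eq_square power_numeral_reduce)
        also have "\<dots> \<le> 2 * D * \<tau> ^ 4 * x\<^sup>2 * 1" using h D0 by (intro mult_left_mono) auto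
        finally show "norm (of_real y * (\<delta> - A)) \<le> 2 * D * \<tau> ^ 4 * x\<^sup>2" by simp
        have "y\<^sup>2 \<le> (2 * \<tau>\<^sup>2 * x)\<^sup>2" using y by (intro power_mono) auto
        then have "norm (of_real E2 * \<delta>) \<le> (2 * \<tau>\<^sup>2 * x)\<^sup>2 * (D * x\<^sup>2)"
          unfolding norm_mult norm_of_real using E2 nd by (intro mult_mono) auto
        also have "\<dots> = 4 * D * \<tau> ^ 4 * x\<^sup>2 * x\<^sup>2" by (simp add: power2_eq_square power_numeral_reduce)
        also have "\<dots> \<le> 4 * D * \<tau> ^ 4 * x\<^sup>2 * 1" using x1 D0 by (intro mult_left_mono) auto
        finally show "norm (of_real E2 * \<delta>) \<le> 4 * D * \<tau> ^ 4 * x\<^sup>2" by simp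
      qed
      also have "\<dots> = (2 + 2 * D + 4 * D) * \<tau> ^ 4 * x\<^sup>2" by (simp add: algebra_simps)
      finally show "norm (of_real b * ((\<delta> - \<delta>') + of_real y * (\<delta> - A) + of_real E2 * \<delta>)) \<le> \<tau>\<^sup>2 * ((2 + 2 * D + 4 * D) * \<tau> ^ 4 * x\<^sup>2)"
        unfolding norm_mult[of "of_real b"] norm_of_real using h t by (intro mult_mono) auto
    qed
    also have "\<dots> = B * \<tau> ^ 6 * x\<^sup>2"
      unfolding B_def by algebra
    finally show "norm ((1 - of_real b * local_G x u b) * of_real (exp (b * dilog x)) - 1 - local_poly x u b) \<le> B * \<tau> ^ 6 * x\<^sup>2"
      unfolding y_def p_def .
  qed
  moreover have "B * \<tau> ^ 6 * x\<^sup>2 \<le> max B (5 * C) * \<tau> ^ 6 * x\<^sup>2" "\<bar>u\<bar> \<le> \<tau> \<Longrightarrow> 5 * C * \<tau> ^ 3 * x\<^sup>2 \<le> max B (5 * C) * \<tau> ^ 3 * x\<^sup>2" for x u \<tau> :: real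
    by (intro mult_right_mono; simp)+
  moreover have "max B (5 * C) \<ge> 0" using C by simp
  ultimately show ?thesis by (meson order_trans)
qed

subsection \<open>The product over all primes\<close>

text \<open>What remains on the left are the products of at least two of the \<open>a i\<close>.
  They are majorised by the same expression in the norms, in which each
  \<open>1 + norm (a i)\<close> may be replaced by an exponential.\<close>

lemma norm_prod_one_plus_le:
  fixes a :: "'i \<Rightarrow> complex"
  assumes "finite A"
  shows "norm ((\<Prod>i\<in>A. 1 + a i) - 1 - (\<Sum>i\<in>A. a i)) \<le> exp (\<Sum>i\<in>A. norm (a i)) - 1 - (\<Sum>i\<in>A. norm (a i))"
  using assms
proof (induction A rule: finite_induct)
  case (insert j A)
  define P where "P = (\<Prod>i\<in>A. 1 + a i)"
  define S where "S = (\<Sum>i\<in>A. a i)"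
  define s where "s = (\<Sum>i\<in>A. norm (a i))"
  have nP: "norm (P - 1 - S) \<le> exp s - 1 - s" using insert.IH by (simp add: P_def S_def s_def)
  have nS: "norm S \<le> s" unfolding S_def s_def by (rule norm_sum)
  have nP1: "norm (P - 1) \<le> exp s - 1"
    using norm_triangle_ineq[of "P - 1 - S" S] nP nS by simp
  have "(\<Prod>i\<in>insert j A. 1 + a i) - 1 - (\<Sum>i\<in>insert j A. a i) = (P - 1 - S) + a j * (P - 1)"
    using insert by (simp add: P_def S_def algebra_simps)
  also have "norm \<dots> \<le> (exp s - 1 - s) + norm (a j) * (exp s - 1)"
    using nP nP1 by (intro norm_triangle_mono) (auto simp: norm_mult mult_left_mono)
  also have "\<dots> \<le> exp (norm (a j) + s) - 1 - (norm (a j) + s)"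
    using mult_right_mono[OF exp_ge_add_one_self[of "norm (a j)"], of "exp s"]
    by (simp add: exp_add algebra_simps)
  finally show ?case using insert by (simp add: s_def)
qed simp

lemma exp_minus_linear_le:
  fixes y :: real
  assumes "0 \<le> y"
  shows "exp y - 1 - y \<le> y\<^sup>2 * exp y"
proof -
  have e: "exp y * (1 - y) \<le> 1"
  proof -
    have "exp y * (1 - y) \<le> exp y * exp (- y)"
      using exp_ge_add_one_self[of "-y"] by (intro mult_left_mono) auto
    then show ?thesis by (simp flip: exp_add)
  qed
  have "exp y - 1 - y \<le> y * (exp y - 1)" using e by (simp add: algebra_simps)
  also have "\<dots> \<le> y * (y * exp y)" using e assms by (intro mult_left_mono) (auto simp: algebra_simps)
  finally show ?thesis by (simp add: power2_eq_square mult.assoc)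
qed

text \<open>Each factor deviates from 1 by \<open>O(\<tau> ^ 3)\<close>, so products of two
  deviations already have the order \<open>\<tau> ^ 6\<close> of the error. Hence only the plain sum
  of the local polynomials survives, and no squares of coefficients enter the polynomials of index
  up to 5.\<close>

lemma norm_prod_expansion:
  fixes a q :: "'i \<Rightarrow> complex"
  assumes "finite A" "\<And>i. i \<in> A \<Longrightarrow> norm (a i - q i) \<le> C * \<tau> ^ 6 * w i" "\<And>i. i \<in> A \<Longrightarrow> norm (q i) \<le> C * \<tau> ^ 3 * w i"
    and "0 \<le> \<tau>" "\<tau> \<le> 1" "0 \<le> C" "\<And>i. i \<in> A \<Longrightarrow> 0 \<le> w i" "sum w A \<le> S"
  shows "norm ((\<Prod>i\<in>A. 1 + a i) - 1 - (\<Sum>i\<in>A. q i)) \<le> ((2 * C * S)\<^sup>2 * exp (2 * C * S) + C * S) * \<tau> ^ 6"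
proof -
  have t63: "\<tau> ^ 6 \<le> \<tau> ^ 3" "\<tau> ^ 3 \<le> 1" using assms by (auto intro: power_decreasing power_le_one)
  have S0: "0 \<le> S" using sum_nonneg[OF assms(7)] assms(8) by (rule order_trans)
  have na: "norm (a i) \<le> 2 * C * \<tau> ^ 3 * w i" if "i \<in> A" for i
  proof -
    have "norm (a i) \<le> norm (a i - q i) + norm (q i)" using norm_triangle_ineq[of "a i - q i" "q i"] by simp
    also have "\<dots> \<le> C * \<tau> ^ 3 * w i + C * \<tau> ^ 3 * w i"
    proof (intro add_mono)
      have "C * \<tau> ^ 6 * w i \<le> C * \<tau> ^ 3 * w i" using t63 assms(6,7) that by (intro mult_right_mono mult_left_mono) auto
      then show "norm (a i - q i) \<le> C * \<tau> ^ 3 * w i" using assms(2)[OF that] by simp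
    qed (use assms(3) that in auto)
    finally show ?thesis by (simp add: mult_ac)
  qed
  define s where "s = (\<Sum>i\<in>A. norm (a i))"
  have s0: "0 \<le> s" unfolding s_def by (intro sum_nonneg) auto
  have s1: "s \<le> 2 * C * S * \<tau> ^ 3"
  proof -
    have "s \<le> (\<Sum>i\<in>A. 2 * C * \<tau> ^ 3 * w i)" unfolding s_def by (intro sum_mono na)
    also have "\<dots> = 2 * C * \<tau> ^ 3 * sum w A" by (simp add: sum_distrib_left)
    also have "\<dots> \<le> 2 * C * \<tau> ^ 3 * S" using assms by (intro mult_left_mono) auto
    finally show ?thesis by (simp add: mult_ac)
  qed
  have s2: "s \<le> 2 * C * S"
    using s1 mult_left_mono[OF t63(2), of "2 * C * S"] assms(6) S0 by simp
  have "norm ((\<Prod>i\<in>A. 1 + a i) - 1 - (\<Sum>i\<in>A. a i)) \<le> s\<^sup>2 * exp s"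
    using norm_prod_one_plus_le[OF assms(1), of a] exp_minus_linear_le[OF s0] unfolding s_def by simp
  also have "\<dots> \<le> (2 * C * S * \<tau> ^ 3)\<^sup>2 * exp (2 * C * S)"
    using s0 s1 s2 by (intro mult_mono power_mono) auto
  also have "\<dots> = (2 * C * S)\<^sup>2 * exp (2 * C * S) * \<tau> ^ 6"
    by (simp add: power_mult_distrib flip: power_mult)
  finally have 1: "norm ((\<Prod>i\<in>A. 1 + a i) - 1 - (\<Sum>i\<in>A. a i)) \<le> (2 * C * S)\<^sup>2 * exp (2 * C * S) * \<tau> ^ 6" .
  have "norm ((\<Sum>i\<in>A. a i) - (\<Sum>i\<in>A. q i)) = norm (\<Sum>i\<in>A. a i - q i)" by (simp add: sum_subtractf)
  also have "\<dots> \<le> (\<Sum>i\<in>A. C * \<tau> ^ 6 * w i)" by (intro sum_norm_le assms(2))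
  also have "\<dots> = C * \<tau> ^ 6 * sum w A" by (simp add: sum_distrib_left)
  also have "\<dots> \<le> C * \<tau> ^ 6 * S" using assms by (intro mult_left_mono) auto
  finally have 2: "norm ((\<Sum>i\<in>A. a i) - (\<Sum>i\<in>A. q i)) \<le> C * S * \<tau> ^ 6" by (simp add: mult_ac)
  show ?thesis
    using norm_diff_triangle_le[OF 1 2] by (simp add: distrib_right)
qed

lemma edge_poly_diff:
  "edge_poly a1 a2 a3 a4 a5 u b - edge_poly b1 b2 b3 b4 b5 u b = edge_poly (a1 - b1) (a2 - b2) (a3 - b3) (a4 - b4) (a5 - b5) u b"
  unfolding edge_poly_def by (simp add: algebra_simps)

lemma edge_poly_sum:
  "(\<Sum>i\<in>A. edge_poly (f1 i) (f2 i) (f3 i) (f4 i) (f5 i) u b) =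
     edge_poly (sum f1 A) (sum f2 A) (sum f3 A) (sum f4 A) (sum f5 A) u b"
  unfolding edge_poly_def by (simp add: sum.distrib sum_distrib_left sum_distrib_right)

text \<open>The argument \<open>1 / n\<close> is \<open>n powr (- 2 * \<sigma>)\<close> at \<sigma>
  = 1/2. There \<open>psi\<close> diverges, but sums of \<open>quad_small\<close> functions over
  primes converge.\<close>

definition prime_sum :: "(real \<Rightarrow> real) \<Rightarrow> nat \<Rightarrow> real" where
  "prime_sum f N = (\<Sum>n | n < N \<and> prime n. f (1 / real n))"

definition edge_const :: "(real \<Rightarrow> real) \<Rightarrow> real" where
  "edge_const f = (\<Sum>n. if prime n then f (1 / real n) else 0)"

lemma sum_prime_if: "(\<Sum>n<N. if prime n then g n else 0) = (\<Sum>n | n < N \<and> prime n. g n)" for g :: "nat \<Rightarrow> 'a :: comm_monoid_add"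
proof -
  have "{..<N} \<inter> {n. prime n} = {n. n < N \<and> prime n}" by auto
  then show ?thesis by (simp add: sum.If_cases)
qed

lemma prime_sum_tendsto:
  assumes "quad_small f"
  shows "prime_sum f \<longlonglongrightarrow> edge_const f"
proof -
  obtain C where C: "C \<ge> 0" "\<And>x. 0 \<le> x \<Longrightarrow> x \<le> 1/2 \<Longrightarrow> \<bar>f x\<bar> \<le> C * x\<^sup>2"
    using quad_small_boundD[OF assms] by blast
  have s2: "summable (\<lambda>n. C * real n powr - 2)"
    using summable_real_powr_iff[of "-2"] by (intro summable_mult) simp
  have "summable (\<lambda>n. if prime n then f (1 / real n) else 0)"
  proof (rule summable_comparison_test'[OF s2, of 0])
    fix n
    show "norm (if prime n then f (1 / real n) else 0) \<le> C * real n powr - 2"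
    proof (cases "prime n")
      case True
      have "1 / real n \<le> 1 / 2" using prime_ge_2_nat[OF True] by (intro divide_left_mono) auto
      then have "\<bar>f (1 / real n)\<bar> \<le> C * (1 / real n)\<^sup>2" by (intro C(2)) auto
      also have "(1 / real n)\<^sup>2 = real n powr - 2"
        using prime_gt_0_nat[OF True] by (simp add: powr_minus power_divide inverse_eq_divide)
      finally show ?thesis using True by simp
    qed (use C in auto)
  qed
  from summable_LIMSEQ[OF this] show ?thesis
    unfolding edge_const_def prime_sum_def[abs_def] sum_prime_if .
qed

text \<open>The characteristic function of the partial sum over primes below \<open>N\<close>, in
  closed form. The estimates below take a limit of it as a hypothesis, which keeps them free of
  probability; the limit is supplied later by almost sure convergence.\<close>

definition Phi :: "real \<Rightarrow> complex \<Rightarrow> nat \<Rightarrow> complex" where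
  "Phi \<sigma> t N = (\<Prod>n | n < N \<and> prime n.
     1 - of_real ((cmod t)\<^sup>2 / 4) * local_G (real n powr (- 2 * \<sigma>)) (Re t) ((cmod t)\<^sup>2 / 4))"

definition limit_poly :: "real \<Rightarrow> real \<Rightarrow> complex" where
  "limit_poly = edge_poly (edge_const cf1) (edge_const cf2) (edge_const cf3) (edge_const cf4) (edge_const cf5)"

lemma psi_tendsto:
  assumes "\<sigma> > 1/2"
  shows "(\<lambda>N. \<Sum>n | n < N \<and> prime n. dilog (real n powr (- 2 * \<sigma>))) \<longlonglongrightarrow> psi \<sigma>"
  using summable_LIMSEQ[OF summable_psi[OF assms]] unfolding psi_def sum_prime_if .

text \<open>With \<open>d = 2 * \<sigma> - 1\<close>, the difference is
  \<open>(1 - p powr (- d)) / p \<le> d * ln p / p\<close>, and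
  \<open>ln p \<le> 2 * sqrt p\<close>. The extra factor \<open>1 / p\<close>, granted by the
  Lipschitz bound in \<open>quad_small\<close>, brings the exponent to the summable -3/2.\<close>

lemma prime_powr_diff:
  assumes "prime p" "\<sigma> > 1/2"
  shows "1 / real p * (1 / real p - real p powr (- 2 * \<sigma>)) \<le> 2 * (2 * \<sigma> - 1) * real p powr (- 3 / 2)"
proof -
  have p: "real p > 1" using prime_gt_1_nat[OF assms(1)] by simp
  define d where "d = 2 * \<sigma> - 1"
  have d: "d > 0" using assms by (simp add: d_def)
  have "real p powr (- 2 * \<sigma>) = real p powr (- 1) * real p powr (- d)"
    unfolding d_def by (simp only: powr_add[symmetric]) simp
  also have "\<dots> = 1 / real p * real p powr (- d)" using p by (simp add: powr_minus inverse_eq_divide)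
  finally have e: "1 / real p - real p powr (- 2 * \<sigma>) = 1 / real p * (1 - real p powr (- d))" by (simp add: algebra_simps)
  have "1 - real p powr (- d) \<le> d * ln (real p)"
    using exp_ge_add_one_self[of "- d * ln (real p)"] p by (simp add: powr_def)
  also have "ln (real p) \<le> 2 * real p powr (1/2)"
  proof -
    have "ln (real p powr (1/2)) \<le> real p powr (1/2) - 1" using p by (intro ln_le_minus_one) auto
    then show ?thesis using p by (simp add: ln_powr)
  qed
  finally have "1 - real p powr (- d) \<le> 2 * d * real p powr (1/2)" using d by simp
  then have "1 / real p * (1 / real p * (1 - real p powr (- d))) \<le> 1 / real p * (1 / real p * (2 * d * real p powr (1/2)))"
    using p by (intro mult_left_mono) auto
  also have "\<dots> = 2 * d * (real p powr (- 1) * real p powr (- 1) * real p powr (1/2))"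
    using p by (simp add: powr_minus inverse_eq_divide)
  also have "real p powr (- 1) * real p powr (- 1) * real p powr (1/2) = real p powr (- 3 / 2)"
    by (simp only: powr_add[symmetric]) simp
  finally show ?thesis unfolding e d_def .
qed

text \<open>Two errors, bounded uniformly in \<open>N\<close> before the limit:
  \<open>norm t ^ 6\<close> from local remainders and from multiplying the factors, and
  \<open>(2 * \<sigma> - 1) * norm t ^ 3\<close> from moving the coefficients to \<sigma> =
  1/2.\<close>

lemma Phi_central:
  "\<exists>C\<ge>0. \<forall>\<sigma> t \<phi>. \<sigma> > 1/2 \<longrightarrow> norm t \<le> 1 \<longrightarrow> Phi \<sigma> t \<longlonglongrightarrow> \<phi> \<longrightarrow>
     norm (\<phi> * of_real (exp ((cmod t)\<^sup>2 / 4 * psi \<sigma>)) - 1 - limit_poly (Re t) ((cmod t)\<^sup>2 / 4))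
       \<le> C * (norm t ^ 6 + (2 * \<sigma> - 1) * norm t ^ 3)"
proof -
  obtain C where C: "C \<ge> 0" "\<And>x u b \<tau>. \<bar>u\<bar> \<le> \<tau> \<Longrightarrow> 0 \<le> b \<Longrightarrow> b \<le> \<tau>\<^sup>2 \<Longrightarrow> \<tau> \<le> 1 \<Longrightarrow> 0 \<le> x \<Longrightarrow> x \<le> 1/2 \<Longrightarrow>
     norm ((1 - of_real b * local_G x u b) * of_real (exp (b * dilog x)) - 1 - local_poly x u b) \<le> C * \<tau> ^ 6 * x\<^sup>2 \<and>
     norm (local_poly x u b) \<le> C * \<tau> ^ 3 * x\<^sup>2"
    using local_expansion by blast
  obtain C' where C': "C' \<ge> 0" "\<And>x y f. f \<in> {cf1, cf2, cf3, cf4, cf5} \<Longrightarrow> 0 \<le> y \<Longrightarrow> y \<le> x \<Longrightarrow> x \<le> 1/2 \<Longrightarrow>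
    \<bar>f x - f y\<bar> \<le> C' * x * (x - y) \<and> \<bar>f x\<bar> \<le> C' * x\<^sup>2"
    using quad_small5_bound[OF cf_quad_small] by metis
  define S where "S = (\<Sum>n. real n powr - 2)"
  define S3 where "S3 = (\<Sum>n. real n powr (- 3 / 2))"
  have s2: "summable (\<lambda>n. real n powr - 2)" using summable_real_powr_iff[of "-2"] by simp
  have s3: "summable (\<lambda>n. real n powr (- 3 / 2))" using summable_real_powr_iff[of "-3/2"] by simp
  define B where "B = (2 * C * S)\<^sup>2 * exp (2 * C * S) + C * S"
  define B' where "B' = 5 * (2 * C' * S3)"
  have S30: "S3 \<ge> 0" unfolding S3_def by (intro suminf_nonneg s3) auto
  have S0: "S \<ge> 0" unfolding S_def by (intro suminf_nonneg s2) auto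
  have B0: "B \<ge> 0" unfolding B_def using C S0 by simp
  have main: "norm (\<phi> * of_real (exp ((cmod t)\<^sup>2 / 4 * psi \<sigma>)) - 1 - limit_poly (Re t) ((cmod t)\<^sup>2 / 4))
       \<le> (B + B') * (norm t ^ 6 + (2 * \<sigma> - 1) * norm t ^ 3)"
    if s: "\<sigma> > 1/2" and t: "norm t \<le> 1" and lim: "Phi \<sigma> t \<longlonglongrightarrow> \<phi>" for \<sigma> t \<phi>
  proof -
    define u where "u = Re t"
    define b where "b = (cmod t)\<^sup>2 / 4"
    define \<tau> where "\<tau> = norm t"
    define d where "d = 2 * \<sigma> - 1"
    have d: "d > 0" using s by (simp add: d_def)
    have h: "\<bar>u\<bar> \<le> \<tau>" "0 \<le> b" "b \<le> \<tau>\<^sup>2" "\<tau> \<le> 1" "0 \<le> \<tau>"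
      using t abs_Re_le_cmod[of t] by (auto simp: u_def b_def \<tau>_def)
    have fin: "norm (Phi \<sigma> t N * of_real (exp (b * (\<Sum>n | n < N \<and> prime n. dilog (real n powr (- 2 * \<sigma>))))) - 1
        - edge_poly (prime_sum cf1 N) (prime_sum cf2 N) (prime_sum cf3 N) (prime_sum cf4 N) (prime_sum cf5 N) u b)
       \<le> (B + B') * (\<tau> ^ 6 + d * \<tau> ^ 3)" for N
    proof -
      define A where "A = {n. n < N \<and> prime n}"
      have finA: "finite A" unfolding A_def by simp
      define x where "x n = real n powr (- 2 * \<sigma>)" for n :: nat
      define a where "a n = (1 - of_real b * local_G (x n) u b) * of_real (exp (b * dilog (x n))) - 1" for n
      have xb: "0 \<le> x n" "x n \<le> 1 / real n" "x n \<le> 1/2" "1 / real n \<le> 1/2" if "n \<in> A" for n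
      proof -
        have pn: "prime n" using that by (simp add: A_def)
        show "0 \<le> x n" "x n \<le> 1 / real n" "x n \<le> 1/2" unfolding x_def using prime_powr_bounds[OF pn, of \<sigma>] s by auto
        show "1 / real n \<le> 1/2" using prime_ge_2_nat[OF pn] by (intro divide_left_mono) auto
      qed
      have sub: "sum g A \<le> suminf g" if "summable g" "\<And>n. 0 \<le> g n" for g :: "nat \<Rightarrow> real"
        using that finA by (intro sum_le_suminf) auto
      have eq: "Phi \<sigma> t N * of_real (exp (b * (\<Sum>n | n < N \<and> prime n. dilog (real n powr (- 2 * \<sigma>))))) = (\<Prod>n\<in>A. 1 + a n)"
        unfolding Phi_def A_def[symmetric] x_def[symmetric] b_def[symmetric] u_def[symmetric] a_def
        by (simp add: sum_distrib_left exp_sum[OF finA] prod.distrib)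
      have 1: "norm ((\<Prod>n\<in>A. 1 + a n) - 1 - (\<Sum>n\<in>A. local_poly (x n) u b)) \<le> B * \<tau> ^ 6"
        unfolding B_def
      proof (rule norm_prod_expansion[where w = "\<lambda>n. (x n)\<^sup>2"])
        fix n assume "n \<in> A"
        then show "norm (a n - local_poly (x n) u b) \<le> C * \<tau> ^ 6 * (x n)\<^sup>2" "norm (local_poly (x n) u b) \<le> C * \<tau> ^ 3 * (x n)\<^sup>2"
          unfolding a_def using C(2)[OF h(1-4), of "x n"] xb[of n] by auto
      next
        have "(\<Sum>n\<in>A. (x n)\<^sup>2) \<le> (\<Sum>n\<in>A. real n powr - 2)"
        proof (rule sum_mono)
          fix n assume n: "n \<in> A"
          have "(x n)\<^sup>2 \<le> (1 / real n)\<^sup>2" using xb[OF n] by (intro power_mono) auto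
          also have "\<dots> = real n powr - 2"
            using n prime_gt_0_nat[of n] by (simp add: A_def powr_minus power_divide inverse_eq_divide)
          finally show "(x n)\<^sup>2 \<le> real n powr - 2" .
        qed
        also have "\<dots> \<le> S" unfolding S_def by (rule sub[OF s2]) auto
        finally show "(\<Sum>n\<in>A. (x n)\<^sup>2) \<le> S" .
      qed (use finA h C in auto)
      have df: "\<bar>(\<Sum>n\<in>A. f (x n)) - prime_sum f N\<bar> \<le> 2 * C' * S3 * d" if f: "f \<in> {cf1, cf2, cf3, cf4, cf5}" for f
      proof -
        have "\<bar>(\<Sum>n\<in>A. f (x n)) - prime_sum f N\<bar> = \<bar>\<Sum>n\<in>A. f (x n) - f (1 / real n)\<bar>"
          by (simp add: prime_sum_def A_def sum_subtractf)
        also have "\<dots> \<le> (\<Sum>n\<in>A. 2 * C' * d * real n powr (- 3 / 2))"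
        proof (rule order_trans[OF sum_abs sum_mono])
          fix n assume n: "n \<in> A"
          have "\<bar>f (x n) - f (1 / real n)\<bar> = \<bar>f (1 / real n) - f (x n)\<bar>" by simp
          also have "\<dots> \<le> C' * (1 / real n) * (1 / real n - x n)" using C'(2)[OF f xb(1,2,4)[OF n]] by simp
          also have "\<dots> \<le> C' * (2 * d * real n powr (- 3 / 2))"
            unfolding x_def d_def mult.assoc[of C'] using prime_powr_diff[of n \<sigma>] n s C'(1) by (intro mult_left_mono) (auto simp: A_def)
          finally show "\<bar>f (x n) - f (1 / real n)\<bar> \<le> 2 * C' * d * real n powr (- 3 / 2)" by (simp add: mult_ac)
        qed
        also have "\<dots> = 2 * C' * d * (\<Sum>n\<in>A. real n powr (- 3 / 2))" by (simp add: sum_distrib_left)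
        also have "\<dots> \<le> 2 * C' * d * S3"
          unfolding S3_def using d C' by (intro mult_left_mono sub s3) auto
        finally show ?thesis by (simp add: mult_ac)
      qed
      have 2: "norm ((\<Sum>n\<in>A. local_poly (x n) u b) - edge_poly (prime_sum cf1 N) (prime_sum cf2 N) (prime_sum cf3 N) (prime_sum cf4 N) (prime_sum cf5 N) u b)
         \<le> 5 * (2 * C' * S3 * d) * \<tau> ^ 3"
        unfolding local_poly_def edge_poly_sum edge_poly_diff
        by (rule norm_edge_poly_le[OF h(1-4)]) (rule df, simp)+
      have "norm ((\<Prod>n\<in>A. 1 + a n) - 1 - edge_poly (prime_sum cf1 N) (prime_sum cf2 N) (prime_sum cf3 N) (prime_sum cf4 N) (prime_sum cf5 N) u b)
        \<le> B * \<tau> ^ 6 + 5 * (2 * C' * S3 * d) * \<tau> ^ 3"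
        by (rule norm_diff_triangle_le[OF 1 2])
      also have "\<dots> = B * \<tau> ^ 6 + B' * (d * \<tau> ^ 3)" by (simp add: B'_def)
      also have "\<dots> \<le> (B + B') * (\<tau> ^ 6 + d * \<tau> ^ 3)"
      proof -
        have "0 \<le> B * (d * \<tau> ^ 3)" "0 \<le> B' * \<tau> ^ 6" using B0 d h C' S30 by (auto simp: B'_def)
        then show ?thesis by (simp add: algebra_simps)
      qed
      finally show ?thesis unfolding eq .
    qed
    have "(\<lambda>N. norm (Phi \<sigma> t N * of_real (exp (b * (\<Sum>n | n < N \<and> prime n. dilog (real n powr (- 2 * \<sigma>))))) - 1
        - edge_poly (prime_sum cf1 N) (prime_sum cf2 N) (prime_sum cf3 N) (prime_sum cf4 N) (prime_sum cf5 N) u b))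
      \<longlonglongrightarrow> norm (\<phi> * of_real (exp (b * psi \<sigma>)) - 1 - limit_poly u b)"
      unfolding limit_poly_def edge_poly_def
      by (intro tendsto_intros lim psi_tendsto[OF s] prime_sum_tendsto cf_quad_small)
    from LIMSEQ_le_const2[OF this] fin show ?thesis
      unfolding u_def b_def \<tau>_def d_def by blast
  qed
  show ?thesis
  proof (intro exI[of _ "B + B'"] conjI allI impI)
    show "0 \<le> B + B'" using B0 C' S30 by (simp add: B'_def)
  qed (rule main)
qed

lemma norm_local_factor_le_1:
  assumes "prime p" "\<sigma> > 1/2"
  shows "norm (1 - of_real ((cmod t)\<^sup>2 / 4) * local_G (real p powr (- 2 * \<sigma>)) (Re t) ((cmod t)\<^sup>2 / 4)) \<le> 1"
proof -
  interpret prob_space uniform_circle by (rule prob_space_uniform_circle)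
  define z where "z = real p powr (- \<sigma>)"
  have z2: "z\<^sup>2 = real p powr (- 2 * \<sigma>)" by (simp add: z_def power2_eq_square flip: powr_add)
  have z: "0 \<le> z" "z < 1"
    using assms prime_gt_1_nat[OF assms(1)] by (auto simp: z_def powr_minus inverse_less_1_iff gr_one_powr)
  have "norm (1 - of_real ((cmod t)\<^sup>2 / 4) * local_G (z\<^sup>2) (Re t) ((cmod t)\<^sup>2 / 4))
     = norm (\<integral>X. cis (Re (cnj t * (- Ln (1 - of_real z * X)))) \<partial>uniform_circle)"
    using local_char[OF z, of t] by simp
  also have "\<dots> \<le> (\<integral>X. norm (cis (Re (cnj t * (- Ln (1 - of_real z * X))))) \<partial>uniform_circle)"
    by (rule integral_norm_bound)
  also have "\<dots> = 1" using prob_space by simp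
  finally show ?thesis unfolding z2 .
qed

text \<open>Primes up to \<open>Y\<close> are estimated by 1. For a larger prime,
  \<open>x \<le> 1 / p < 1 / Y\<close> meets the smallness condition of
  \<open>local_factor_decay\<close> with \<open>s = Y / 8\<close>, so its factor is at most
  \<open>exp (- b * x / 2)\<close>; the sum of these \<open>x\<close> is \<open>psi\<close> up to a
  constant and \<open>ln Y\<close>.\<close>

lemma Phi_decay:
  "\<exists>C. \<forall>\<sigma> t \<phi> Y. \<sigma> > 1/2 \<longrightarrow> Phi \<sigma> t \<longlonglongrightarrow> \<phi> \<longrightarrow> Y \<ge> 1 \<longrightarrow> 8 * (1 + norm t + (norm t)\<^sup>2) \<le> real Y \<longrightarrow>
     norm \<phi> \<le> exp (- ((cmod t)\<^sup>2 / 8) * (psi \<sigma> - C - ln (real Y)))"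
proof -
  obtain C where C: "\<And>\<sigma> Y. \<sigma> > 1/2 \<Longrightarrow> Y \<ge> 1 \<Longrightarrow> psi \<sigma> - C - ln (real Y) \<le>
     (\<Sum>n. if prime n \<and> Y < n then real n powr (- 2 * \<sigma>) else 0)"
    using sum_prime_powr_ge by blast
  have "norm \<phi> \<le> exp (- ((cmod t)\<^sup>2 / 8) * (psi \<sigma> - C - ln (real Y)))"
    if s: "\<sigma> > 1/2" and lim: "Phi \<sigma> t \<longlonglongrightarrow> \<phi>" and Y: "Y \<ge> 1" "8 * (1 + norm t + (norm t)\<^sup>2) \<le> real Y" for \<sigma> t \<phi> and Y :: nat
  proof -
    define b where "b = (cmod t)\<^sup>2 / 4"
    define c where "c = (\<lambda>n. if prime n \<and> Y < n then real n powr (- 2 * \<sigma>) else 0)"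
    have b: "0 \<le> b" by (simp add: b_def)
    have bd: "norm (1 - of_real b * local_G (real n powr (- 2 * \<sigma>)) (Re t) b) \<le> exp (- b / 2 * c n)" if n: "prime n" for n
    proof (cases "Y < n")
      case True
      have x: "0 < real n powr (- 2 * \<sigma>)" "real n powr (- 2 * \<sigma>) \<le> 1 / real n" using prime_powr_bounds[OF n, of \<sigma>] s by auto
      have n0: "real n > 0" using prime_gt_0_nat[OF n] by simp
      have "norm (1 - of_real b * local_G (real n powr (- 2 * \<sigma>)) (Re t) b) \<le> exp (- b * (real n powr (- 2 * \<sigma>)) / 2)"
      proof (rule local_factor_decay[where s = "real Y / 8"])
        show "1 + \<bar>Re t\<bar> + b \<le> real Y / 8"
        proof -
          have "b \<le> (norm t)\<^sup>2" by (simp add: b_def)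
          then show ?thesis using Y(2) abs_Re_le_cmod[of t] by argo
        qed
        have "real n powr (- 2 * \<sigma>) * (real Y / 8) \<le> 1 / real n * (real n / 8)"
          using x True n0 by (intro mult_mono) auto
        then show "real n powr (- 2 * \<sigma>) * (real Y / 8) \<le> 1 / 8" using n0 by simp
      qed (use x b in auto)
      then show ?thesis using True n by (simp add: c_def)
    next
      case False
      then show ?thesis using norm_local_factor_le_1[OF n s, of t] by (simp add: c_def b_def)
    qed
    have sc: "summable c"
      by (rule summable_comparison_test'[OF summable_prime_powr[of "2 * \<sigma>"], of 0]) (use s in \<open>auto simp: c_def\<close>)
    have fin: "norm (Phi \<sigma> t N) \<le> exp (- b / 2 * (\<Sum>n<N. c n))" for N
    proof -
      have "norm (Phi \<sigma> t N) \<le> (\<Prod>n | n < N \<and> prime n. exp (- b / 2 * c n))"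
        unfolding Phi_def b_def[symmetric] prod_norm[symmetric] by (intro prod_mono conjI bd) auto
      also have "\<dots> = exp (\<Sum>n | n < N \<and> prime n. - b / 2 * c n)" by (simp add: exp_sum)
      also have "(\<Sum>n | n < N \<and> prime n. - b / 2 * c n) = (\<Sum>n<N. - b / 2 * c n)"
        by (intro sum.mono_neutral_left) (auto simp: c_def)
      finally show ?thesis by (simp add: sum_distrib_left)
    qed
    have l1: "(\<lambda>N. exp (- b / 2 * (\<Sum>n<N. c n))) \<longlonglongrightarrow> exp (- b / 2 * suminf c)"
      by (intro tendsto_intros summable_LIMSEQ sc)
    have l2: "(\<lambda>N. norm (Phi \<sigma> t N)) \<longlonglongrightarrow> norm \<phi>" by (intro tendsto_intros lim)
    have "norm \<phi> \<le> exp (- b / 2 * suminf c)"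
      by (rule LIMSEQ_le[OF l2 l1]) (use fin in blast)
    also have "\<dots> \<le> exp (- b / 2 * (psi \<sigma> - C - ln (real Y)))"
      using C[OF s Y(1)] b unfolding c_def by (intro iffD2[OF exp_le_cancel_iff] mult_left_mono_neg) auto
    finally show ?thesis by (simp add: b_def)
  qed
  then show ?thesis by blast
qed

subsection \<open>Almost sure convergence\<close>

text \<open>The mean value property of a function holomorphic near the disc, here as Parseval's
  identity with second series 1: only the coefficient of index 0 is selected.\<close>

lemma circle_mean_Ln:
  assumes "0 \<le> z" "z < 1"
  shows "(\<integral>X. Ln (1 - of_real z * X) \<partial>uniform_circle) = 0"
proof -
  \<comment> \<open>At \<open>n = 0\<close> the division by zero yields the coefficient 0, which is
    the correct one because \<open>Ln 1 = 0\<close>.\<close>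
  define a where "a n = (-1) ^ Suc n / of_nat n * (- complex_of_real z) ^ n" for n
  define b where "b n = (if n = 0 then 1 else 0 :: complex)" for n :: nat
  obtain r where r: "z < r" "r < 1" using dense[OF assms(2)] by blast
  have sa: "summable (\<lambda>n. norm (a n))"
    unfolding a_def
    by (rule powser_insidea[where x = "of_real r"])
       (use Ln_series[of "of_real r"] r assms in \<open>auto simp: sums_iff\<close>)
  have sb: "summable (\<lambda>n. norm (b n))"
    by (rule summable_finite[of "{0}"]) (auto simp: b_def)
  have b1: "(\<Sum>n. b n * cnj X ^ n) = 1" for X
    using suminf_finite[of "{0}" "\<lambda>n. b n * cnj X ^ n"] by (simp add: b_def)
  have a1: "(\<Sum>n. a n * X ^ n) = Ln (1 - of_real z * X)" if "norm X = 1" for X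
  proof -
    have "norm (- of_real z * X) < 1" using that assms by (simp add: norm_mult)
    from sums_unique[OF Ln_series[OF this]] show ?thesis
      unfolding a_def by (simp only: power_mult_distrib mult.assoc) simp
  qed
  have "(\<integral>X. Ln (1 - of_real z * X) \<partial>uniform_circle) = (\<integral>X. (\<Sum>n. a n * X ^ n) * (\<Sum>n. b n * cnj X ^ n) \<partial>uniform_circle)"
  proof (rule integral_cong_AE)
    show "AE X in uniform_circle. Ln (1 - of_real z * X) = (\<Sum>n. a n * X ^ n) * (\<Sum>n. b n * cnj X ^ n)"
      by (rule AE_uniform_circleI) (simp add: a1 b1)
  qed measurable
  also have "\<dots> = (\<Sum>n. a n * b n)" by (rule sums_unique[OF circle_parseval[OF sa sb]])
  also have "(\<lambda>n. a n * b n) = (\<lambda>n. 0)" by (auto simp: a_def b_def)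
  finally show ?thesis by simp
qed

lemma exp_quadratic_bound:
  fixes y :: real
  assumes "\<bar>y\<bar> \<le> 1"
  shows "exp y \<le> 1 + y + 2 * y\<^sup>2"
proof -
  obtain t where t: "\<bar>t\<bar> \<le> \<bar>y\<bar>" "exp y = (\<Sum>m<2. y ^ m / fact m) + exp t / fact 2 * y ^ 2"
    using Maclaurin_exp_le[of y 2] by blast
  have "exp t \<le> exp 1" using t assms by simp
  then have "exp t \<le> 3" using exp_le by linarith
  then have le: "exp t * y\<^sup>2 \<le> 3 * y\<^sup>2" by (intro mult_right_mono) auto
  moreover have "(\<Sum>m<2. y ^ m / fact m) = 1 + y" by (simp add: eval_nat_numeral)
  moreover have "fact 2 = (2::real)" by (simp add: eval_nat_numeral)
  ultimately have "exp y = 1 + y + exp t * y\<^sup>2 / 2" using t(2) by simp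
  then show ?thesis using le zero_le_power2[of y] by linarith
qed

text \<open>A sub-Gaussian bound: the linear term of the exponential integrates to zero, and
  \<open>|Y| \<le> 2 * z\<close> turns the quadratic term \<open>2 * (l * Y) ^ 2\<close> into
  \<open>8 * l ^ 2 * z ^ 2\<close>. The condition on \<open>l * z\<close> keeps the exponent within
  \<open>[-1, 1]\<close>, where the quadratic bound holds.\<close>

lemma circle_exp_moment:
  assumes z: "0 \<le> z" "z < 1/2" and c: "norm c \<le> 1" and l: "0 \<le> l" "2 * l * z \<le> 1"
  shows "(\<integral>X. exp (l * Re (c * (- Ln (1 - of_real z * X)))) \<partial>uniform_circle) \<le> exp (8 * l\<^sup>2 * z\<^sup>2)"
proof -
  interpret prob_space uniform_circle by (rule prob_space_uniform_circle)
  define Y where "Y X = Re (c * (- Ln (1 - of_real z * X)))" for X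
  have [measurable]: "Y \<in> borel_measurable borel" unfolding Y_def by measurable
  have Yb: "\<bar>Y X\<bar> \<le> 2 * z" if "norm X = 1" for X
  proof -
    have "norm (Ln (1 + (- of_real z * X))) \<le> 2 * norm (- of_real z * X)"
      by (rule norm_Ln_le) (use that z in \<open>simp add: norm_mult\<close>)
    then have L: "norm (Ln (1 - of_real z * X)) \<le> 2 * z" using that z by (simp add: norm_mult)
    have "\<bar>Y X\<bar> \<le> norm (c * (- Ln (1 - of_real z * X)))" unfolding Y_def by (rule abs_Re_le_cmod)
    also have "\<dots> \<le> 1 * (2 * z)" unfolding norm_mult using c L z by (intro mult_mono) auto
    finally show ?thesis by simp
  qed
  have Ln_int: "integrable uniform_circle (\<lambda>X. Ln (1 - of_real z * X))"
  proof (rule integrable_const_bound[where B = "2 * z"])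
    show "AE X in uniform_circle. norm (Ln (1 - of_real z * X)) \<le> 2 * z"
    proof (rule AE_uniform_circleI)
      fix X :: complex assume "norm X = 1"
      then show "norm (Ln (1 - of_real z * X)) \<le> 2 * z"
        using norm_Ln_le[of "- of_real z * X"] z by (simp add: norm_mult)
    qed
  qed measurable
  have Yint: "integrable uniform_circle Y" unfolding Y_def using Ln_int by simp
  have EY: "expectation Y = 0"
  proof -
    have "expectation Y = Re (\<integral>X. c * (- Ln (1 - of_real z * X)) \<partial>uniform_circle)"
      unfolding Y_def using Ln_int by (subst integral_Re) auto
    also have "(\<integral>X. c * (- Ln (1 - of_real z * X)) \<partial>uniform_circle) = c * (- (\<integral>X. Ln (1 - of_real z * X) \<partial>uniform_circle))"
      by simp
    also have "\<dots> = 0" using circle_mean_Ln[of z] z by simp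
    finally show ?thesis by simp
  qed
  have bd: "exp (l * Y X) \<le> 1 + l * Y X + 8 * l\<^sup>2 * z\<^sup>2" if "norm X = 1" for X
  proof -
    have lY: "\<bar>l * Y X\<bar> \<le> l * (2 * z)" using mult_left_mono[OF Yb[OF that] l(1)] l by (simp add: abs_mult)
    have "exp (l * Y X) \<le> 1 + l * Y X + 2 * (l * Y X)\<^sup>2"
      by (rule exp_quadratic_bound) (use lY l in linarith)
    moreover have "(l * Y X)\<^sup>2 \<le> (l * (2 * z))\<^sup>2"
      using lY by (simp add: abs_le_square_iff[symmetric])
    ultimately show ?thesis by (simp add: power_mult_distrib)
  qed
  have "(\<integral>X. exp (l * Y X) \<partial>uniform_circle) \<le> (\<integral>X. 1 + l * Y X + 8 * l\<^sup>2 * z\<^sup>2 \<partial>uniform_circle)"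
  proof (rule integral_mono_AE)
    show "AE X in uniform_circle. exp (l * Y X) \<le> 1 + l * Y X + 8 * l\<^sup>2 * z\<^sup>2"
      by (rule AE_uniform_circleI) (rule bd)
    show "integrable uniform_circle (\<lambda>X. exp (l * Y X))"
    proof (rule integrable_const_bound[where B = "exp (l * (2 * z))"])
      show "AE X in uniform_circle. norm (exp (l * Y X)) \<le> exp (l * (2 * z))"
      proof (rule AE_uniform_circleI)
        fix X :: complex assume "norm X = 1"
        then have "Y X \<le> 2 * z" using Yb[of X] by simp
        then show "norm (exp (l * Y X)) \<le> exp (l * (2 * z))" using l by (simp add: mult_left_mono)
      qed
    qed measurable
  qed (use Yint in auto)
  also have "\<dots> = 1 + 8 * l\<^sup>2 * z\<^sup>2" using Yint EY prob_space by simp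
  also have "\<dots> \<le> exp (8 * l\<^sup>2 * z\<^sup>2)" by (rule exp_ge_add_one_self)
  finally show ?thesis unfolding Y_def .
qed

section \<open>The random sum over primes and its limit\<close>

locale random_primes = prob_space M for M :: "'a measure" +
  fixes X :: "nat \<Rightarrow> 'a \<Rightarrow> complex"
  assumes indep: "indep_vars (\<lambda>_. borel) X {p. prime p}"
    and dist: "\<And>p. prime p \<Longrightarrow> distr M borel (X p) = uniform_circle"
begin

definition lterm :: "real \<Rightarrow> nat \<Rightarrow> 'a \<Rightarrow> complex" where
  "lterm \<sigma> n \<omega> = (if prime n then - Ln (1 - X n \<omega> / of_real (real n powr \<sigma>)) else 0)"

definition lsum :: "real \<Rightarrow> nat \<Rightarrow> 'a \<Rightarrow> complex" where
  "lsum \<sigma> N \<omega> = (\<Sum>n<N. lterm \<sigma> n \<omega>)"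

lemma X_measurable: "prime p \<Longrightarrow> X p \<in> borel_measurable M"
  using indep unfolding indep_vars_def by auto

lemma lterm_measurable [measurable]: "lterm \<sigma> n \<in> borel_measurable M"
proof (cases "prime n")
  case True
  have [measurable]: "X n \<in> borel_measurable M" using X_measurable[OF True] .
  show ?thesis using True unfolding lterm_def[abs_def] by simp
qed (simp add: lterm_def[abs_def])

lemma lsum_measurable [measurable]: "lsum \<sigma> N \<in> borel_measurable M"
  unfolding lsum_def[abs_def] by measurable

lemma lterm_eq: "prime n \<Longrightarrow> lterm \<sigma> n \<omega> = - Ln (1 - of_real (real n powr - \<sigma>) * X n \<omega>)"
  by (simp add: lterm_def powr_minus divide_inverse mult.commute of_real_inverse)

lemma integral_X:
  fixes f :: "complex \<Rightarrow> 'b :: {banach, second_countable_topology}"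
  assumes "prime p" "f \<in> borel_measurable borel"
  shows "(\<integral>\<omega>. f (X p \<omega>) \<partial>M) = integral\<^sup>L uniform_circle f"
  unfolding dist[OF assms(1), symmetric]
  by (rule integral_distr[symmetric]) (use assms X_measurable in auto)

lemma expectation_prod:
  fixes f :: "nat \<Rightarrow> complex \<Rightarrow> 'b :: {real_normed_field, banach, second_countable_topology}"
  assumes A: "finite A" "A \<subseteq> {p. prime p}" and m: "\<And>p. p \<in> A \<Longrightarrow> f p \<in> borel_measurable borel"
    and i: "\<And>p. p \<in> A \<Longrightarrow> integrable uniform_circle (f p)"
  shows "(\<integral>\<omega>. (\<Prod>p\<in>A. f p (X p \<omega>)) \<partial>M) = (\<Prod>p\<in>A. integral\<^sup>L uniform_circle (f p))"
    "integrable M (\<lambda>\<omega>. \<Prod>p\<in>A. f p (X p \<omega>))"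
proof -
  have ind: "indep_vars (\<lambda>_. borel) (\<lambda>p \<omega>. f p (X p \<omega>)) A"
    by (rule indep_vars_compose2[OF indep_vars_subset[OF indep A(2)]]) (rule m)
  have int: "integrable M (\<lambda>\<omega>. f p (X p \<omega>))" if "p \<in> A" for p
  proof -
    have p: "prime p" using A that by auto
    from i[OF that] show ?thesis
      unfolding dist[OF p, symmetric]
      by (subst (asm) integrable_distr_eq) (use p X_measurable m[OF that] in auto)
  qed
  show "(\<integral>\<omega>. (\<Prod>p\<in>A. f p (X p \<omega>)) \<partial>M) = (\<Prod>p\<in>A. integral\<^sup>L uniform_circle (f p))"
    by (subst indep_vars_lebesgue_integral[OF A(1) ind int])
       (use A m in \<open>auto intro!: prod.cong integral_X\<close>)
  show "integrable M (\<lambda>\<omega>. \<Prod>p\<in>A. f p (X p \<omega>))"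
    by (rule indep_vars_integrable[OF A(1) ind int])
qed

lemma lsum_prime: "lsum \<sigma> N \<omega> = (\<Sum>n | n < N \<and> prime n. - Ln (1 - of_real (real n powr - \<sigma>) * X n \<omega>))"
proof -
  have "lsum \<sigma> N \<omega> = (\<Sum>n | n < N \<and> prime n. lterm \<sigma> n \<omega>)"
    unfolding lsum_def by (intro sum.mono_neutral_right) (auto simp: lterm_def)
  then show ?thesis by (simp add: lterm_eq)
qed

lemma char_lsum:
  assumes "\<sigma> > 1/2"
  shows "(\<integral>\<omega>. cis (Re (cnj t * lsum \<sigma> N \<omega>)) \<partial>M) = Phi \<sigma> t N"
proof -
  interpret U: prob_space uniform_circle by (rule prob_space_uniform_circle)
  define A where "A = {n. n < N \<and> prime n}"
  define f where "f n x = cis (Re (cnj t * (- Ln (1 - of_real (real n powr - \<sigma>) * x))))" for n :: nat and x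
  have [measurable]: "f n \<in> borel_measurable borel" for n unfolding f_def by measurable
  have "cis (Re (cnj t * lsum \<sigma> N \<omega>)) = (\<Prod>n\<in>A. f n (X n \<omega>))" for \<omega>
    unfolding lsum_prime A_def[symmetric] f_def
    by (simp only: sum_distrib_left Re_sum cis_conv_exp of_real_sum sum_distrib_left) (simp add: A_def exp_sum)
  then have "(\<integral>\<omega>. cis (Re (cnj t * lsum \<sigma> N \<omega>)) \<partial>M) = (\<integral>\<omega>. (\<Prod>n\<in>A. f n (X n \<omega>)) \<partial>M)" by simp
  also have "\<dots> = (\<Prod>n\<in>A. integral\<^sup>L uniform_circle (f n))"
    by (rule expectation_prod(1)) (auto simp: A_def f_def intro!: U.integrable_const_bound[where B = 1])
  also have "\<dots> = Phi \<sigma> t N"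
    unfolding Phi_def A_def
  proof (intro prod.cong refl)
    fix p assume "p \<in> {n. n < N \<and> prime n}"
    then have p: "real p > 1" using prime_gt_1_nat[of p] by auto
    define z where "z = real p powr - \<sigma>"
    have z2: "z\<^sup>2 = real p powr (- 2 * \<sigma>)" by (simp add: z_def power2_eq_square flip: powr_add)
    have z: "0 \<le> z" "z < 1"
      using assms p by (auto simp: z_def powr_minus inverse_less_1_iff gr_one_powr)
    show "integral\<^sup>L uniform_circle (f p) = 1 - of_real ((cmod t)\<^sup>2 / 4) * local_G (real p powr (- 2 * \<sigma>)) (Re t) ((cmod t)\<^sup>2 / 4)"
      unfolding f_def z_def[symmetric] z2[symmetric] by (rule local_char[OF z])
  qed
  finally show ?thesis .
qed

text \<open>By independence the exponential moments of the single primes multiply, so the variance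
  proxies add. The unit factor \<open>c\<close> selects a direction in the plane.\<close>

lemma exp_moment:
  assumes s: "\<sigma> > 1/2" and MN: "5 \<le> m" "m \<le> N" and c: "norm c \<le> 1"
    and l: "0 \<le> l" "2 * l * real m powr - \<sigma> \<le> 1"
  shows "integrable M (\<lambda>\<omega>. exp (l * Re (c * (lsum \<sigma> N \<omega> - lsum \<sigma> m \<omega>))))"
    "(\<integral>\<omega>. exp (l * Re (c * (lsum \<sigma> N \<omega> - lsum \<sigma> m \<omega>))) \<partial>M) \<le> exp (8 * l\<^sup>2 * (\<Sum>n=m..<N. real n powr (- 2 * \<sigma>)))"
proof -
  interpret U: prob_space uniform_circle by (rule prob_space_uniform_circle)
  define A where "A = {n. m \<le> n \<and> n < N \<and> prime n}"
  have finA: "finite A" unfolding A_def by simp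
  define z where "z n = real n powr - \<sigma>" for n :: nat
  define f where "f n x = exp (l * Re (c * (- Ln (1 - of_real (z n) * x))))" for n :: nat and x
  have [measurable]: "f n \<in> borel_measurable borel" for n unfolding f_def by measurable
  have z: "0 \<le> z n" "z n < 1/2" "2 * l * z n \<le> 1" if "n \<in> A" for n
  proof -
    \<comment> \<open>From 5 on, \<open>n powr (- 1/2)\<close> is strictly below 1/2, as required by
      the estimate of \<open>Ln (1 - z * X)\<close>; at 4 there would be equality.\<close>
    have n: "real n \<ge> 5" "real n \<ge> real m" using that MN by (auto simp: A_def)
    show "0 \<le> z n" by (simp add: z_def)
    have "z n \<le> 5 powr - \<sigma>" unfolding z_def using n s by (intro powr_mono2') auto
    also have "\<dots> \<le> 5 powr - (1/2)" using s by (intro powr_mono) auto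
    also have "\<dots> < 1/2"
    proof -
      have "sqrt 4 < sqrt 5" by (rule real_sqrt_less_mono) simp
      then have "2 < sqrt 5" by simp
      then show ?thesis by (simp add: powr_minus powr_half_sqrt inverse_eq_divide field_simps)
    qed
    finally show "z n < 1/2" .
    have "z n \<le> real m powr - \<sigma>" unfolding z_def using n s MN by (intro powr_mono2') auto
    then have "2 * l * z n \<le> 2 * l * real m powr - \<sigma>" using l by (intro mult_left_mono) auto
    then show "2 * l * z n \<le> 1" using l by simp
  qed
  have fi: "integrable uniform_circle (f n)" if n: "n \<in> A" for n
  proof (rule U.integrable_const_bound[where B = "exp 1"])
    show "AE x in uniform_circle. norm (f n x) \<le> exp 1"
    proof (rule AE_uniform_circleI)
      fix x :: complex assume x: "norm x = 1"
      have "Re (c * (- Ln (1 - of_real (z n) * x))) \<le> norm (c * (- Ln (1 - of_real (z n) * x)))" by (rule complex_Re_le_cmod)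
      also have "\<dots> \<le> 1 * (2 * z n)"
        unfolding norm_mult using c x z[OF n] norm_Ln_le[of "- of_real (z n) * x"] by (intro mult_mono) (auto simp: norm_mult)
      finally have "l * Re (c * (- Ln (1 - of_real (z n) * x))) \<le> l * (2 * z n)" using l by (intro mult_left_mono) auto
      then show "norm (f n x) \<le> exp 1" unfolding f_def using z(3)[OF n] by simp
    qed
  qed measurable
  have diff: "lsum \<sigma> N \<omega> - lsum \<sigma> m \<omega> = (\<Sum>n\<in>A. - Ln (1 - of_real (z n) * X n \<omega>))" for \<omega>
  proof -
    have "lsum \<sigma> N \<omega> - lsum \<sigma> m \<omega> = (\<Sum>n\<in>{n. n < N \<and> prime n} - {n. n < m \<and> prime n}. - Ln (1 - of_real (z n) * X n \<omega>))"
      unfolding lsum_prime z_def using MN by (subst sum_diff) auto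
    also have "{n. n < N \<and> prime n} - {n. n < m \<and> prime n} = A" by (auto simp: A_def)
    finally show ?thesis .
  qed
  have eq: "exp (l * Re (c * (lsum \<sigma> N \<omega> - lsum \<sigma> m \<omega>))) = (\<Prod>n\<in>A. f n (X n \<omega>))" for \<omega>
    unfolding diff f_def by (simp only: sum_distrib_left Re_sum exp_sum[OF finA])
  have Ap: "A \<subseteq> {p. prime p}" by (auto simp: A_def)
  show "integrable M (\<lambda>\<omega>. exp (l * Re (c * (lsum \<sigma> N \<omega> - lsum \<sigma> m \<omega>))))"
    unfolding eq by (rule expectation_prod(2)[OF finA Ap]) (auto intro: fi)
  have "(\<integral>\<omega>. exp (l * Re (c * (lsum \<sigma> N \<omega> - lsum \<sigma> m \<omega>))) \<partial>M) = (\<Prod>n\<in>A. integral\<^sup>L uniform_circle (f n))"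
    unfolding eq by (rule expectation_prod(1)[OF finA Ap]) (auto intro: fi)
  also have "\<dots> \<le> (\<Prod>n\<in>A. exp (8 * l\<^sup>2 * (z n)\<^sup>2))"
  proof (intro prod_mono conjI)
    fix n assume n: "n \<in> A"
    show "0 \<le> integral\<^sup>L uniform_circle (f n)" by (intro Bochner_Integration.integral_nonneg) (simp add: f_def)
    show "integral\<^sup>L uniform_circle (f n) \<le> exp (8 * l\<^sup>2 * (z n)\<^sup>2)"
      unfolding f_def by (rule circle_exp_moment[OF z(1,2)[OF n] c l(1) z(3)[OF n]])
  qed
  also have "\<dots> = exp (8 * l\<^sup>2 * (\<Sum>n\<in>A. (z n)\<^sup>2))" by (simp add: exp_sum[OF finA] sum_distrib_left)
  also have "\<dots> \<le> exp (8 * l\<^sup>2 * (\<Sum>n=m..<N. real n powr (- 2 * \<sigma>)))"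
  proof -
    have "(\<Sum>n\<in>A. (z n)\<^sup>2) = (\<Sum>n\<in>A. real n powr (- 2 * \<sigma>))"
      by (simp add: z_def power2_eq_square flip: powr_add)
    also have "\<dots> \<le> (\<Sum>n=m..<N. real n powr (- 2 * \<sigma>))" by (rule sum_mono2) (auto simp: A_def)
    finally show ?thesis by (simp add: mult_left_mono)
  qed
  finally show "(\<integral>\<omega>. exp (l * Re (c * (lsum \<sigma> N \<omega> - lsum \<sigma> m \<omega>))) \<partial>M) \<le> exp (8 * l\<^sup>2 * (\<Sum>n=m..<N. real n powr (- 2 * \<sigma>)))" .
qed


text \<open>Chernoff's bound in the four directions 1, -1, \<open>\<i>\<close>,
  \<open>-\<i>\<close>: a complex number of norm at least \<open>2 * \<epsilon>\<close> has real
  part at least \<epsilon> after multiplication by one of them. The tail of the variance beyond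
  \<open>m\<close> is \<open>O(m powr (- \<eta>))\<close>, uniformly in \<open>N\<close>.\<close>

lemma deviation_bound:
  assumes s: "\<sigma> > 1/2"
  defines "\<eta> \<equiv> \<sigma> - 1/2"
  obtains C where "C \<ge> 0" "\<And>m N. 5 \<le> m \<Longrightarrow> m \<le> N \<Longrightarrow>
    measure M {\<omega>\<in>space M. 2 * real m powr (- \<eta> / 4) \<le> norm (lsum \<sigma> N \<omega> - lsum \<sigma> m \<omega>)} \<le> C * exp (- (real m powr (\<eta> / 4)))"
proof -
  have eta: "\<eta> > 0" using s by (simp add: \<eta>_def)
  define K where "K = (\<Sum>n. real n powr (- (1 + \<eta>)))"
  have sK: "summable (\<lambda>n. real n powr (- (1 + \<eta>)))"
    using summable_real_powr_iff[of "- (1 + \<eta>)"] eta by simp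
  have tail: "(\<Sum>n=m..<N. real n powr (- 2 * \<sigma>)) \<le> real m powr (- \<eta>) * K" if "5 \<le> m" for m N :: nat
  proof -
    have "(\<Sum>n=m..<N. real n powr (- 2 * \<sigma>)) \<le> (\<Sum>n=m..<N. real m powr (- \<eta>) * real n powr (- (1 + \<eta>)))"
    proof (rule sum_mono)
      fix n assume n: "n \<in> {m..<N}"
      have "real n powr (- 2 * \<sigma>) = real n powr (- \<eta>) * real n powr (- (1 + \<eta>))"
        unfolding \<eta>_def by (simp only: powr_add[symmetric]) simp
      also have "\<dots> \<le> real m powr (- \<eta>) * real n powr (- (1 + \<eta>))"
        using n that eta by (intro mult_right_mono powr_mono2') auto
      finally show "real n powr (- 2 * \<sigma>) \<le> real m powr (- \<eta>) * real n powr (- (1 + \<eta>))" .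
    qed
    also have "\<dots> = real m powr (- \<eta>) * (\<Sum>n=m..<N. real n powr (- (1 + \<eta>)))" by (simp add: sum_distrib_left)
    also have "\<dots> \<le> real m powr (- \<eta>) * K"
      unfolding K_def by (intro mult_left_mono sum_le_suminf sK) auto
    finally show ?thesis .
  qed
  show ?thesis
  proof (rule that[of "4 * exp (8 * K)"])
    fix m N :: nat assume m: "5 \<le> m" and N: "m \<le> N"
    have m0: "real m > 0" using m by simp
    \<comment> \<open>The balance in Chernoff's bound: \<open>l ^ 2\<close> times the tail variance
      stays bounded, while \<open>l * \<epsilon> = m powr (\<eta> / 4)\<close> still grows, so the
      probabilities are summable.\<close>
    define l where "l = real m powr (\<eta> / 2)"
    define \<epsilon> where "\<epsilon> = real m powr (- \<eta> / 4)"
    have l: "0 \<le> l" by (simp add: l_def)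
    have l2: "2 * l * real m powr - \<sigma> \<le> 1"
    proof -
      have "l * real m powr - \<sigma> = real m powr (- 1/2 - \<eta> / 2)"
        unfolding l_def \<eta>_def by (simp only: powr_add[symmetric]) (simp add: field_simps)
      also have "\<dots> \<le> real m powr (- (1/2))" using m eta by (intro powr_mono) auto
      also have "\<dots> \<le> 4 powr (- (1/2))" using m by (intro powr_mono2') auto
      also have "\<dots> = 1/2" by (simp add: powr_minus powr_half_sqrt)
      finally show ?thesis by simp
    qed
    have le: "l * \<epsilon> = real m powr (\<eta> / 4)"
      unfolding l_def \<epsilon>_def by (simp only: powr_add[symmetric]) simp
    have ll: "8 * l\<^sup>2 * (\<Sum>n=m..<N. real n powr (- 2 * \<sigma>)) \<le> 8 * K"
    proof -
      have "l\<^sup>2 * (\<Sum>n=m..<N. real n powr (- 2 * \<sigma>)) \<le> l\<^sup>2 * (real m powr (- \<eta>) * K)"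
        using tail[OF m] by (intro mult_left_mono) auto
      also have "l\<^sup>2 * (real m powr (- \<eta>) * K) = (l * l * real m powr (- \<eta>)) * K" by (simp add: power2_eq_square)
      also have "l * l * real m powr (- \<eta>) = 1"
        unfolding l_def using m0 by (simp only: powr_add[symmetric]) simp
      finally show ?thesis by simp
    qed
    define D where "D \<omega> = lsum \<sigma> N \<omega> - lsum \<sigma> m \<omega>" for \<omega>
    have [measurable]: "D \<in> borel_measurable M" unfolding D_def by measurable
    define E where "E c = {\<omega>\<in>space M. exp (l * \<epsilon>) \<le> exp (l * Re (c * D \<omega>))}" for c
    have Es: "E c \<in> sets M" for c unfolding E_def by measurable
    have P: "measure M (E c) \<le> exp (8 * K) * exp (- (real m powr (\<eta> / 4)))" if c: "norm c \<le> 1" for c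
    proof -
      have "measure M (E c) \<le> (\<integral>\<omega>. exp (l * Re (c * D \<omega>)) \<partial>M) / exp (l * \<epsilon>)"
        unfolding E_def D_def
        using exp_moment(1)[OF s m N c l l2] by (intro integral_Markov_inequality_measure[where A = "{}"]) auto
      also have "\<dots> \<le> exp (8 * K) / exp (l * \<epsilon>)"
        using order_trans[OF exp_moment(2)[OF s m N c l l2], of "exp (8 * K)"] ll
        by (intro divide_right_mono) (auto simp: D_def)
      finally show ?thesis unfolding le by (simp only: exp_minus divide_inverse)
    qed
    have l0: "l > 0" using m0 by (simp add: l_def)
    have sub: "{\<omega>\<in>space M. 2 * \<epsilon> \<le> norm (D \<omega>)} \<subseteq> (\<Union>c\<in>{1, -1, \<i>, -\<i>}. E c)"
    proof
      fix \<omega> assume "\<omega> \<in> {\<omega>\<in>space M. 2 * \<epsilon> \<le> norm (D \<omega>)}"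
      then have w: "\<omega> \<in> space M" "2 * \<epsilon> \<le> \<bar>Re (D \<omega>)\<bar> + \<bar>Im (D \<omega>)\<bar>" using cmod_le[of "D \<omega>"] by auto
      then have "\<epsilon> \<le> Re (D \<omega>) \<or> \<epsilon> \<le> - Re (D \<omega>) \<or> \<epsilon> \<le> Im (D \<omega>) \<or> \<epsilon> \<le> - Im (D \<omega>)" by linarith
      then have "\<exists>c\<in>{1, -1, \<i>, -\<i>}. \<epsilon> \<le> Re (c * D \<omega>)" by auto
      then show "\<omega> \<in> (\<Union>c\<in>{1, -1, \<i>, -\<i>}. E c)" using w l0 unfolding E_def by auto
    qed
    have "measure M {\<omega>\<in>space M. 2 * \<epsilon> \<le> norm (D \<omega>)} \<le> measure M (\<Union>c\<in>{1, -1, \<i>, -\<i>}. E c)"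
      by (rule finite_measure_mono[OF sub]) (use Es in auto)
    also have "\<dots> \<le> (\<Sum>c\<in>{1, -1, \<i>, -\<i>}. measure M (E c))"
      by (rule measure_UNION_le) (use Es in auto)
    also have "\<dots> \<le> (\<Sum>c\<in>{1, -1, \<i>, -\<i>::complex}. exp (8 * K) * exp (- (real m powr (\<eta> / 4))))"
      by (intro sum_mono P) auto
    also have "\<dots> = real (card {1, -1, \<i>, -\<i>::complex}) * (exp (8 * K) * exp (- (real m powr (\<eta> / 4))))" by simp
    also have "\<dots> \<le> 4 * (exp (8 * K) * exp (- (real m powr (\<eta> / 4))))"
      by (intro mult_right_mono) (auto simp: card_insert_if)
    finally show "measure M {\<omega>\<in>space M. 2 * real m powr (- \<eta> / 4) \<le> norm (lsum \<sigma> N \<omega> - lsum \<sigma> m \<omega>)}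
       \<le> 4 * exp (8 * K) * exp (- (real m powr (\<eta> / 4)))"
      unfolding \<epsilon>_def D_def by simp
  qed simp
qed

text \<open>Comparing \<open>lsum \<sigma> k\<close> with \<open>lsum \<sigma> (2 ^ k)\<close>, instead of taking a maximum over blocks,
  makes a single deviation estimate per \<open>k\<close> sufficient.\<close>

lemma AE_lsum_convergent:
  assumes s: "\<sigma> > 1/2"
  shows "AE \<omega> in M. convergent (\<lambda>N. lsum \<sigma> N \<omega>)"
proof -
  define \<eta> where "\<eta> = \<sigma> - 1/2"
  have eta: "\<eta> > 0" using s by (simp add: \<eta>_def)
  obtain C where C: "C \<ge> 0" "\<And>m N. 5 \<le> m \<Longrightarrow> m \<le> N \<Longrightarrow>
    measure M {\<omega>\<in>space M. 2 * real m powr (- \<eta> / 4) \<le> norm (lsum \<sigma> N \<omega> - lsum \<sigma> m \<omega>)} \<le> C * exp (- (real m powr (\<eta> / 4)))"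
    by (rule deviation_bound[OF s, folded \<eta>_def]) (rule that)
  have BC: "AE \<omega> in M. \<forall>\<^sub>F k in sequentially. norm (lsum \<sigma> (b k) \<omega> - lsum \<sigma> (a k) \<omega>) \<le> 2 * real (a k) powr (- \<eta> / 4)"
    if ab: "\<And>k. k \<le> a k" "\<And>k. a k \<le> b k" for a b :: "nat \<Rightarrow> nat"
  proof -
    define A where "A k = {\<omega>\<in>space M. 2 * real (a k) powr (- \<eta> / 4) \<le> norm (lsum \<sigma> (b k) \<omega> - lsum \<sigma> (a k) \<omega>)}" for k
    have A: "A k \<in> sets M" for k unfolding A_def by measurable
    have "(\<lambda>k. exp (- (real k powr (\<eta> / 4)))) \<in> O(\<lambda>k. real k powr - 2)" using eta by real_asymp
    then have "summable (\<lambda>k. exp (- (real k powr (\<eta> / 4))))"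
      using summable_real_powr_iff[of "-2"] by (elim summable_comparison_test_bigo[rotated]) simp
    then have sm: "summable (\<lambda>k. C * exp (- (real k powr (\<eta> / 4))))" by (rule summable_mult)
    have "summable (\<lambda>k. measure M (A k))"
    proof (rule summable_comparison_test'[OF sm, of 5])
      fix k :: nat assume k: "5 \<le> k"
      have "measure M (A k) \<le> C * exp (- (real (a k) powr (\<eta> / 4)))"
        unfolding A_def using C(2)[of "a k" "b k"] ab[of k] k by auto
      also have "\<dots> \<le> C * exp (- (real k powr (\<eta> / 4)))"
        using ab[of k] eta C(1) by (intro mult_left_mono) (auto intro!: powr_mono2)
      finally show "norm (measure M (A k)) \<le> C * exp (- (real k powr (\<eta> / 4)))" by simp
    qed
    from borel_cantelli_AE1[OF A _ this] have "AE \<omega> in M. \<forall>\<^sub>F k in sequentially. \<omega> \<in> space M - A k"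
      by (simp add: emeasure_eq_measure)
    then show ?thesis
      by eventually_elim (auto elim!: eventually_mono simp: A_def)
  qed
  have e1: "k \<le> (2::nat) ^ k" for k by (simp add: less_imp_le)
  \<comment> \<open>The pairs \<open>2 ^ k\<close>, \<open>2 ^ Suc k\<close> have geometrically
    small differences, which gives convergence along powers of two; the pairs \<open>k\<close>,
    \<open>2 ^ k\<close> transfer this limit to the whole sequence, since their differences tend to
    0.\<close>
  from BC[of "\<lambda>k. k" "\<lambda>k. 2 ^ k"] BC[of "\<lambda>k. 2 ^ k" "\<lambda>k. 2 ^ Suc k"] e1
  have "AE \<omega> in M. \<forall>\<^sub>F k in sequentially. norm (lsum \<sigma> (2 ^ k) \<omega> - lsum \<sigma> k \<omega>) \<le> 2 * real k powr (- \<eta> / 4)"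
    "AE \<omega> in M. \<forall>\<^sub>F k in sequentially. norm (lsum \<sigma> (2 ^ Suc k) \<omega> - lsum \<sigma> (2 ^ k) \<omega>) \<le> 2 * real (2 ^ k) powr (- \<eta> / 4)"
    by auto
  then show ?thesis
  proof eventually_elim
    case (elim \<omega>)
    define r where "r = 2 powr (- \<eta> / 4)"
    have r: "0 \<le> r" "r < 1" using eta by (auto simp: r_def powr_less_one)
    have rk: "real (2 ^ k) powr (- \<eta> / 4) = r ^ k" for k
      by (simp add: r_def powr_powr mult.commute flip: powr_realpow)
    have sm: "summable (\<lambda>k. lsum \<sigma> (2 ^ Suc k) \<omega> - lsum \<sigma> (2 ^ k) \<omega>)"
    proof (rule summable_comparison_test_ev)
      show "\<forall>\<^sub>F k in sequentially. norm (lsum \<sigma> (2 ^ Suc k) \<omega> - lsum \<sigma> (2 ^ k) \<omega>) \<le> 2 * r ^ k"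
        using elim(2) unfolding rk .
      show "summable (\<lambda>k. 2 * r ^ k)" using r by (intro summable_mult) auto
    qed
    have "convergent (\<lambda>n. \<Sum>k<n. lsum \<sigma> (2 ^ Suc k) \<omega> - lsum \<sigma> (2 ^ k) \<omega>)"
      using sm by (simp add: summable_iff_convergent)
    then have "convergent (\<lambda>n. lsum \<sigma> (2 ^ n) \<omega> - lsum \<sigma> (2 ^ 0) \<omega>)"
      unfolding sum_lessThan_telescope[of "\<lambda>n. lsum \<sigma> (2 ^ n) \<omega>"] .
    then have "convergent (\<lambda>n. (lsum \<sigma> (2 ^ n) \<omega> - lsum \<sigma> (2 ^ 0) \<omega>) + lsum \<sigma> (2 ^ 0) \<omega>)"
      by (intro convergent_add convergent_const)
    then obtain L where L: "(\<lambda>n. lsum \<sigma> (2 ^ n) \<omega>) \<longlonglongrightarrow> L" by (auto simp: convergent_def)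
    have "(\<lambda>n. lsum \<sigma> (2 ^ n) \<omega> - lsum \<sigma> n \<omega>) \<longlonglongrightarrow> 0"
    proof (rule Lim_null_comparison[OF elim(1)])
      show "(\<lambda>k. 2 * real k powr (- \<eta> / 4)) \<longlonglongrightarrow> 0" using eta by real_asymp
    qed
    from tendsto_diff[OF L this] show ?case by (auto simp: convergent_def)
  qed
qed

definition log_zeta_X :: "real \<Rightarrow> 'a \<Rightarrow> complex" where
  "log_zeta_X \<sigma> \<omega> = log_zeta \<sigma> (\<lambda>p. X p \<omega>)"

lemma log_zeta_X_measurable [measurable]: "log_zeta_X \<sigma> \<in> borel_measurable M"
proof -
  have "log_zeta_X \<sigma> = (\<lambda>\<omega>. - (\<Sum>n. - lterm \<sigma> n \<omega>))"
    unfolding log_zeta_X_def log_zeta_def lterm_def by (intro ext) (simp add: if_distrib cong: if_cong)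
  then show ?thesis by simp
qed

lemma AE_log_zeta_X:
  assumes "\<sigma> > 1/2"
  shows "AE \<omega> in M. (\<lambda>N. lsum \<sigma> N \<omega>) \<longlonglongrightarrow> log_zeta_X \<sigma> \<omega>"
  using AE_lsum_convergent[OF assms]
proof eventually_elim
  case (elim \<omega>)
  then have sm: "summable (\<lambda>n. lterm \<sigma> n \<omega>)" unfolding lsum_def by (simp add: summable_iff_convergent)
  have "log_zeta_X \<sigma> \<omega> = - (\<Sum>n. - lterm \<sigma> n \<omega>)"
    unfolding log_zeta_X_def log_zeta_def lterm_def by (simp add: if_distrib cong: if_cong)
  also have "\<dots> = (\<Sum>n. lterm \<sigma> n \<omega>)" using suminf_minus[OF sm] by simp
  finally show ?case unfolding lsum_def using summable_LIMSEQ[OF sm] by simp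
qed

text \<open>Dominated convergence along the almost sure limit. This provides the convergence of
  \<open>Phi\<close> assumed in the analytic estimates.\<close>

lemma char_log_zeta_X:
  assumes "\<sigma> > 1/2"
  shows "Phi \<sigma> t \<longlonglongrightarrow> (\<integral>\<omega>. cis (Re (cnj t * log_zeta_X \<sigma> \<omega>)) \<partial>M)"
proof -
  have "(\<lambda>N. \<integral>\<omega>. cis (Re (cnj t * lsum \<sigma> N \<omega>)) \<partial>M) \<longlonglongrightarrow> (\<integral>\<omega>. cis (Re (cnj t * log_zeta_X \<sigma> \<omega>)) \<partial>M)"
  proof (rule integral_dominated_convergence[where w = "\<lambda>_. 1"])
    show "AE \<omega> in M. (\<lambda>N. cis (Re (cnj t * lsum \<sigma> N \<omega>))) \<longlonglongrightarrow> cis (Re (cnj t * log_zeta_X \<sigma> \<omega>))"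
      using AE_log_zeta_X[OF assms]
    proof eventually_elim
      case (elim \<omega>)
      have "isCont cis x" for x using continuous_on_cis[OF continuous_on_id, of UNIV] by (simp add: continuous_on_eq_continuous_at)
      then show ?case by (rule isCont_tendsto_compose) (intro tendsto_intros elim)
    qed
  qed auto
  then show ?thesis unfolding char_lsum[OF assms] .
qed

end

subsection \<open>Gaussian Fourier integrals and smoothing\<close>

lemma (in prob_space) swap_expectation:
  fixes f :: "'a \<Rightarrow> real \<Rightarrow> 'b :: {banach, second_countable_topology}"
  assumes [measurable]: "(\<lambda>(\<omega>, u). f \<omega> u) \<in> borel_measurable (M \<Otimes>\<^sub>M lborel)"
    and g: "integrable lborel g" and b: "\<And>\<omega> u. norm (f \<omega> u) \<le> g u"
  shows "integrable lborel (\<lambda>u. \<integral>\<omega>. f \<omega> u \<partial>M)"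
    "(\<integral>\<omega>. (\<integral>u. f \<omega> u \<partial>lborel) \<partial>M) = (\<integral>u. (\<integral>\<omega>. f \<omega> u \<partial>M) \<partial>lborel)"
proof -
  interpret P: pair_sigma_finite M lborel ..
  have [measurable]: "g \<in> borel_measurable borel" using g by simp
  have gp: "integrable (M \<Otimes>\<^sub>M lborel) (\<lambda>(\<omega>, u). g u)"
  proof (rule P.Fubini_integrable)
    show "AE \<omega> in M. integrable lborel (\<lambda>u. case (\<omega>, u) of (\<omega>, u) \<Rightarrow> g u)" using g by simp
  qed (use g in simp_all)
  have int: "integrable (M \<Otimes>\<^sub>M lborel) (\<lambda>(\<omega>, u). f \<omega> u)"
  proof (rule Bochner_Integration.integrable_bound[OF gp])
    have "norm (f \<omega> u) \<le> norm (g u)" for \<omega> u using b[of \<omega> u] by (auto intro: order_trans[OF b])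
    then show "AE x in M \<Otimes>\<^sub>M lborel. norm (case x of (\<omega>, u) \<Rightarrow> f \<omega> u) \<le> norm (case x of (\<omega>, u) \<Rightarrow> g u)"
      by (intro AE_I2) auto
  qed simp
  show "integrable lborel (\<lambda>u. \<integral>\<omega>. f \<omega> u \<partial>M)" using P.integrable_snd[OF int] .
  show "(\<integral>\<omega>. (\<integral>u. f \<omega> u \<partial>lborel) \<partial>M) = (\<integral>u. (\<integral>\<omega>. f \<omega> u \<partial>M) \<partial>lborel)"
    using P.Fubini_integral[OF int] by simp
qed

section \<open>Hermite functions as Fourier integrals\<close>

lemma normal_fourier:
  assumes s: "\<sigma> > 0"
  shows "(\<integral>w. normal_density 0 \<sigma> w *\<^sub>R cis (w * y) \<partial>lborel) = of_real (exp (- (\<sigma>\<^sup>2 * y\<^sup>2 / 2)))"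
proof -
  have "(\<integral>w. normal_density 0 \<sigma> w *\<^sub>R cis (w * y) \<partial>lborel)
     = \<bar>\<sigma>\<bar> *\<^sub>R (\<integral>w. normal_density 0 \<sigma> (0 + \<sigma> * w) *\<^sub>R cis ((0 + \<sigma> * w) * y) \<partial>lborel)"
    by (rule lborel_integral_real_affine) (use s in simp)
  also have "\<dots> = (\<integral>w. \<sigma> *\<^sub>R (normal_density 0 \<sigma> (0 + \<sigma> * w) *\<^sub>R cis ((0 + \<sigma> * w) * y)) \<partial>lborel)"
    unfolding Bochner_Integration.integral_scaleR_right using s by simp
  also have "\<dots> = (\<integral>w. std_normal_density w *\<^sub>R iexp ((\<sigma> * y) * w) \<partial>lborel)"
  proof (rule Bochner_Integration.integral_cong[OF refl])
    fix w
    have "\<sigma> * normal_density 0 \<sigma> (0 + \<sigma> * w) = std_normal_density w"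
      using s unfolding normal_density_def by (simp add: real_sqrt_mult power_mult_distrib)
    then show "\<sigma> *\<^sub>R (normal_density 0 \<sigma> (0 + \<sigma> * w) *\<^sub>R cis ((0 + \<sigma> * w) * y)) = std_normal_density w *\<^sub>R iexp ((\<sigma> * y) * w)"
      by (simp add: cis_conv_exp mult_ac)
  qed
  also have "\<dots> = char std_normal_distribution (\<sigma> * y)"
    unfolding char_def by (subst integral_density) auto
  also have "\<dots> = of_real (exp (- (\<sigma>\<^sup>2 * y\<^sup>2 / 2)))"
    by (simp add: char_std_normal_distribution power_mult_distrib)
  finally show ?thesis .
qed

text \<open>The Hermite polynomials for the weight \<open>exp (- pi * x ^ 2)\<close>: the
  physicists' \<open>H m (sqrt pi * x)\<close> times \<open>sqrt pi ^ m\<close>. Their product with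
  the weight is the \<open>m\<close>-th power of \<open>- d/dx\<close> applied to it, that is, the
  Fourier integral with an additional factor \<open>(\<i> * w) ^ m\<close>.\<close>

fun herm :: "nat \<Rightarrow> real poly" where
  "herm 0 = 1"
| "herm (Suc 0) = [:0, 2 * pi:]"
| "herm (Suc (Suc m)) = smult (2 * pi) (pCons 0 (herm (Suc m)) - smult (real (Suc m)) (herm m))"

lemma degree_herm: "degree (herm m) \<le> m"
proof (induction m rule: herm.induct)
  case (3 m)
  have "degree (pCons 0 (herm (Suc m))) \<le> Suc (Suc m)" using 3 by (simp add: degree_pCons_le order_trans[OF degree_pCons_le])
  moreover have "degree (smult (real (Suc m)) (herm m)) \<le> Suc (Suc m)"
    using 3 order_trans[OF degree_smult_le, of "herm m" "Suc (Suc m)"] by simp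
  ultimately have "degree (pCons 0 (herm (Suc m)) - smult (real (Suc m)) (herm m)) \<le> Suc (Suc m)"
    by (rule degree_diff_le)
  then show ?case unfolding herm.simps by (rule order_trans[OF degree_smult_le])
qed auto

text \<open>The normal density with this standard deviation is \<open>exp (- w\<^sup>2 / (4 * pi)) / (2 * pi)\<close>.\<close>

abbreviation gauss :: "real \<Rightarrow> real" where
  "gauss \<equiv> normal_density 0 (sqrt (2 * pi))"

lemma gauss_eq: "gauss w = exp (- (w\<^sup>2 / (4 * pi))) / (2 * pi)"
proof -
  have "sqrt (2 * pi * (sqrt (2 * pi))\<^sup>2) = sqrt (2 * pi) * sqrt (2 * pi)"
    by (simp only: real_sqrt_mult[symmetric]) simp
  then have "sqrt (2 * pi * (sqrt (2 * pi))\<^sup>2) = 2 * pi" by simp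
  then show ?thesis unfolding normal_density_def by simp
qed

definition gauss_term :: "nat \<Rightarrow> real \<Rightarrow> real \<Rightarrow> complex" where
  "gauss_term m x w = gauss w *\<^sub>R ((\<i> * of_real w) ^ m * cis (- (w * x)))"

lemma integrable_gauss_term: "integrable lborel (gauss_term m x)"
proof (rule Bochner_Integration.integrable_bound)
  show "integrable lborel (\<lambda>w. gauss w * \<bar>w - 0\<bar> ^ m)" by (rule integrable_normal_moment_abs) simp
  show "gauss_term m x \<in> borel_measurable lborel" unfolding gauss_term_def[abs_def] by measurable
  show "AE w in lborel. norm (gauss_term m x w) \<le> norm (gauss w * \<bar>w - 0\<bar> ^ m)"
    by (auto simp: gauss_term_def norm_mult norm_power)
qed

text \<open>The boundary terms for the integration by parts below. Nonnegativity of
  \<open>(|w| - 2 * pi) ^ 2\<close> gives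
  \<open>exp (- w ^ 2 / (4 * pi)) \<le> exp (pi - |w|)\<close>, so exponential decay beats the
  power.\<close>

lemma gauss_power_tendsto_0:
  "((\<lambda>w. gauss w * \<bar>w\<bar> ^ m) \<longlongrightarrow> 0) at_top" "((\<lambda>w. gauss w * \<bar>w\<bar> ^ m) \<longlongrightarrow> 0) at_bot"
proof -
  have lim: "((\<lambda>w::real. exp pi / (2 * pi) * (w ^ m / exp w)) \<longlongrightarrow> 0) at_top"
    using tendsto_mult_right_zero[OF tendsto_power_div_exp_0] .
  have bd: "norm (gauss w * \<bar>w\<bar> ^ m) \<le> exp pi / (2 * pi) * (\<bar>w\<bar> ^ m / exp \<bar>w\<bar>)" for w
  proof -
    have "0 \<le> (\<bar>w\<bar> - 2 * pi)\<^sup>2 / (4 * pi)" by simp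
    also have "(\<bar>w\<bar> - 2 * pi)\<^sup>2 / (4 * pi) = w\<^sup>2 / (4 * pi) - \<bar>w\<bar> + pi"
      by (simp add: power2_eq_square field_simps)
    finally have "exp (- (w\<^sup>2 / (4 * pi))) \<le> exp (pi - \<bar>w\<bar>)" by simp
    then have "gauss w * \<bar>w\<bar> ^ m \<le> exp (pi - \<bar>w\<bar>) / (2 * pi) * \<bar>w\<bar> ^ m"
      unfolding gauss_eq by (intro mult_right_mono divide_right_mono) auto
    then show ?thesis by (simp add: exp_diff mult_ac)
  qed
  have "\<forall>\<^sub>F w in at_top. exp pi / (2 * pi) * (w ^ m / exp w) = exp pi / (2 * pi) * (\<bar>w\<bar> ^ m / exp \<bar>w\<bar>)"
    using eventually_ge_at_top[of "0::real"] by eventually_elim simp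
  then have lim': "((\<lambda>w::real. exp pi / (2 * pi) * (\<bar>w\<bar> ^ m / exp \<bar>w\<bar>)) \<longlongrightarrow> 0) at_top"
    using lim by (rule Lim_transform_eventually[rotated])
  show 1: "((\<lambda>w. gauss w * \<bar>w\<bar> ^ m) \<longlongrightarrow> 0) at_top"
    by (rule Lim_null_comparison[OF _ lim']) (use bd in simp)
  have "((\<lambda>w. gauss (- w) * \<bar>- w\<bar> ^ m) \<longlongrightarrow> 0) at_top" using 1 by (simp add: gauss_eq)
  then show "((\<lambda>w. gauss w * \<bar>w\<bar> ^ m) \<longlongrightarrow> 0) at_bot"
    by (simp add: at_bot_mirror filterlim_filtermap)
qed

lemma gauss_has_derivative:
  "(gauss has_vector_derivative gauss w * (- w / (2 * pi))) (at w)"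
proof -
  have "((\<lambda>w. exp (- (w\<^sup>2 / (4 * pi))) / (2 * pi)) has_real_derivative gauss w * (- w / (2 * pi))) (at w)"
    unfolding gauss_eq by (auto intro!: derivative_eq_intros simp: field_simps)
  then show ?thesis unfolding gauss_eq[abs_def] by (simp add: has_real_derivative_iff_has_vector_derivative)
qed

definition gauss_int :: "nat \<Rightarrow> real \<Rightarrow> complex" where
  "gauss_int m x = integral\<^sup>L lborel (gauss_term m x)"

lemma cis_vector_derivative:
  "((\<lambda>w. cis (- (w * x))) has_vector_derivative (- \<i> * of_real x * cis (- (w * x)))) (at w)"
  unfolding has_vector_derivative_def
  by (auto intro!: derivative_eq_intros simp: scaleR_conv_of_real algebra_simps)

text \<open>The derivative of \<open>gauss_term m x\<close> integrates to 0 over the line. Its three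
  summands, from the Gaussian, from the power and from the exponential, are multiples of
  \<open>gauss_term\<close> of index \<open>m + 1\<close>, \<open>m - 1\<close> and
  \<open>m\<close>. For \<open>m = 0\<close> the truncated index is harmless because of its
  coefficient 0.\<close>

lemma gauss_int_rec:
  "gauss_int (Suc m) x = 2 * of_real pi * (of_real x * gauss_int m x - of_nat m * gauss_int (m - 1) x)"
proof -
  define f where "f w = (\<i> / (2 * of_real pi)) * gauss_term (Suc m) x w + \<i> * of_nat m * gauss_term (m - 1) x w
     - \<i> * of_real x * gauss_term m x w" for w
  have ib: "integrable lborel f" unfolding f_def by (simp add: integrable_gauss_term)
  have deriv: "(gauss_term m x has_vector_derivative f w) (at w)" for w
  proof -
    have p: "((\<lambda>w. (\<i> * of_real w) ^ m) has_vector_derivative (of_nat m * (\<i> * of_real w) ^ (m - 1) * \<i>)) (at w)"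
    proof -
      have "((\<lambda>z. (\<i> * z) ^ m) has_field_derivative (of_nat m * (\<i> * of_real w) ^ (m - 1) * \<i>)) (at (of_real w))"
        by (auto intro!: derivative_eq_intros)
      then show ?thesis by (rule has_vector_derivative_real_field)
    qed
    have "(gauss_term m x has_vector_derivative
        gauss w *\<^sub>R ((\<i> * of_real w) ^ m * (- \<i> * of_real x * cis (- (w * x))) + (of_nat m * (\<i> * of_real w) ^ (m - 1) * \<i>) * cis (- (w * x)))
        + (gauss w * (- w / (2 * pi))) *\<^sub>R ((\<i> * of_real w) ^ m * cis (- (w * x)))) (at w)"
      unfolding gauss_term_def[abs_def]
      by (rule has_vector_derivative_scaleR[OF gauss_has_derivative[unfolded has_real_derivative_iff_has_vector_derivative[symmetric]] has_vector_derivative_mult[OF p cis_vector_derivative]])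
    moreover have "gauss w *\<^sub>R ((\<i> * of_real w) ^ m * (- \<i> * of_real x * cis (- (w * x))) + (of_nat m * (\<i> * of_real w) ^ (m - 1) * \<i>) * cis (- (w * x)))
        + (gauss w * (- w / (2 * pi))) *\<^sub>R ((\<i> * of_real w) ^ m * cis (- (w * x))) = f w"
      unfolding f_def gauss_term_def by (simp add: scaleR_conv_of_real field_simps)
    ultimately show ?thesis by simp
  qed
  have cont: "isCont f w" for w
  proof -
    have "isCont (gauss_term k x) w" for k
    proof -
      have "isCont gauss w" using gauss_has_derivative has_vector_derivative_continuous by blast
      moreover have "isCont (\<lambda>w. cis (- (w * x))) w"
        using cis_vector_derivative has_vector_derivative_continuous by blast
      ultimately show ?thesis unfolding gauss_term_def[abs_def]
        by (intro isCont_scaleR isCont_mult isCont_power isCont_of_real continuous_ident continuous_const)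
    qed
    then show ?thesis unfolding f_def by (intro continuous_intros)
  qed
  have n: "norm (gauss_term m x w) = gauss w * \<bar>w\<bar> ^ m" for w
    by (simp add: gauss_term_def norm_mult norm_power)
  have ei: "einterval (-\<infinity>) \<infinity> = (UNIV :: real set)" by (auto simp: einterval_def)
  have "(LBINT w=-\<infinity>..\<infinity>. f w) = 0 - 0"
  proof (rule interval_integral_FTC_integrable)
    show "set_integrable lborel (einterval (-\<infinity>) \<infinity>) f" using ib by (simp add: ei set_integrable_def)
    show "((gauss_term m x \<circ> real_of_ereal) \<longlongrightarrow> 0) (at_right (-\<infinity>))" "((gauss_term m x \<circ> real_of_ereal) \<longlongrightarrow> 0) (at_left \<infinity>)"
      unfolding ereal_tendsto_simps1
      by (rule tendsto_norm_zero_cancel, unfold n, rule gauss_power_tendsto_0)+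
  qed (use deriv cont in auto)
  then have "integral\<^sup>L lborel f = 0"
    by (simp add: interval_lebesgue_integral_def ei set_lebesgue_integral_def)
  moreover have "integral\<^sup>L lborel f = (\<i> / (2 * of_real pi)) * gauss_int (Suc m) x + \<i> * of_nat m * gauss_int (m - 1) x
     - \<i> * of_real x * gauss_int m x"
    unfolding f_def gauss_int_def using integrable_gauss_term by simp
  ultimately have "\<i> * (gauss_int (Suc m) x - 2 * of_real pi * (of_real x * gauss_int m x - of_nat m * gauss_int (m - 1) x)) = 0"
    by (simp add: field_simps)
  then show ?thesis by simp
qed

lemma gauss_int_eq: "gauss_int m x = of_real (poly (herm m) x * exp (- (pi * x\<^sup>2)))"
proof -
  have g0: "gauss_int 0 x = of_real (exp (- (pi * x\<^sup>2)))"
    using normal_fourier[of "sqrt (2 * pi)" "- x"] by (simp add: gauss_int_def gauss_term_def[abs_def])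
  show ?thesis
  proof (induction m rule: herm.induct)
    case 1
    show ?case by (simp add: g0)
  next
    case 2
    show ?case using gauss_int_rec[of 0 x] by (simp add: g0)
  next
    case (3 m)
    have "gauss_int (Suc (Suc m)) x = 2 * of_real pi * (of_real x * gauss_int (Suc m) x - of_nat (Suc m) * gauss_int m x)"
      using gauss_int_rec[of "Suc m" x] by simp
    also have "\<dots> = of_real (poly (herm (Suc (Suc m))) x * exp (- (pi * x\<^sup>2)))"
      unfolding 3 by (simp add: algebra_simps)
    finally show ?case .
  qed
qed

section \<open>Gaussian smoothing and Fourier inversion in the plane\<close>

lemma integrable_inverse_1_plus_sq: "integrable lborel (\<lambda>x::real. inverse (1 + x\<^sup>2))"
proof -
  have ei: "einterval (-\<infinity>) \<infinity> = (UNIV :: real set)" by (auto simp: einterval_def)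
  show ?thesis using integrable_inverse_1_plus_square by (simp add: ei set_integrable_def)
qed

lemma integral_inverse_1_plus_sq: "integral\<^sup>L lborel (\<lambda>x::real. inverse (1 + x\<^sup>2)) = pi"
proof -
  have ei: "einterval (-\<infinity>) \<infinity> = (UNIV :: real set)" by (auto simp: einterval_def)
  show ?thesis using LBINT_inverse_1_plus_square
    by (simp add: ei interval_lebesgue_integral_def set_lebesgue_integral_def)
qed

text \<open>Since \<open>exp (- \<epsilon>\<^sup>2 * u\<^sup>2 / 2)\<close> is integrable, the density of a Gaussian smoothing is given by
  absolutely convergent Fourier inversion.\<close>

definition damp :: "real \<Rightarrow> real \<Rightarrow> real" where
  "damp \<epsilon> u = exp (- (\<epsilon>\<^sup>2 * u\<^sup>2 / 2))"

lemma damp_normal: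
  assumes "\<epsilon> > 0"
  shows "damp \<epsilon> u = sqrt (2 * pi) / \<epsilon> * normal_density 0 (1 / \<epsilon>) u"
proof -
  have "sqrt (2 * pi * (1 / \<epsilon>)\<^sup>2) = sqrt (2 * pi) / \<epsilon>"
    using assms by (simp add: real_sqrt_mult)
  moreover have "(u - 0)\<^sup>2 / (2 * (1 / \<epsilon>)\<^sup>2) = \<epsilon>\<^sup>2 * u\<^sup>2 / 2" using assms by (simp add: power_divide)
  ultimately show ?thesis unfolding damp_def normal_density_def using assms by simp
qed

lemma damp_measurable [measurable]: "damp \<epsilon> \<in> borel_measurable borel"
  unfolding damp_def[abs_def] by measurable

lemma integrable_damp:
  assumes "\<epsilon> > 0"
  shows "integrable lborel (damp \<epsilon>)"
  unfolding damp_normal[OF assms, abs_def] using assms by (intro integrable_mult_right integrable_normal_density) auto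

lemma normal_inversion:
  assumes e: "\<epsilon> > 0"
  shows "of_real (2 * pi * normal_density 0 \<epsilon> (x - y)) = (\<integral>u. damp \<epsilon> u *\<^sub>R cis (u * (y - x)) \<partial>lborel)"
proof -
  have "(\<integral>u. damp \<epsilon> u *\<^sub>R cis (u * (y - x)) \<partial>lborel) = (\<integral>u. (sqrt (2 * pi) / \<epsilon>) *\<^sub>R (normal_density 0 (1 / \<epsilon>) u *\<^sub>R cis (u * (y - x))) \<partial>lborel)"
    unfolding damp_normal[OF e] by simp
  also have "\<dots> = (sqrt (2 * pi) / \<epsilon>) *\<^sub>R (\<integral>u. normal_density 0 (1 / \<epsilon>) u *\<^sub>R cis (u * (y - x)) \<partial>lborel)"
    by (rule Bochner_Integration.integral_scaleR_right)
  also have "(\<integral>u. normal_density 0 (1 / \<epsilon>) u *\<^sub>R cis (u * (y - x)) \<partial>lborel) = of_real (exp (- ((1 / \<epsilon>)\<^sup>2 * (y - x)\<^sup>2 / 2)))"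
    using e by (intro normal_fourier) auto
  also have "(sqrt (2 * pi) / \<epsilon>) *\<^sub>R complex_of_real (exp (- ((1 / \<epsilon>)\<^sup>2 * (y - x)\<^sup>2 / 2)))
     = of_real ((sqrt (2 * pi) / \<epsilon>) * exp (- ((1 / \<epsilon>)\<^sup>2 * (y - x)\<^sup>2 / 2)))" by (simp add: scaleR_conv_of_real)
  also have "(sqrt (2 * pi) / \<epsilon>) * exp (- ((1 / \<epsilon>)\<^sup>2 * (y - x)\<^sup>2 / 2)) = 2 * pi * normal_density 0 \<epsilon> (x - y)"
  proof -
    have "2 * pi = sqrt (2 * pi) * sqrt (2 * pi)" by simp
    then have "2 * pi / sqrt (2 * pi * \<epsilon>\<^sup>2) = sqrt (2 * pi) / \<epsilon>"
      using e by (simp add: real_sqrt_mult field_simps)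
    moreover have "(1 / \<epsilon>)\<^sup>2 * (y - x)\<^sup>2 / 2 = (x - y)\<^sup>2 / (2 * \<epsilon>\<^sup>2)" by (simp add: power2_commute power_divide)
    ultimately have "(sqrt (2 * pi) / \<epsilon>) * exp (- ((1 / \<epsilon>)\<^sup>2 * (y - x)\<^sup>2 / 2)) = 2 * pi / sqrt (2 * pi * \<epsilon>\<^sup>2) * exp (- ((x - y)\<^sup>2 / (2 * \<epsilon>\<^sup>2)))"
      by (simp only:)
    then show ?thesis unfolding normal_density_def by simp
  qed
  finally show ?thesis by simp
qed

context prob_space
begin

definition charf :: "('a \<Rightarrow> complex) \<Rightarrow> real \<Rightarrow> real \<Rightarrow> complex" where
  "charf Z u v = (\<integral>\<omega>. cis (u * Re (Z \<omega>) + v * Im (Z \<omega>)) \<partial>M)"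

text \<open>The density of \<open>Z\<close> plus independent planar Gaussian noise of standard
  deviation \<epsilon> in each coordinate, written as an expectation so that no enlarged probability
  space is needed.\<close>

definition smooth_density :: "real \<Rightarrow> ('a \<Rightarrow> complex) \<Rightarrow> real \<Rightarrow> real \<Rightarrow> real" where
  "smooth_density \<epsilon> Z x y = (\<integral>\<omega>. normal_density 0 \<epsilon> (x - Re (Z \<omega>)) * normal_density 0 \<epsilon> (y - Im (Z \<omega>)) \<partial>M)"

lemma norm_charf_le_1: "norm (charf Z u v) \<le> 1"
proof -
  have "norm (charf Z u v) \<le> (\<integral>\<omega>. norm (cis (u * Re (Z \<omega>) + v * Im (Z \<omega>))) \<partial>M)"
    unfolding charf_def by (rule integral_norm_bound)
  then show ?thesis using prob_space by simp
qed

lemma charf_measurable [measurable]: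
  assumes [measurable]: "Z \<in> borel_measurable M"
  shows "(\<lambda>(u, v). charf Z u v) \<in> borel_measurable (lborel \<Otimes>\<^sub>M lborel)"
  unfolding charf_def split_beta by measurable

lemma normal_density_le:
  assumes "\<epsilon> > 0"
  shows "normal_density \<mu> \<epsilon> x \<le> 1 / sqrt (2 * pi * \<epsilon>\<^sup>2)"
  unfolding normal_density_def by (intro mult_left_le) auto

text \<open>Each normal density is replaced by its own Fourier integral, one coordinate after the
  other, and the expectation is moved inside; \<open>damp\<close> dominates both exchanges, whatever
  the distribution of \<open>Z\<close>.\<close>

lemma smooth_density_inversion:
  assumes [measurable]: "Z \<in> borel_measurable M" and e: "\<epsilon> > 0"
  shows "of_real (4 * pi\<^sup>2 * smooth_density \<epsilon> Z x y) =
    (\<integral>v. (\<integral>u. of_real (damp \<epsilon> u * damp \<epsilon> v) * (cis (- (u * x + v * y)) * charf Z u v) \<partial>lborel) \<partial>lborel)"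
proof -
  define A where "A = 2 * pi * (1 / sqrt (2 * pi * \<epsilon>\<^sup>2))"
  define a where "a \<omega> = complex_of_real (2 * pi * normal_density 0 \<epsilon> (x - Re (Z \<omega>)))" for \<omega>
  have [measurable]: "a \<in> borel_measurable M" unfolding a_def by measurable
  have aA: "norm (a \<omega>) \<le> A" for \<omega>
    unfolding a_def A_def norm_of_real using normal_density_le[OF e, of 0 "x - Re (Z \<omega>)"]
    by (simp add: abs_mult mult_left_mono del: times_divide_eq_right)
  have "complex_of_real (4 * pi\<^sup>2 * smooth_density \<epsilon> Z x y)
     = (\<integral>\<omega>. complex_of_real (4 * pi\<^sup>2 * (normal_density 0 \<epsilon> (x - Re (Z \<omega>)) * normal_density 0 \<epsilon> (y - Im (Z \<omega>)))) \<partial>M)"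
    unfolding smooth_density_def by (subst integral_complex_of_real) simp_all
  also have "\<dots> = (\<integral>\<omega>. (\<integral>v. (damp \<epsilon> v *\<^sub>R cis (v * (Im (Z \<omega>) - y))) * a \<omega> \<partial>lborel) \<partial>M)"
  proof (rule Bochner_Integration.integral_cong[OF refl])
    fix \<omega>
    have "(\<integral>v. (damp \<epsilon> v *\<^sub>R cis (v * (Im (Z \<omega>) - y))) * a \<omega> \<partial>lborel)
       = of_real (2 * pi * normal_density 0 \<epsilon> (y - Im (Z \<omega>))) * a \<omega>"
      unfolding normal_inversion[OF e] by (rule integral_mult_left_zero)
    then show "of_real (4 * pi\<^sup>2 * (normal_density 0 \<epsilon> (x - Re (Z \<omega>)) * normal_density 0 \<epsilon> (y - Im (Z \<omega>))))
       = (\<integral>v. (damp \<epsilon> v *\<^sub>R cis (v * (Im (Z \<omega>) - y))) * a \<omega> \<partial>lborel)"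
      by (simp add: a_def power2_eq_square)
  qed
  also have "\<dots> = (\<integral>v. (\<integral>\<omega>. (damp \<epsilon> v *\<^sub>R cis (v * (Im (Z \<omega>) - y))) * a \<omega> \<partial>M) \<partial>lborel)"
  proof (rule swap_expectation(2)[where g = "\<lambda>v. damp \<epsilon> v * A"])
    show "integrable lborel (\<lambda>v. damp \<epsilon> v * A)" using integrable_damp[OF e] by simp
    show "norm ((damp \<epsilon> v *\<^sub>R cis (v * (Im (Z \<omega>) - y))) * a \<omega>) \<le> damp \<epsilon> v * A" for \<omega> v
      unfolding norm_mult using aA[of \<omega>] by (simp add: damp_def mult_left_mono)
  qed measurable
  also have "\<dots> = (\<integral>v. (\<integral>u. of_real (damp \<epsilon> u * damp \<epsilon> v) * (cis (- (u * x + v * y)) * charf Z u v) \<partial>lborel) \<partial>lborel)"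
  proof (rule Bochner_Integration.integral_cong[OF refl])
    fix v
    have "(\<integral>\<omega>. (damp \<epsilon> v *\<^sub>R cis (v * (Im (Z \<omega>) - y))) * a \<omega> \<partial>M)
      = (\<integral>\<omega>. (\<integral>u. (damp \<epsilon> v *\<^sub>R cis (v * (Im (Z \<omega>) - y))) * (damp \<epsilon> u *\<^sub>R cis (u * (Re (Z \<omega>) - x))) \<partial>lborel) \<partial>M)"
    proof (rule Bochner_Integration.integral_cong[OF refl])
      fix \<omega>
      show "(damp \<epsilon> v *\<^sub>R cis (v * (Im (Z \<omega>) - y))) * a \<omega> = (\<integral>u. (damp \<epsilon> v *\<^sub>R cis (v * (Im (Z \<omega>) - y))) * (damp \<epsilon> u *\<^sub>R cis (u * (Re (Z \<omega>) - x))) \<partial>lborel)"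
        unfolding a_def normal_inversion[OF e] by (rule integral_mult_right_zero[symmetric])
    qed
    also have "\<dots> = (\<integral>u. (\<integral>\<omega>. (damp \<epsilon> v *\<^sub>R cis (v * (Im (Z \<omega>) - y))) * (damp \<epsilon> u *\<^sub>R cis (u * (Re (Z \<omega>) - x))) \<partial>M) \<partial>lborel)"
    proof (rule swap_expectation(2)[where g = "\<lambda>u. damp \<epsilon> u * damp \<epsilon> v"])
      show "integrable lborel (\<lambda>u. damp \<epsilon> u * damp \<epsilon> v)" using integrable_damp[OF e] by simp
      show "norm ((damp \<epsilon> v *\<^sub>R cis (v * (Im (Z \<omega>) - y))) * (damp \<epsilon> u *\<^sub>R cis (u * (Re (Z \<omega>) - x)))) \<le> damp \<epsilon> u * damp \<epsilon> v" for \<omega> u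
        unfolding norm_mult by (simp add: damp_def)
    qed measurable
    also have "\<dots> = (\<integral>u. of_real (damp \<epsilon> u * damp \<epsilon> v) * (cis (- (u * x + v * y)) * charf Z u v) \<partial>lborel)"
    proof (rule Bochner_Integration.integral_cong[OF refl])
      fix u
      have "(\<integral>\<omega>. (damp \<epsilon> v *\<^sub>R cis (v * (Im (Z \<omega>) - y))) * (damp \<epsilon> u *\<^sub>R cis (u * (Re (Z \<omega>) - x))) \<partial>M)
        = (\<integral>\<omega>. (of_real (damp \<epsilon> u * damp \<epsilon> v) * cis (- (u * x + v * y))) * cis (u * Re (Z \<omega>) + v * Im (Z \<omega>)) \<partial>M)"
        by (intro Bochner_Integration.integral_cong refl) (simp add: scaleR_conv_of_real cis_mult algebra_simps)
      also have "\<dots> = (of_real (damp \<epsilon> u * damp \<epsilon> v) * cis (- (u * x + v * y))) * charf Z u v"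
        unfolding charf_def by (rule integral_mult_right_zero)
      finally show "(\<integral>\<omega>. (damp \<epsilon> v *\<^sub>R cis (v * (Im (Z \<omega>) - y))) * (damp \<epsilon> u *\<^sub>R cis (u * (Re (Z \<omega>) - x))) \<partial>M)
        = of_real (damp \<epsilon> u * damp \<epsilon> v) * (cis (- (u * x + v * y)) * charf Z u v)" by (simp add: mult.assoc)
    qed
    finally show "(\<integral>\<omega>. (damp \<epsilon> v *\<^sub>R cis (v * (Im (Z \<omega>) - y))) * a \<omega> \<partial>M)
      = (\<integral>u. of_real (damp \<epsilon> u * damp \<epsilon> v) * (cis (- (u * x + v * y)) * charf Z u v) \<partial>lborel)" .
  qed
  finally show ?thesis .
qed

text \<open>Closeness of integrands implies closeness of densities, uniformly in the plane. The
  product weight on the right is integrable with total mass \<open>pi ^ 2\<close>, which the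
  inversion constant \<open>4 * pi ^ 2\<close> more than compensates.\<close>

lemma smooth_density_approx:
  assumes [measurable]: "Z \<in> borel_measurable M" and e: "\<epsilon> > 0"
    and q: "of_real (4 * pi\<^sup>2 * q) = (\<integral>v. (\<integral>u. Q u v \<partial>lborel) \<partial>lborel)"
    and Q1: "\<And>v. integrable lborel (\<lambda>u. Q u v)" and Q2: "integrable lborel (\<lambda>v. \<integral>u. Q u v \<partial>lborel)"
    and B: "\<And>u v. norm (of_real (damp \<epsilon> u * damp \<epsilon> v) * (cis (- (u * x + v * y)) * charf Z u v) - Q u v)
        \<le> B * (inverse (1 + u\<^sup>2) * inverse (1 + v\<^sup>2))"
  shows "\<bar>smooth_density \<epsilon> Z x y - q\<bar> \<le> B"
proof -
  define P where "P u v = of_real (damp \<epsilon> u * damp \<epsilon> v) * (cis (- (u * x + v * y)) * charf Z u v)" for u v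
  have [measurable]: "(\<lambda>(u, v). P u v) \<in> borel_measurable (lborel \<Otimes>\<^sub>M lborel)"
    using charf_measurable[of Z] unfolding P_def split_beta by measurable
  have Pb: "norm (P u v) \<le> damp \<epsilon> u * damp \<epsilon> v" for u v
  proof -
    have "norm (P u v) = (damp \<epsilon> u * damp \<epsilon> v) * norm (charf Z u v)" by (simp add: P_def norm_mult damp_def)
    also have "\<dots> \<le> (damp \<epsilon> u * damp \<epsilon> v) * 1" by (intro mult_left_mono norm_charf_le_1) (simp add: damp_def)
    finally show ?thesis by simp
  qed
  have d0: "damp \<epsilon> u \<ge> 0" for u by (simp add: damp_def)
  have P1: "integrable lborel (\<lambda>u. P u v)" for v
  proof (rule Bochner_Integration.integrable_bound)
    show "integrable lborel (\<lambda>u. damp \<epsilon> u * damp \<epsilon> v)" using integrable_damp[OF e] by simp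
  qed (use Pb d0 in \<open>auto\<close>)
  have P2: "integrable lborel (\<lambda>v. \<integral>u. P u v \<partial>lborel)"
  proof (rule Bochner_Integration.integrable_bound)
    show "integrable lborel (\<lambda>v. (\<integral>u. damp \<epsilon> u \<partial>lborel) * damp \<epsilon> v)" using integrable_damp[OF e] by simp
    show "AE v in lborel. norm (\<integral>u. P u v \<partial>lborel) \<le> norm ((\<integral>u. damp \<epsilon> u \<partial>lborel) * damp \<epsilon> v)"
    proof (rule AE_I2)
      fix v
      have "norm (\<integral>u. P u v \<partial>lborel) \<le> (\<integral>u. damp \<epsilon> u * damp \<epsilon> v \<partial>lborel)"
        by (rule Bochner_Integration.integral_norm_bound_integral[OF P1]) (use integrable_damp[OF e] Pb in auto)
      then show "norm (\<integral>u. P u v \<partial>lborel) \<le> norm ((\<integral>u. damp \<epsilon> u \<partial>lborel) * damp \<epsilon> v)"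
        by simp
    qed
  qed simp
  have inner: "norm ((\<integral>u. P u v \<partial>lborel) - (\<integral>u. Q u v \<partial>lborel)) \<le> B * pi * inverse (1 + v\<^sup>2)" for v
  proof -
    have "(\<integral>u. P u v \<partial>lborel) - (\<integral>u. Q u v \<partial>lborel) = (\<integral>u. P u v - Q u v \<partial>lborel)"
      using P1 Q1 by simp
    also have "norm \<dots> \<le> (\<integral>u. B * inverse (1 + v\<^sup>2) * inverse (1 + u\<^sup>2) \<partial>lborel)"
    proof (rule Bochner_Integration.integral_norm_bound_integral)
      show "integrable lborel (\<lambda>u. B * inverse (1 + v\<^sup>2) * inverse (1 + u\<^sup>2))"
        using integrable_inverse_1_plus_sq by simp
      show "norm (P u v - Q u v) \<le> B * inverse (1 + v\<^sup>2) * inverse (1 + u\<^sup>2)" for u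
        using B[of u v] unfolding P_def by (simp add: mult_ac)
    qed (use P1 Q1 in auto)
    also have "\<dots> = B * inverse (1 + v\<^sup>2) * pi" by (simp add: integral_inverse_1_plus_sq del: inverse_eq_divide)
    finally show ?thesis by (simp add: mult_ac)
  qed
  have "of_real (4 * pi\<^sup>2 * smooth_density \<epsilon> Z x y) - of_real (4 * pi\<^sup>2 * q)
     = (\<integral>v. (\<integral>u. P u v \<partial>lborel) - (\<integral>u. Q u v \<partial>lborel) \<partial>lborel)"
    unfolding q smooth_density_inversion[OF assms(1) e] P_def[symmetric] using P2 Q2 by simp
  also have "norm \<dots> \<le> (\<integral>v. B * pi * inverse (1 + v\<^sup>2) \<partial>lborel)"
    by (rule Bochner_Integration.integral_norm_bound_integral) (use P2 Q2 inner integrable_inverse_1_plus_sq in auto)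
  also have "\<dots> = B * pi * pi" by (simp add: integral_inverse_1_plus_sq del: inverse_eq_divide)
  also have "\<dots> = B * pi\<^sup>2" by (simp add: power2_eq_square)
  finally have "norm (complex_of_real (4 * pi\<^sup>2 * (smooth_density \<epsilon> Z x y - q))) \<le> B * pi\<^sup>2"
    by (simp add: algebra_simps)
  then have "pi\<^sup>2 * (4 * \<bar>smooth_density \<epsilon> Z x y - q\<bar>) \<le> pi\<^sup>2 * B"
    unfolding norm_of_real by (simp add: abs_mult mult_ac)
  then have "4 * \<bar>smooth_density \<epsilon> Z x y - q\<bar> \<le> B" by (simp del: mult_le_cancel_left_pos add: mult_le_cancel_left_pos)
  moreover have "1 * \<bar>smooth_density \<epsilon> Z x y - q\<bar> \<le> 4 * \<bar>smooth_density \<epsilon> Z x y - q\<bar>"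
    by (rule mult_right_mono) auto
  ultimately show ?thesis using order_trans by (simp only: mult_1_left)
qed

end

section \<open>From smoothed densities to rectangle probabilities\<close>

lemma normal_tail_le:
  assumes e: "\<epsilon> > 0" and d: "\<delta> > 0" and S: "S \<in> sets borel" and far: "\<And>x. x \<in> S \<Longrightarrow> \<delta> \<le> \<bar>x - s\<bar>"
  shows "(\<integral>x. indicator S x * normal_density s \<epsilon> x \<partial>lborel) \<le> \<epsilon>\<^sup>2 / \<delta>\<^sup>2"
proof -
  have m: "integrable lborel (\<lambda>x. normal_density s \<epsilon> x * (x - s) ^ 2)" using e by (rule integrable_normal_moment)
  have mv: "(\<integral>x. normal_density s \<epsilon> x * (x - s) ^ 2 \<partial>lborel) = \<epsilon>\<^sup>2"
    using integral_normal_moment_even[OF e, of s 1] by (simp add: power2_eq_square numeral_2_eq_2)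
  \<comment> \<open>Chebyshev's inequality: on \<open>S\<close> the factor
    \<open>(x - s) ^ 2 / \<delta> ^ 2\<close> is at least 1, and the second moment is
    \<open>\<epsilon> ^ 2\<close>.\<close>
  have "(\<integral>x. indicator S x * normal_density s \<epsilon> x \<partial>lborel) \<le> (\<integral>x. normal_density s \<epsilon> x * (x - s) ^ 2 / \<delta>\<^sup>2 \<partial>lborel)"
  proof (rule integral_mono)
    show "integrable lborel (\<lambda>x. indicator S x * normal_density s \<epsilon> x)"
      using integrable_real_mult_indicator[of S lborel "normal_density s \<epsilon>"] S integrable_normal_density[OF e] by (simp add: mult.commute)
    show "integrable lborel (\<lambda>x. normal_density s \<epsilon> x * (x - s) ^ 2 / \<delta>\<^sup>2)" using m by simp
    fix x
    show "indicator S x * normal_density s \<epsilon> x \<le> normal_density s \<epsilon> x * (x - s) ^ 2 / \<delta>\<^sup>2"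
    proof (cases "x \<in> S")
      case True
      have "\<delta>\<^sup>2 \<le> (x - s)\<^sup>2" using power_mono[OF far[OF True], of 2] d by simp
      then have "normal_density s \<epsilon> x * \<delta>\<^sup>2 \<le> normal_density s \<epsilon> x * (x - s)\<^sup>2" by (intro mult_left_mono) auto
      then show ?thesis using True d by (simp add: field_simps)
    qed simp
  qed
  also have "\<dots> = \<epsilon>\<^sup>2 / \<delta>\<^sup>2" using mv by simp
  finally show ?thesis .
qed

definition window :: "real \<Rightarrow> real \<Rightarrow> real \<Rightarrow> real \<Rightarrow> real" where
  "window \<epsilon> a b s = (\<integral>x. indicator {a..b} x * normal_density 0 \<epsilon> (x - s) \<partial>lborel)"

lemma normal_density_shift: "normal_density 0 \<epsilon> (x - s) = normal_density s \<epsilon> x"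
  by (simp add: normal_density_def)

lemma integrable_indicator_normal:
  assumes "\<epsilon> > 0" "S \<in> sets borel"
  shows "integrable lborel (\<lambda>x. indicator S x * normal_density s \<epsilon> x)"
  using integrable_real_mult_indicator[of S lborel "normal_density s \<epsilon>"] assms(2) integrable_normal_density[OF assms(1)]
  by (simp add: mult.commute)

lemma window_bounds:
  assumes e: "\<epsilon> > 0"
  shows "0 \<le> window \<epsilon> a b s" "window \<epsilon> a b s \<le> 1"
proof -
  show "0 \<le> window \<epsilon> a b s" unfolding window_def by (intro Bochner_Integration.integral_nonneg) auto
  have "window \<epsilon> a b s \<le> (\<integral>x. normal_density s \<epsilon> x \<partial>lborel)"
    unfolding window_def normal_density_shift
    by (intro integral_mono integrable_indicator_normal e integrable_normal_density) (auto simp: indicator_def)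
  then show "window \<epsilon> a b s \<le> 1" using e by simp
qed

lemma window_inside:
  assumes e: "\<epsilon> > 0" and d: "\<delta> > 0" and s: "a' + \<delta> \<le> s" "s + \<delta> \<le> b'"
  shows "1 - \<epsilon>\<^sup>2 / \<delta>\<^sup>2 \<le> window \<epsilon> a' b' s"
proof -
  have "(\<integral>x. normal_density s \<epsilon> x \<partial>lborel) = (\<integral>x. indicator {a'..b'} x * normal_density s \<epsilon> x + indicator (- {a'..b'}) x * normal_density s \<epsilon> x \<partial>lborel)"
    by (intro Bochner_Integration.integral_cong refl) (auto simp: indicator_def)
  also have "\<dots> = window \<epsilon> a' b' s + (\<integral>x. indicator (- {a'..b'}) x * normal_density s \<epsilon> x \<partial>lborel)"
    unfolding window_def normal_density_shift
    by (intro Bochner_Integration.integral_add integrable_indicator_normal e) auto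
  also have "(\<integral>x. indicator (- {a'..b'}) x * normal_density s \<epsilon> x \<partial>lborel) \<le> \<epsilon>\<^sup>2 / \<delta>\<^sup>2"
    by (rule normal_tail_le[OF e d]) (use s in auto)
  finally show ?thesis using e by simp
qed

lemma window_outside:
  assumes e: "\<epsilon> > 0" and d: "\<delta> > 0" and s: "s < a \<or> b < s" "a + \<delta> \<le> a'" "b' + \<delta> \<le> b"
  shows "window \<epsilon> a' b' s \<le> \<epsilon>\<^sup>2 / \<delta>\<^sup>2"
  unfolding window_def normal_density_shift
  by (rule normal_tail_le[OF e d]) (use s in auto)

lemma window_measurable [measurable]: "window \<epsilon> a b \<in> borel_measurable borel"
  unfolding window_def[abs_def] by measurable

lemma integral_interval_change:
  fixes w :: "real \<Rightarrow> real"
  assumes cont: "continuous_on UNIV w" and K: "\<And>x. \<bar>w x\<bar> \<le> K"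
    and ab: "a \<le> b" "a' \<le> b'" "\<bar>a' - a\<bar> \<le> \<delta>" "\<bar>b' - b\<bar> \<le> \<delta>"
  shows "\<bar>integral {a'..b'} w - integral {a..b} w\<bar> \<le> 2 * \<delta> * K"
proof -
  have K0: "0 \<le> K" using K[of 0] by linarith
  \<comment> \<open>A primitive based to the left of both intervals turns the difference into
    increments at the two endpoints, without distinguishing how the intervals lie to each
    other.\<close>
  define m where "m = min a a'"
  define F where "F t = integral {m..t} w" for t
  have int: "w integrable_on {x..y}" for x y
    by (intro integrable_continuous_interval continuous_on_subset[OF cont]) auto
  have comb: "F x + integral {x..y} w = F y" if "m \<le> x" "x \<le> y" for x y
    unfolding F_def using that int by (intro Henstock_Kurzweil_Integration.integral_combine) auto
  have lip1: "\<bar>F y - F x\<bar> \<le> K * (y - x)" if "m \<le> x" "x \<le> y" for x y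
  proof -
    have "norm (integral {x..y} w) \<le> K * (y - x)"
      by (rule integral_bound) (use that K continuous_on_subset[OF cont] in auto)
    then show ?thesis using comb[OF that] by simp
  qed
  have lip: "\<bar>F y - F x\<bar> \<le> K * \<delta>" if "m \<le> x" "m \<le> y" "\<bar>y - x\<bar> \<le> \<delta>" for x y
  proof -
    have "\<bar>F y - F x\<bar> \<le> K * \<bar>y - x\<bar>"
      using lip1[of x y] lip1[of y x] that by (cases "x \<le> y") auto
    also have "\<dots> \<le> K * \<delta>" using that K0 by (intro mult_left_mono)
    finally show ?thesis .
  qed
  have "integral {a'..b'} w - integral {a..b} w = (F b' - F b) - (F a' - F a)"
    using comb[of a' b'] comb[of a b] ab by (simp add: m_def)
  moreover have "\<bar>F b' - F b\<bar> \<le> K * \<delta>" "\<bar>F a' - F a\<bar> \<le> K * \<delta>"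
    using ab by (auto intro!: lip simp: m_def)
  moreover have "2 * \<delta> * K = K * \<delta> + K * \<delta>" by simp
  ultimately show ?thesis by linarith
qed


context prob_space
begin

text \<open>Fubini moves the noise from the random variable to the test function: integrating the
  smoothed density over the rectangle is the same as averaging the smoothed indicator over
  \<open>Z\<close>.\<close>

lemma expectation_windows:
  assumes [measurable]: "Z \<in> borel_measurable M" and e: "\<epsilon> > 0"
  shows "(\<integral>\<omega>. window \<epsilon> a b (Re (Z \<omega>)) * window \<epsilon> c d (Im (Z \<omega>)) \<partial>M)
    = (LBINT y:{c..d}. (LBINT x:{a..b}. smooth_density \<epsilon> Z x y))"
    "integrable lborel (\<lambda>y. indicator {c..d} y *\<^sub>R (LBINT x:{a..b}. smooth_density \<epsilon> Z x y))"
    "integrable lborel (\<lambda>x. indicator {a..b} x *\<^sub>R smooth_density \<epsilon> Z x y)"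
proof -
  define A where "A = 1 / sqrt (2 * pi * \<epsilon>\<^sup>2)"
  have A: "0 \<le> normal_density 0 \<epsilon> x" "normal_density 0 \<epsilon> x \<le> A" "0 \<le> A" for x
    using normal_density_le[OF e, of 0 x] by (auto simp: A_def)
  have ii: "integrable lborel (\<lambda>x. indicator {a..b} x * K)" for a b K :: real
    using integrable_real_indicator[of "{a..b}" lborel] by (simp add: emeasure_lborel_Icc_eq)
  let ?f = "\<lambda>\<omega> y. (indicator {c..d} y * normal_density 0 \<epsilon> (y - Im (Z \<omega>))) * window \<epsilon> a b (Re (Z \<omega>))"
  let ?g = "\<lambda>y \<omega> x. (indicator {a..b} x * normal_density 0 \<epsilon> (x - Re (Z \<omega>))) * normal_density 0 \<epsilon> (y - Im (Z \<omega>))"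
  have fb: "norm (?f \<omega> y) \<le> indicator {c..d} y * A" for \<omega> y
  proof -
    have "normal_density 0 \<epsilon> (y - Im (Z \<omega>)) * window \<epsilon> a b (Re (Z \<omega>)) \<le> A * 1"
      using A window_bounds[OF e] by (intro mult_mono) auto
    then show ?thesis using window_bounds[OF e, of a b "Re (Z \<omega>)"] by (auto simp: indicator_def abs_mult)
  qed
  have gb: "norm (?g y \<omega> x) \<le> indicator {a..b} x * (A * A)" for \<omega> x y
    using A by (auto simp: indicator_def abs_mult intro!: mult_mono)
  have sw1: "integrable lborel (\<lambda>y. \<integral>\<omega>. ?f \<omega> y \<partial>M)" "(\<integral>\<omega>. (\<integral>y. ?f \<omega> y \<partial>lborel) \<partial>M) = (\<integral>y. (\<integral>\<omega>. ?f \<omega> y \<partial>M) \<partial>lborel)"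
    by (rule swap_expectation[OF _ ii fb], measurable)+
  have sw2: "integrable lborel (\<lambda>x. \<integral>\<omega>. ?g y \<omega> x \<partial>M)" "(\<integral>\<omega>. (\<integral>x. ?g y \<omega> x \<partial>lborel) \<partial>M) = (\<integral>x. (\<integral>\<omega>. ?g y \<omega> x \<partial>M) \<partial>lborel)" for y
    by (rule swap_expectation[OF _ ii gb], measurable)+
  have g1: "(\<integral>\<omega>. ?g y \<omega> x \<partial>M) = indicator {a..b} x *\<^sub>R smooth_density \<epsilon> Z x y" for x y
    unfolding smooth_density_def by (simp add: mult.assoc)
  have f1: "(\<integral>\<omega>. ?f \<omega> y \<partial>M) = indicator {c..d} y *\<^sub>R (LBINT x:{a..b}. smooth_density \<epsilon> Z x y)" for y
  proof -
    have w: "(\<integral>x. ?g y \<omega> x \<partial>lborel) = window \<epsilon> a b (Re (Z \<omega>)) * normal_density 0 \<epsilon> (y - Im (Z \<omega>))" for \<omega>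
      unfolding window_def by (rule integral_mult_left_zero)
    have "(\<integral>\<omega>. window \<epsilon> a b (Re (Z \<omega>)) * normal_density 0 \<epsilon> (y - Im (Z \<omega>)) \<partial>M) = (LBINT x:{a..b}. smooth_density \<epsilon> Z x y)"
      using sw2(2)[of y] unfolding w g1 set_lebesgue_integral_def .
    moreover have "(\<integral>\<omega>. ?f \<omega> y \<partial>M) = indicator {c..d} y * (\<integral>\<omega>. window \<epsilon> a b (Re (Z \<omega>)) * normal_density 0 \<epsilon> (y - Im (Z \<omega>)) \<partial>M)"
      by (simp add: mult.assoc mult.commute[of "normal_density 0 \<epsilon> (y - Im (Z _))"])
    ultimately show ?thesis by simp
  qed
  have f2: "(\<integral>y. ?f \<omega> y \<partial>lborel) = window \<epsilon> a b (Re (Z \<omega>)) * window \<epsilon> c d (Im (Z \<omega>))" for \<omega>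
    unfolding window_def[of \<epsilon> c d] by (subst integral_mult_left_zero) (rule mult.commute)
  show "(\<integral>\<omega>. window \<epsilon> a b (Re (Z \<omega>)) * window \<epsilon> c d (Im (Z \<omega>)) \<partial>M)
    = (LBINT y:{c..d}. (LBINT x:{a..b}. smooth_density \<epsilon> Z x y))"
    using sw1(2) unfolding f1 f2 set_lebesgue_integral_def[of _ "{c..d}"] .
  show "integrable lborel (\<lambda>y. indicator {c..d} y *\<^sub>R (LBINT x:{a..b}. smooth_density \<epsilon> Z x y))"
    using sw1(1) unfolding f1 .
  show "integrable lborel (\<lambda>x. indicator {a..b} x *\<^sub>R smooth_density \<epsilon> Z x y)"
    using sw2(1) unfolding g1 .
qed

lemma smoothing_rectangle_estimate:
  fixes q :: "real \<Rightarrow> real \<Rightarrow> real"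
  assumes Z: "Z \<in> borel_measurable M" and e: "\<epsilon> > 0"
    and cont: "continuous_on UNIV (\<lambda>(y, x). q x y)"
    and B: "\<And>x y. \<bar>smooth_density \<epsilon> Z x y - q x y\<bar> \<le> B" and ab: "a \<le> b" "c \<le> d"
  shows "\<bar>(\<integral>\<omega>. window \<epsilon> a b (Re (Z \<omega>)) * window \<epsilon> c d (Im (Z \<omega>)) \<partial>M)
     - integral {c..d} (\<lambda>y. integral {a..b} (\<lambda>x. q x y))\<bar> \<le> B * (b - a) * (d - c)"
proof -
  have B0: "0 \<le> B" using B[of 0 0] by linarith
  have cx: "continuous_on {a..b} (\<lambda>x. q x y)" for y
  proof -
    have "continuous_on {a..b} (\<lambda>x. case (y, x) of (y, x) \<Rightarrow> q x y)"
      by (rule continuous_on_compose2[OF cont]) (auto intro!: continuous_on_Pair continuous_on_const continuous_on_id)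
    then show ?thesis by simp
  qed
  have six: "set_integrable lborel {a..b} (\<lambda>x. q x y)" for y
    by (rule borel_integrable_atLeastAtMost') (rule cx)
  have eqx: "integral {a..b} (\<lambda>x. q x y) = (LBINT x:{a..b}. q x y)" for y
    using set_borel_integral_eq_integral(2)[OF six] by simp
  define w where "w y = integral {a..b} (\<lambda>x. q x y)" for y
  have cw: "continuous_on {c..d} w"
  proof -
    have "continuous_on UNIV (\<lambda>y. integral (cbox a b) (\<lambda>x. q x y))"
      by (rule integral_continuous_on_param) (use continuous_on_subset[OF cont] in auto)
    then show ?thesis unfolding w_def by (auto intro: continuous_on_subset)
  qed
  have siy: "set_integrable lborel {c..d} w" by (rule borel_integrable_atLeastAtMost') (rule cw)
  have eqy: "integral {c..d} w = (LBINT y:{c..d}. w y)"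
    using set_borel_integral_eq_integral(2)[OF siy] by simp
  define s where "s y = (LBINT x:{a..b}. smooth_density \<epsilon> Z x y)" for y
  have si1: "set_integrable lborel {a..b} (\<lambda>x. smooth_density \<epsilon> Z x y)" for y
    using expectation_windows(3)[OF Z e] unfolding set_integrable_def .
  have si2: "set_integrable lborel {c..d} s"
    using expectation_windows(2)[OF Z e] unfolding set_integrable_def s_def .
  have const: "(LBINT x:{a..b}. K) = K * (b - a)" if "a \<le> b" for a b K :: real
    using that by (simp add: set_integral_const)
  have ic: "set_integrable lborel {a..b} (\<lambda>x. K)" for a b K :: real
    by (rule borel_integrable_atLeastAtMost') simp
  have nb: "\<bar>LBINT x:{a..b}. f x\<bar> \<le> K * (b - a)"
    if f: "set_integrable lborel {a..b} f" "\<And>x. \<bar>f x\<bar> \<le> K" "a \<le> b" for f a b and K :: real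
  proof -
    have "\<bar>LBINT x:{a..b}. f x\<bar> \<le> (LBINT x:{a..b}. K)"
      unfolding set_lebesgue_integral_def real_norm_def[symmetric]
    proof (rule Bochner_Integration.integral_norm_bound_integral)
      show "norm (indicat_real {a..b} x *\<^sub>R f x) \<le> indicat_real {a..b} x *\<^sub>R K" for x
        using f(2)[of x] by (auto simp: indicator_def)
    qed (use f(1) ic[of a b K] in \<open>auto simp: set_integrable_def\<close>)
    then show ?thesis using const f(3) by simp
  qed
  have in1: "\<bar>s y - w y\<bar> \<le> B * (b - a)" for y
  proof -
    have "s y - w y = (LBINT x:{a..b}. smooth_density \<epsilon> Z x y - q x y)"
      unfolding s_def w_def eqx by (rule set_integral_diff(2)[symmetric, OF si1 six])
    also have "\<bar>\<dots>\<bar> \<le> B * (b - a)"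
      by (rule nb[OF set_integral_diff(1)[OF si1 six] B ab(1)])
    finally show ?thesis .
  qed
  have "(\<integral>\<omega>. window \<epsilon> a b (Re (Z \<omega>)) * window \<epsilon> c d (Im (Z \<omega>)) \<partial>M) - integral {c..d} w = (LBINT y:{c..d}. s y - w y)"
    unfolding expectation_windows(1)[OF Z e] s_def[symmetric] eqy by (rule set_integral_diff(2)[symmetric, OF si2 siy])
  also have "\<bar>\<dots>\<bar> \<le> B * (b - a) * (d - c)"
    by (rule nb[OF set_integral_diff(1)[OF si2 siy] in1 ab(2)])
  finally show ?thesis unfolding w_def .
qed

text \<open>The indicator of the rectangle is squeezed between smoothed indicators of the rectangles
  shrunk and enlarged by \<delta>, up to multiples of the escaping mass
  \<open>\<epsilon> ^ 2 / \<delta> ^ 2\<close>. \<open>B\<close> is paid on the whole area,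
  \<open>Q\<close> only on the boundary strips. The conditions
  \<open>2 * \<delta> \<le> b - a\<close> and \<open>2 * \<delta> \<le> d - c\<close> keep the sides
  of the shrunk rectangle in order.\<close>

theorem smoothing_inequality:
  fixes q :: "real \<Rightarrow> real \<Rightarrow> real"
  assumes Z [measurable]: "Z \<in> borel_measurable M" and e: "\<epsilon> > 0" and d: "\<delta> > 0" "\<delta> \<le> 1" "2 * \<delta> \<le> b - a" "2 * \<delta> \<le> d - c"
    and cont: "continuous_on UNIV (\<lambda>(y, x). q x y)" and Q: "\<And>x y. \<bar>q x y\<bar> \<le> Q"
    and B: "\<And>x y. \<bar>smooth_density \<epsilon> Z x y - q x y\<bar> \<le> B"
  shows "\<bar>measure M {\<omega>\<in>space M. Re (Z \<omega>) \<in> {a..b} \<and> Im (Z \<omega>) \<in> {c..d}}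
     - integral {c..d} (\<lambda>y. integral {a..b} (\<lambda>x. q x y))\<bar>
     \<le> B * (b - a + 2) * (d - c + 2) + 2 * \<delta> * Q * ((b - a + 2) + (d - c + 2)) + 2 * (\<epsilon>\<^sup>2 / \<delta>\<^sup>2)"
proof -
  have B0: "0 \<le> B" using B[of 0 0] by linarith
  have Q0: "0 \<le> Q" using Q[of 0 0] by linarith
  define \<eta> where "\<eta> = \<epsilon>\<^sup>2 / \<delta>\<^sup>2"
  have eta0: "0 \<le> \<eta>" by (simp add: \<eta>_def)
  define J where "J a b c d = integral {c..d} (\<lambda>y. integral {a..b} (\<lambda>x. q x y))" for a b c d
  define W where "W a b c d \<omega> = window \<epsilon> a b (Re (Z \<omega>)) * window \<epsilon> c d (Im (Z \<omega>))" for a b c d \<omega>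
  define R where "R = {\<omega>\<in>space M. Re (Z \<omega>) \<in> {a..b} \<and> Im (Z \<omega>) \<in> {c..d}}"
  have Rm [measurable]: "R \<in> sets M" unfolding R_def by measurable
  have [measurable]: "W a b c d \<in> borel_measurable M" for a b c d unfolding W_def[abs_def] by measurable
  have Wb: "0 \<le> W a b c d \<omega>" "W a b c d \<omega> \<le> 1" for a b c d \<omega>
    unfolding W_def using window_bounds[OF e] by (auto intro!: mult_le_one)
  have Wi: "integrable M (W a b c d)" for a b c d
    by (rule integrable_const_bound[where B = 1]) (use Wb in auto)
  have cx: "continuous_on UNIV (\<lambda>x. q x y)" for y
  proof -
    have "continuous_on UNIV (\<lambda>x. case (y, x) of (y, x) \<Rightarrow> q x y)"
      by (rule continuous_on_compose2[OF cont]) (auto intro!: continuous_on_Pair continuous_on_const continuous_on_id)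
    then show ?thesis by simp
  qed
  have cw: "continuous_on UNIV (\<lambda>y. integral {a..b} (\<lambda>x. q x y))" for a b
    using integral_continuous_on_param[of UNIV a b "\<lambda>y x. q x y"] continuous_on_subset[OF cont] by auto
  have wb: "\<bar>integral {a..b} (\<lambda>x. q x y)\<bar> \<le> Q * (b - a)" if "a \<le> b" for a b y
    using integral_bound[of a b "\<lambda>x. q x y" Q] that Q continuous_on_subset[OF cx] by auto
  have Jd: "\<bar>J a' b' c' d' - J a b c d\<bar> \<le> 2 * \<delta> * Q * ((b - a + 2) + (d - c + 2))"
    if h: "a' \<le> b'" "c' \<le> d'" "\<bar>a' - a\<bar> \<le> \<delta>" "\<bar>b' - b\<bar> \<le> \<delta>" "\<bar>c' - c\<bar> \<le> \<delta>" "\<bar>d' - d\<bar> \<le> \<delta>" for a' b' c' d'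
  proof -
    have 1: "\<bar>J a' b' c' d' - J a' b' c d\<bar> \<le> 2 * \<delta> * (Q * (b' - a'))"
      unfolding J_def by (rule integral_interval_change[OF cw wb]) (use h d in auto)
    have 2: "\<bar>J a' b' c d - J a b c d\<bar> \<le> 2 * \<delta> * Q * (d - c)"
    proof -
      have io: "(\<lambda>y. integral {a..b} (\<lambda>x. q x y)) integrable_on {c..d}" for a b
        by (intro integrable_continuous_interval continuous_on_subset[OF cw]) auto
      have "J a' b' c d - J a b c d = integral {c..d} (\<lambda>y. integral {a'..b'} (\<lambda>x. q x y) - integral {a..b} (\<lambda>x. q x y))"
        unfolding J_def by (rule Henstock_Kurzweil_Integration.integral_diff[symmetric, OF io io])
      also have "norm \<dots> \<le> 2 * \<delta> * Q * (d - c)"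
      proof (rule integral_bound)
        show "continuous_on {c..d} (\<lambda>y. integral {a'..b'} (\<lambda>x. q x y) - integral {a..b} (\<lambda>x. q x y))"
          by (intro continuous_on_diff continuous_on_subset[OF cw]) auto
        show "norm (integral {a'..b'} (\<lambda>x. q x y) - integral {a..b} (\<lambda>x. q x y)) \<le> 2 * \<delta> * Q" for y
          unfolding real_norm_def by (rule integral_interval_change[OF cx Q]) (use h d in auto)
      qed (use d in auto)
      finally show ?thesis by simp
    qed
    have "2 * \<delta> * (Q * (b' - a')) \<le> 2 * \<delta> * (Q * (b - a + 2))"
      using h d Q0 by (intro mult_left_mono) auto
    moreover have "2 * \<delta> * Q * (d - c) \<le> 2 * \<delta> * Q * (d - c + 2)"
      using d Q0 by (intro mult_left_mono) auto
    moreover have "2 * \<delta> * Q * ((b - a + 2) + (d - c + 2)) = 2 * \<delta> * (Q * (b - a + 2)) + 2 * \<delta> * Q * (d - c + 2)"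
      by (simp add: algebra_simps)
    ultimately show ?thesis using 1 2 by linarith
  qed
  have est: "\<bar>(\<integral>\<omega>. W a' b' c' d' \<omega> \<partial>M) - J a b c d\<bar> \<le> B * (b - a + 2) * (d - c + 2) + 2 * \<delta> * Q * ((b - a + 2) + (d - c + 2))"
    if h: "a' \<le> b'" "c' \<le> d'" "\<bar>a' - a\<bar> \<le> \<delta>" "\<bar>b' - b\<bar> \<le> \<delta>" "\<bar>c' - c\<bar> \<le> \<delta>" "\<bar>d' - d\<bar> \<le> \<delta>" for a' b' c' d'
  proof -
    have "\<bar>(\<integral>\<omega>. W a' b' c' d' \<omega> \<partial>M) - J a' b' c' d'\<bar> \<le> B * (b' - a') * (d' - c')"
      unfolding W_def J_def by (rule smoothing_rectangle_estimate[OF Z e cont B h(1,2)])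
    also have "\<dots> \<le> B * (b - a + 2) * (d - c + 2)"
      using h d B0 by (intro mult_mono mult_nonneg_nonneg) auto
    finally show ?thesis using Jd[OF h] by linarith
  qed
  have mR: "measure M R = (\<integral>\<omega>. indicator R \<omega> \<partial>M)" by simp
  have Ri: "integrable M (indicator R :: _ \<Rightarrow> real)" by (rule integrable_real_indicator) (auto simp: emeasure_eq_measure)
  have upper: "measure M R \<le> (\<integral>\<omega>. W (a - \<delta>) (b + \<delta>) (c - \<delta>) (d + \<delta>) \<omega> \<partial>M) + 2 * \<eta>"
  proof -
    have "indicator R \<omega> \<le> W (a - \<delta>) (b + \<delta>) (c - \<delta>) (d + \<delta>) \<omega> + 2 * \<eta>" if "\<omega> \<in> space M" for \<omega>
    proof (cases "\<omega> \<in> R")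
      case True
      let ?w1 = "window \<epsilon> (a - \<delta>) (b + \<delta>) (Re (Z \<omega>))" and ?w2 = "window \<epsilon> (c - \<delta>) (d + \<delta>) (Im (Z \<omega>))"
      have "1 - \<eta> \<le> ?w1" "1 - \<eta> \<le> ?w2"
        unfolding \<eta>_def by (rule window_inside[OF e d(1)]; use True in \<open>auto simp: R_def\<close>)+
      \<comment> \<open>For two numbers in \<open>[0, 1]\<close> the product is at least their sum
        minus 1, so the two losses \<eta> merely add.\<close>
      moreover have "0 \<le> (1 - ?w1) * (1 - ?w2)" using window_bounds[OF e] by (intro mult_nonneg_nonneg) auto
      then have "?w1 + ?w2 - 1 \<le> ?w1 * ?w2" by (simp add: algebra_simps)
      ultimately show ?thesis unfolding W_def using True by simp
    next
      case False
      then show ?thesis using Wb(1)[of "a - \<delta>" "b + \<delta>" "c - \<delta>" "d + \<delta>" \<omega>] eta0 by simp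
    qed
    then have "(\<integral>\<omega>. indicator R \<omega> \<partial>M) \<le> (\<integral>\<omega>. W (a - \<delta>) (b + \<delta>) (c - \<delta>) (d + \<delta>) \<omega> + 2 * \<eta> \<partial>M)"
      using Ri Wi by (intro integral_mono) auto
    also have "\<dots> = (\<integral>\<omega>. W (a - \<delta>) (b + \<delta>) (c - \<delta>) (d + \<delta>) \<omega> \<partial>M) + 2 * \<eta>"
      using Wi prob_space by simp
    finally show ?thesis unfolding mR .
  qed
  have lower: "(\<integral>\<omega>. W (a + \<delta>) (b - \<delta>) (c + \<delta>) (d - \<delta>) \<omega> \<partial>M) \<le> measure M R + \<eta>"
  proof -
    have "W (a + \<delta>) (b - \<delta>) (c + \<delta>) (d - \<delta>) \<omega> \<le> indicator R \<omega> + \<eta>" if "\<omega> \<in> space M" for \<omega>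
    proof (cases "\<omega> \<in> R")
      case True
      then show ?thesis using Wb(2)[of "a + \<delta>" "b - \<delta>" "c + \<delta>" "d - \<delta>" \<omega>] eta0 by simp
    next
      case False
      let ?w1 = "window \<epsilon> (a + \<delta>) (b - \<delta>) (Re (Z \<omega>))" and ?w2 = "window \<epsilon> (c + \<delta>) (d - \<delta>) (Im (Z \<omega>))"
      have "?w1 \<le> \<eta> \<or> ?w2 \<le> \<eta>"
      proof (cases "Re (Z \<omega>) \<in> {a..b}")
        case True
        then have "Im (Z \<omega>) < c \<or> d < Im (Z \<omega>)" using False that by (auto simp: R_def)
        then show ?thesis unfolding \<eta>_def using window_outside[OF e d(1), of "Im (Z \<omega>)" c d "c + \<delta>" "d - \<delta>"] by auto
      next
        case False
        then have "Re (Z \<omega>) < a \<or> b < Re (Z \<omega>)" by auto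
        then show ?thesis unfolding \<eta>_def using window_outside[OF e d(1), of "Re (Z \<omega>)" a b "a + \<delta>" "b - \<delta>"] by auto
      qed
      moreover have "?w1 * ?w2 \<le> ?w1" "?w1 * ?w2 \<le> ?w2"
        using window_bounds[OF e] by (auto simp: mult_left_le mult_left_le_one_le)
      ultimately show ?thesis unfolding W_def using False by auto
    qed
    then have "(\<integral>\<omega>. W (a + \<delta>) (b - \<delta>) (c + \<delta>) (d - \<delta>) \<omega> \<partial>M) \<le> (\<integral>\<omega>. indicator R \<omega> + \<eta> \<partial>M)"
      using Ri Wi by (intro integral_mono) auto
    also have "\<dots> = (\<integral>\<omega>. indicator R \<omega> \<partial>M) + \<eta>" using Ri prob_space by (subst Bochner_Integration.integral_add) auto
    finally show ?thesis unfolding mR .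
  qed
  have e1: "\<bar>(\<integral>\<omega>. W (a - \<delta>) (b + \<delta>) (c - \<delta>) (d + \<delta>) \<omega> \<partial>M) - J a b c d\<bar> \<le> B * (b - a + 2) * (d - c + 2) + 2 * \<delta> * Q * ((b - a + 2) + (d - c + 2))"
    and e2: "\<bar>(\<integral>\<omega>. W (a + \<delta>) (b - \<delta>) (c + \<delta>) (d - \<delta>) \<omega> \<partial>M) - J a b c d\<bar> \<le> B * (b - a + 2) * (d - c + 2) + 2 * \<delta> * Q * ((b - a + 2) + (d - c + 2))"
    by (rule est; use d in auto)+
  show ?thesis
    using upper lower e1 e2 eta0 unfolding R_def[symmetric] J_def[symmetric] \<eta>_def[symmetric] by linarith
qed

end

subsection \<open>The expansion\<close>

lemma power_exp_bound:
  assumes c: "c > 0"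
  obtains K where "K > 0" "\<And>s. 0 \<le> s \<Longrightarrow> (1 + s) ^ n * exp (- (c * s)) \<le> (K :: real)"
proof (cases "n = 0")
  case True
  show ?thesis by (rule that[of 1]) (use True c in auto)
next
  case False
  then have n: "real n > 0" by simp
  show ?thesis
  proof (rule that[of "(real n / c) ^ n * exp c"])
    show "0 < (real n / c) ^ n * exp c" using n c by simp
    fix s :: real assume s: "0 \<le> s"
    define x where "x = c * (1 + s)"
    have x: "0 \<le> x" using s c by (simp add: x_def)
    have "x / real n \<le> exp (x / real n)" using exp_ge_add_one_self[of "x / real n"] by linarith
    then have "(x / real n) ^ n \<le> exp (x / real n) ^ n" using x n by (intro power_mono) auto
    also have "\<dots> = exp x" using n by (simp flip: exp_of_nat_mult)
    finally have "(1 + s) ^ n * (c / real n) ^ n \<le> exp x"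
      by (simp add: x_def power_mult_distrib power_divide mult.commute)
    then have "(1 + s) ^ n \<le> (real n / c) ^ n * exp x"
      using n c by (simp add: power_divide field_simps)
    then have "(1 + s) ^ n * exp (- (c * s)) \<le> (real n / c) ^ n * exp x * exp (- (c * s))"
      by (intro mult_right_mono) auto
    also have "\<dots> = (real n / c) ^ n * (exp x * exp (- (c * s)))" by simp
    also have "exp x * exp (- (c * s)) = exp c" by (simp add: x_def algebra_simps flip: exp_add)
    finally show "(1 + s) ^ n * exp (- (c * s)) \<le> (real n / c) ^ n * exp c" .
  qed
qed

text \<open>Outside the unit disc the bound is stated with exponent 6, the power of
  \<open>norm t\<close> that turns into \<open>psi powr (- 3)\<close> after rescaling.\<close>

lemma norm_limit_poly_le:
  obtains K where "K \<ge> 0"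
    "\<And>t. norm t \<le> 1 \<Longrightarrow> norm (limit_poly (Re t) ((cmod t)\<^sup>2 / 4)) \<le> K"
    "\<And>t. norm t \<ge> 1 \<Longrightarrow> norm (limit_poly (Re t) ((cmod t)\<^sup>2 / 4)) \<le> K * norm t ^ 6"
proof -
  define L where "L = \<bar>edge_const cf1\<bar> + \<bar>edge_const cf2\<bar> + \<bar>edge_const cf3\<bar> + \<bar>edge_const cf4\<bar> + \<bar>edge_const cf5\<bar>"
  have L: "\<bar>edge_const cf1\<bar> \<le> L" "\<bar>edge_const cf2\<bar> \<le> L" "\<bar>edge_const cf3\<bar> \<le> L" "\<bar>edge_const cf4\<bar> \<le> L" "\<bar>edge_const cf5\<bar> \<le> L" "0 \<le> L"
    by (auto simp: L_def)
  have b: "norm (limit_poly (Re t) ((cmod t)\<^sup>2 / 4)) \<le> 5 * (L * m ^ 6)" if m: "norm t \<le> m" "1 \<le> m" for t m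
  proof -
    define u where "u = Re t"
    define b where "b = (cmod t)\<^sup>2 / 4"
    have u: "\<bar>u\<bar> \<le> m" using abs_Re_le_cmod[of t] m by (simp add: u_def)
    have bm: "0 \<le> b" "b \<le> m\<^sup>2"
    proof -
      have "(cmod t)\<^sup>2 \<le> m\<^sup>2" using power_mono[OF m(1), of 2] by simp
      moreover have "0 \<le> (cmod t)\<^sup>2" by simp
      ultimately show "b \<le> m\<^sup>2" unfolding b_def by linarith
    qed (simp add: b_def)
    have mono: "\<bar>u\<bar> ^ i * b ^ j * \<bar>k\<bar> \<le> L * m ^ 6" if "i + 2 * j \<le> 6" "\<bar>k\<bar> \<le> L" for i j k
    proof -
      have "\<bar>u\<bar> ^ i * b ^ j \<le> m ^ i * (m\<^sup>2) ^ j" using u bm m by (intro mult_mono power_mono) auto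
      also have "\<dots> = m ^ (i + 2 * j)" by (simp add: power_add power_mult)
      also have "\<dots> \<le> m ^ 6" using that m by (intro power_increasing) auto
      finally have "\<bar>u\<bar> ^ i * b ^ j * \<bar>k\<bar> \<le> m ^ 6 * L" using that m by (intro mult_mono) auto
      then show ?thesis by (simp add: mult.commute)
    qed
    have "norm (limit_poly u b) \<le> L * m ^ 6 + L * m ^ 6 + L * m ^ 6 + L * m ^ 6 + L * m ^ 6"
      unfolding limit_poly_def edge_poly_def
    proof (intro norm_triangle_mono)
      show "norm (\<i> * of_real (u * b * edge_const cf1)) \<le> L * m ^ 6"
        using mono[of 1 1 "edge_const cf1"] L bm by (simp add: norm_mult abs_mult)
      show "norm (of_real (u\<^sup>2 * b * edge_const cf2) :: complex) \<le> L * m ^ 6"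
        using mono[of 2 1 "edge_const cf2"] L bm by (simp add: norm_mult abs_mult norm_power)
      show "norm (of_real (b\<^sup>2 * edge_const cf3) :: complex) \<le> L * m ^ 6"
        using mono[of 0 2 "edge_const cf3"] L bm by (simp add: norm_mult abs_mult norm_power)
      show "norm (\<i> * of_real (u ^ 3 * b * edge_const cf4)) \<le> L * m ^ 6"
        using mono[of 3 1 "edge_const cf4"] L bm by (simp add: norm_mult abs_mult norm_power power_abs)
      show "norm (\<i> * of_real (u * b\<^sup>2 * edge_const cf5)) \<le> L * m ^ 6"
        using mono[of 1 2 "edge_const cf5"] L bm by (simp add: norm_mult abs_mult norm_power)
    qed
    then show ?thesis by (simp add: u_def b_def)
  qed
  show ?thesis
  proof (rule that[of "5 * L"])
    show "norm (limit_poly (Re t) ((cmod t)\<^sup>2 / 4)) \<le> 5 * L" if "norm t \<le> 1" for t using b[OF that] by simp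
    show "norm (limit_poly (Re t) ((cmod t)\<^sup>2 / 4)) \<le> 5 * L * norm t ^ 6" if "norm t \<ge> 1" for t
      using b[of t "norm t"] that by simp
  qed (use L in auto)
qed

text \<open>By the asymptotics of \<open>psi\<close>,
  \<open>2 * \<sigma> - 1 \<le> exp (C - psi \<sigma>)\<close>. The cube is what
  \<open>exp y \<ge> (y / 3) ^ 3\<close> retains of this exponential smallness, and 27 is its
  constant.\<close>

lemma sigma_gap_le:
  obtains C where "C \<ge> 0" "\<And>\<sigma>. 1/2 < \<sigma> \<Longrightarrow> \<sigma> \<le> 3/2 \<Longrightarrow> 2 * \<sigma> - 1 \<le> C / psi \<sigma> ^ 3"
proof -
  obtain C where C: "\<And>\<sigma>. 1/2 < \<sigma> \<Longrightarrow> \<sigma> \<le> 3/2 \<Longrightarrow> \<bar>psi \<sigma> - ln (1 / (2 * \<sigma> - 1))\<bar> \<le> C"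
    using psi_asymp by blast
  show ?thesis
  proof (rule that[of "27 * exp C"])
    fix \<sigma> :: real assume s: "1/2 < \<sigma>" "\<sigma> \<le> 3/2"
    define d where "d = 2 * \<sigma> - 1"
    have d: "d > 0" using s by (simp add: d_def)
    have p: "psi \<sigma> > 0" using psi_ge[OF s] by linarith
    have "psi \<sigma> \<le> - ln d + C" using C[OF s] d unfolding d_def[symmetric] by (simp add: ln_div)
    then have "ln d \<le> C - psi \<sigma>" by linarith
    then have "d \<le> exp (C - psi \<sigma>)" using d by (metis exp_le_cancel_iff exp_ln)
    also have "\<dots> = exp C / exp (psi \<sigma>)" by (rule exp_diff)
    also have "\<dots> \<le> exp C / (psi \<sigma> ^ 3 / 27)"
    proof (intro divide_left_mono)
      have "psi \<sigma> / 3 \<le> exp (psi \<sigma> / 3)" using exp_ge_add_one_self[of "psi \<sigma> / 3"] by linarith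
      then have "(psi \<sigma> / 3) ^ 3 \<le> exp (psi \<sigma> / 3) ^ 3" using p by (intro power_mono) auto
      also have "\<dots> = exp (psi \<sigma>)" by (simp flip: exp_of_nat_mult)
      finally show "psi \<sigma> ^ 3 / 27 \<le> exp (psi \<sigma>)" by (simp add: power_divide)
    qed (use p in auto)
    finally show "2 * \<sigma> - 1 \<le> 27 * exp C / psi \<sigma> ^ 3" by (simp add: d_def field_simps)
  qed simp
qed

text \<open>In the rescaled variable \<open>S = pi * psi * |t| ^ 2\<close> all three errors are
  \<open>psi powr (- 3)\<close> times a polynomial in \<open>S\<close>: \<open>|t| ^ 6\<close> is
  \<open>(S / (pi * psi)) ^ 3\<close>, the gap \<open>2 * \<sigma> - 1\<close> is
  \<open>O(psi powr (- 3))\<close>, and the damping differs from 1 by at most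
  \<open>\<epsilon> ^ 2 * S\<close>. The common Gaussian factor is kept, for integrability in
  \<open>S\<close>.\<close>

lemma char_approx_central:
  obtains C where "C \<ge> 0" "\<And>\<sigma> t \<phi> \<epsilon>. 1/2 < \<sigma> \<Longrightarrow> \<sigma> \<le> 3/2 \<Longrightarrow> psi \<sigma> \<ge> 1 \<Longrightarrow> norm t \<le> 1 \<Longrightarrow> Phi \<sigma> t \<longlonglongrightarrow> \<phi> \<Longrightarrow>
    \<epsilon>\<^sup>2 \<le> 1 / psi \<sigma> ^ 3 \<Longrightarrow>
    norm (of_real (exp (- (\<epsilon>\<^sup>2 * (pi * psi \<sigma> * (norm t)\<^sup>2) / 2))) * \<phi>
      - of_real (exp (- (psi \<sigma> * (norm t)\<^sup>2 / 4))) * (1 + limit_poly (Re t) ((norm t)\<^sup>2 / 4)))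
    \<le> C / psi \<sigma> ^ 3 * (1 + pi * psi \<sigma> * (norm t)\<^sup>2) ^ 3 * exp (- (psi \<sigma> * (norm t)\<^sup>2 / 4))"
proof -
  obtain C1 where C1: "C1 \<ge> 0" "\<And>\<sigma> t \<phi>. \<sigma> > 1/2 \<Longrightarrow> norm t \<le> 1 \<Longrightarrow> Phi \<sigma> t \<longlonglongrightarrow> \<phi> \<Longrightarrow>
     norm (\<phi> * of_real (exp ((cmod t)\<^sup>2 / 4 * psi \<sigma>)) - 1 - limit_poly (Re t) ((cmod t)\<^sup>2 / 4))
       \<le> C1 * (norm t ^ 6 + (2 * \<sigma> - 1) * norm t ^ 3)"
    using Phi_central by blast
  obtain K where K: "K \<ge> 0" "\<And>t. norm t \<le> 1 \<Longrightarrow> norm (limit_poly (Re t) ((cmod t)\<^sup>2 / 4)) \<le> K"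
    by (rule norm_limit_poly_le) (rule that)
  obtain C5 where C5: "C5 \<ge> 0" "\<And>\<sigma>. 1/2 < \<sigma> \<Longrightarrow> \<sigma> \<le> 3/2 \<Longrightarrow> 2 * \<sigma> - 1 \<le> C5 / psi \<sigma> ^ 3"
    by (rule sigma_gap_le) (rule that)
  define C3 where "C3 = 1 + K + 3 * C1"
  have C30: "C3 \<ge> 0" using K C1 by (simp add: C3_def)
  show ?thesis
  proof (rule that[of "C3 + C1 * (1 + C5)"])
    show "0 \<le> C3 + C1 * (1 + C5)" using C30 C1 C5 by simp
    fix \<sigma> t \<phi> and \<epsilon> :: real
    assume s: "1/2 < \<sigma>" "\<sigma> \<le> 3/2" and psi1: "psi \<sigma> \<ge> 1" and t: "norm t \<le> 1" and lim: "Phi \<sigma> t \<longlonglongrightarrow> \<phi>"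
      and eps: "\<epsilon>\<^sup>2 \<le> 1 / psi \<sigma> ^ 3"
    define p where "p = psi \<sigma>"
    define r where "r = norm t"
    define S where "S = pi * p * r\<^sup>2"
    define g where "g = exp (- (p * r\<^sup>2 / 4))"
    define P where "P = limit_poly (Re t) ((cmod t)\<^sup>2 / 4)"
    define dm where "dm = exp (- (\<epsilon>\<^sup>2 * S / 2))"
    have p: "p \<ge> 1" using psi1 by (simp add: p_def)
    have r: "0 \<le> r" "r \<le> 1" using t by (auto simp: r_def)
    have S: "S \<ge> 0" using p by (simp add: S_def)
    have g: "g > 0" by (simp add: g_def)
    define e where "e = r ^ 6 + (2 * \<sigma> - 1) * r ^ 3"
    have e0: "0 \<le> e" using r s by (simp add: e_def)
    have e3: "e \<le> 3"
    proof -
      have "(2 * \<sigma> - 1) * r ^ 3 \<le> 2 * 1" using s r by (intro mult_mono) (auto simp: power_le_one)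
      then show ?thesis using power_le_one[OF r, of 6] by (simp add: e_def)
    qed
    have r6: "r ^ 6 \<le> S ^ 3 / p ^ 3"
    proof -
      have "S ^ 3 / p ^ 3 = pi ^ 3 * r ^ 6" using p by (simp add: S_def power_mult_distrib flip: power_mult)
      moreover have "1 * r ^ 6 \<le> pi ^ 3 * r ^ 6" using r pi_gt3 by (intro mult_right_mono one_le_power) auto
      ultimately show ?thesis by simp
    qed
    have ep: "e \<le> (1 + C5) * (1 + S) ^ 3 / p ^ 3"
    proof -
      have "(2 * \<sigma> - 1) * r ^ 3 \<le> C5 / p ^ 3 * 1"
        using C5(2)[OF s] r s C5(1) p by (intro mult_mono) (auto simp: p_def power_le_one)
      then have "e \<le> S ^ 3 / p ^ 3 + C5 / p ^ 3" using r6 by (simp add: e_def)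
      also have "\<dots> \<le> (1 + S) ^ 3 / p ^ 3 + C5 * (1 + S) ^ 3 / p ^ 3"
      proof (intro add_mono divide_right_mono)
        show "S ^ 3 \<le> (1 + S) ^ 3" using S by (intro power_mono) auto
        have "1 \<le> (1 + S) ^ 3" using S by (intro one_le_power) auto
        then show "C5 \<le> C5 * (1 + S) ^ 3" using C5(1) by (simp add: mult_le_cancel_left1)
      qed (use p in auto)
      finally show ?thesis by (simp add: algebra_simps add_divide_distrib)
    qed
    have ginv: "of_real (exp (r\<^sup>2 / 4 * p)) * complex_of_real g = 1"
      by (simp add: g_def algebra_simps flip: of_real_mult exp_add)
    have d1: "norm (\<phi> - of_real g * (1 + P)) \<le> g * (C1 * e)"
    proof -
      have "\<phi> - of_real g * (1 + P) = of_real g * (\<phi> * of_real (exp (r\<^sup>2 / 4 * p)) - 1 - P)"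
        using ginv by (simp add: algebra_simps)
      also have "norm \<dots> \<le> g * (C1 * e)"
        unfolding norm_mult e_def r_def p_def P_def using C1(2)[OF s(1) t lim] g by (simp add: mult_left_mono)
      finally show ?thesis .
    qed
    have nphi: "norm \<phi> \<le> g * C3"
    proof -
      have "norm \<phi> \<le> norm (\<phi> - of_real g * (1 + P)) + norm (of_real g * (1 + P))"
        using norm_triangle_ineq[of "\<phi> - of_real g * (1 + P)" "of_real g * (1 + P)"] by simp
      also have "norm (of_real g * (1 + P)) \<le> g * (1 + K)"
      proof -
        have "norm (1 + P) \<le> 1 + K" using K(2)[OF t] norm_triangle_ineq[of 1 P] by (simp add: P_def)
        then show ?thesis unfolding norm_mult using g by (simp add: mult_left_mono)
      qed
      also have "norm (\<phi> - of_real g * (1 + P)) \<le> g * (C1 * 3)"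
        by (rule order_trans[OF d1]) (intro mult_left_mono e3; use C1 g in simp)
      finally show ?thesis by (simp add: C3_def algebra_simps)
    qed
    have dm: "\<bar>dm - 1\<bar> \<le> S / p ^ 3"
    proof -
      have "dm \<le> 1" unfolding dm_def using S by simp
      moreover have "1 - dm \<le> \<epsilon>\<^sup>2 * S / 2" using exp_ge_add_one_self[of "- (\<epsilon>\<^sup>2 * S / 2)"] by (simp add: dm_def)
      moreover have "\<epsilon>\<^sup>2 * S / 2 \<le> \<epsilon>\<^sup>2 * S" using S by simp
      moreover have "\<epsilon>\<^sup>2 * S \<le> 1 / p ^ 3 * S" using eps S by (intro mult_right_mono) (auto simp: p_def)
      ultimately show ?thesis by simp
    qed
    have "of_real dm * \<phi> - of_real g * (1 + P) = of_real (dm - 1) * \<phi> + (\<phi> - of_real g * (1 + P))"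
      by (simp add: algebra_simps)
    also have "norm \<dots> \<le> S / p ^ 3 * (g * C3) + g * (C1 * e)"
    proof (intro norm_triangle_mono d1)
      show "norm (of_real (dm - 1) * \<phi>) \<le> S / p ^ 3 * (g * C3)"
        unfolding norm_mult norm_of_real by (intro mult_mono dm nphi) (use S p in auto)
    qed
    also have "\<dots> \<le> (1 + S) ^ 3 / p ^ 3 * (g * C3) + g * (C1 * ((1 + C5) * (1 + S) ^ 3 / p ^ 3))"
    proof (intro add_mono mult_right_mono divide_right_mono mult_left_mono ep)
      have "S \<le> (1 + S) ^ 1" by simp
      also have "\<dots> \<le> (1 + S) ^ 3" using S by (intro power_increasing) auto
      finally show "S \<le> (1 + S) ^ 3" .
    qed (use p g C30 C1 in auto)
    also have "\<dots> = (C3 + C1 * (1 + C5)) / p ^ 3 * (1 + S) ^ 3 * g"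
      by (simp add: algebra_simps add_divide_distrib)
    finally show "norm (of_real (exp (- (\<epsilon>\<^sup>2 * (pi * psi \<sigma> * (norm t)\<^sup>2) / 2))) * \<phi>
      - of_real (exp (- (psi \<sigma> * (norm t)\<^sup>2 / 4))) * (1 + limit_poly (Re t) ((norm t)\<^sup>2 / 4)))
    \<le> (C3 + C1 * (1 + C5)) / psi \<sigma> ^ 3 * (1 + pi * psi \<sigma> * (norm t)\<^sup>2) ^ 3 * exp (- (psi \<sigma> * (norm t)\<^sup>2 / 4))"
      unfolding dm_def g_def P_def S_def p_def r_def .
  qed
qed


text \<open>With \<open>S = u ^ 2 + v ^ 2\<close>, the weight
  \<open>(1 + u ^ 2) * (1 + v ^ 2)\<close> is at most \<open>(1 + S) ^ 2\<close>. For
  \<open>|t| \<le> 1\<close> the central expansion applies. For \<open>|t| > 1\<close> one has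
  \<open>1 \<le> |t| ^ 6 \<le> (1 + S) ^ 3 / psi ^ 3\<close>, so the factor
  \<open>psi powr (- 3)\<close> is free and the two sides are bounded separately: the approximant by
  its Gaussian, the characteristic function by \<open>Phi_decay\<close> up to
  \<open>|t| = psi ^ 10\<close> and by the damping beyond. The powers 3 and 2 of
  \<open>1 + S\<close> make up the exponent 5 in \<open>K1\<close> and \<open>K2\<close>.\<close>

lemma char_approx:
  obtains C \<Psi> where "C \<ge> 0" "\<Psi> \<ge> 1" "\<And>\<sigma> u v \<phi>. 1/2 < \<sigma> \<Longrightarrow> \<sigma> \<le> 3/2 \<Longrightarrow> psi \<sigma> \<ge> \<Psi> \<Longrightarrow>
    Phi \<sigma> (Complex u v / of_real (sqrt (pi * psi \<sigma>))) \<longlonglongrightarrow> \<phi> \<Longrightarrow> norm \<phi> \<le> 1 \<Longrightarrow>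
    norm (of_real (damp (1 / psi \<sigma> ^ 5) u * damp (1 / psi \<sigma> ^ 5) v) * \<phi>
      - of_real (exp (- ((u\<^sup>2 + v\<^sup>2) / (4 * pi)))) * (1 + limit_poly (u / sqrt (pi * psi \<sigma>)) ((u\<^sup>2 + v\<^sup>2) / (4 * pi * psi \<sigma>))))
    \<le> C / psi \<sigma> ^ 3 * (inverse (1 + u\<^sup>2) * inverse (1 + v\<^sup>2))"
proof -
  obtain Ca where Ca: "Ca \<ge> 0" "\<And>\<sigma> t \<phi> \<epsilon>. 1/2 < \<sigma> \<Longrightarrow> \<sigma> \<le> 3/2 \<Longrightarrow> psi \<sigma> \<ge> 1 \<Longrightarrow> norm t \<le> 1 \<Longrightarrow> Phi \<sigma> t \<longlonglongrightarrow> \<phi> \<Longrightarrow>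
    \<epsilon>\<^sup>2 \<le> 1 / psi \<sigma> ^ 3 \<Longrightarrow>
    norm (of_real (exp (- (\<epsilon>\<^sup>2 * (pi * psi \<sigma> * (norm t)\<^sup>2) / 2))) * \<phi>
      - of_real (exp (- (psi \<sigma> * (norm t)\<^sup>2 / 4))) * (1 + limit_poly (Re t) ((norm t)\<^sup>2 / 4)))
    \<le> Ca / psi \<sigma> ^ 3 * (1 + pi * psi \<sigma> * (norm t)\<^sup>2) ^ 3 * exp (- (psi \<sigma> * (norm t)\<^sup>2 / 4))"
    by (rule char_approx_central) (rule that)
  obtain K where K: "K \<ge> 0" "\<And>t. norm t \<ge> 1 \<Longrightarrow> norm (limit_poly (Re t) ((cmod t)\<^sup>2 / 4)) \<le> K * norm t ^ 6"
    by (rule norm_limit_poly_le) (rule that)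
  obtain Cd where Cd: "\<And>\<sigma> t \<phi> Y. \<sigma> > 1/2 \<Longrightarrow> Phi \<sigma> t \<longlonglongrightarrow> \<phi> \<Longrightarrow> Y \<ge> 1 \<Longrightarrow> 8 * (1 + norm t + (norm t)\<^sup>2) \<le> real Y \<Longrightarrow>
     norm \<phi> \<le> exp (- ((cmod t)\<^sup>2 / 8) * (psi \<sigma> - Cd - ln (real Y)))"
    using Phi_decay by blast
  have "\<forall>\<^sub>F x in at_top. Cd + ln 25 + 20 * ln x \<le> x / 2" by real_asymp
  \<comment> \<open>Beyond this threshold the constant \<open>Cd\<close> and the primes up to
    \<open>Y \<le> 25 * p ^ 20\<close> together consume at most half of \<open>psi\<close> in the
    decay exponent.\<close>
  then obtain \<Psi>0 where \<Psi>0: "\<And>x. x \<ge> \<Psi>0 \<Longrightarrow> Cd + ln 25 + 20 * ln x \<le> x / 2"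
    by (auto simp: eventually_at_top_linorder)
  obtain K1 where K1: "K1 > 0" "\<And>s. 0 \<le> s \<Longrightarrow> (1 + s) ^ 5 * exp (- (1 / (4 * pi) * s)) \<le> K1"
    by (rule power_exp_bound[of "1 / (4 * pi)" 5]) (simp, rule that)
  obtain K2 where K2: "K2 > 0" "\<And>s. 0 \<le> s \<Longrightarrow> (1 + s) ^ 5 * exp (- (1 / (16 * pi) * s)) \<le> K2"
    by (rule power_exp_bound[of "1 / (16 * pi)" 5]) (simp, rule that)
  obtain K3 :: real where K3: "K3 > 0" "\<And>s. 0 \<le> s \<Longrightarrow> (1 + s) ^ 5 * exp (- (1 / 2 * s)) \<le> K3"
    by (rule power_exp_bound[of "1 / 2" 5]) (simp, rule that)
  define C where "C = Ca * K1 + (1 + K) * K1 + K2 + K3"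
  have Cparts: "0 \<le> Ca * K1" "0 \<le> (1 + K) * K1" "0 \<le> K2" "0 \<le> K3" using Ca K K1 K2 K3 by auto
  show ?thesis
  proof (rule that[of C "max 1 \<Psi>0"])
    show "C \<ge> 0" using Cparts by (simp add: C_def)
    fix \<sigma> u v :: real and \<phi>
    assume s: "1/2 < \<sigma>" "\<sigma> \<le> 3/2" and psi0: "psi \<sigma> \<ge> max 1 \<Psi>0"
      and lim: "Phi \<sigma> (Complex u v / of_real (sqrt (pi * psi \<sigma>))) \<longlonglongrightarrow> \<phi>" and phi1: "norm \<phi> \<le> 1"
    define p where "p = psi \<sigma>"
    have p: "p \<ge> 1" "p \<ge> \<Psi>0" using psi0 by (auto simp: p_def)
    define t where "t = Complex u v / of_real (sqrt (pi * p))"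
    define r where "r = norm t"
    define S where "S = u\<^sup>2 + v\<^sup>2"
    define \<epsilon> where "\<epsilon> = 1 / p ^ 5"
    have sq: "sqrt (pi * p) > 0" using p by simp
    have Ret: "Re t = u / sqrt (pi * p)" by (simp add: t_def)
    have r0: "r \<ge> 0" by (simp add: r_def)
    have S0: "S \<ge> 0" by (simp add: S_def)
    have r2: "r\<^sup>2 = S / (pi * p)"
    proof -
      have "r = sqrt S / sqrt (pi * p)" unfolding r_def t_def norm_divide norm_of_real using p by (simp add: complex_norm S_def)
      then show ?thesis using p S0 by (simp add: power_divide)
    qed
    have Sr: "pi * p * r\<^sup>2 = S" using r2 p by simp
    have pr4: "p * r\<^sup>2 / 4 = S / (4 * pi)" using r2 p by simp
    have r24: "r\<^sup>2 / 4 = S / (4 * pi * p)" using r2 by simp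
    have dd: "damp \<epsilon> u * damp \<epsilon> v = exp (- (\<epsilon>\<^sup>2 * S / 2))"
      unfolding damp_def S_def by (simp add: algebra_simps add_divide_distrib flip: exp_add)
    define P where "P = limit_poly (Re t) (r\<^sup>2 / 4)"
    define g where "g = exp (- (S / (4 * pi)))"
    define X where "X = of_real (exp (- (\<epsilon>\<^sup>2 * S / 2))) * \<phi> - of_real g * (1 + P)"
    have g: "g > 0" by (simp add: g_def)
    have limt: "Phi \<sigma> t \<longlonglongrightarrow> \<phi>" using lim by (simp add: t_def p_def)
    have p3: "p ^ 3 > 0" using p by simp
    have main: "norm X * (1 + S)\<^sup>2 \<le> C / p ^ 3"
    proof (cases "r \<le> 1")
      case True
      have e2: "\<epsilon>\<^sup>2 \<le> 1 / psi \<sigma> ^ 3"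
      proof -
        have "\<epsilon>\<^sup>2 = 1 / p ^ 10" by (simp add: \<epsilon>_def power_divide flip: power_mult)
        also have "\<dots> \<le> 1 / p ^ 3" using p by (intro divide_left_mono power_increasing) auto
        finally show ?thesis by (simp add: p_def)
      qed
      have "norm X \<le> Ca / p ^ 3 * (1 + S) ^ 3 * g"
        using Ca(2)[OF s _ _ limt e2] True p
        unfolding X_def P_def g_def p_def[symmetric] r_def[symmetric] Sr pr4 by simp
      then have "norm X * (1 + S)\<^sup>2 \<le> Ca / p ^ 3 * (1 + S) ^ 3 * g * (1 + S)\<^sup>2"
        by (rule mult_right_mono) simp
      also have "\<dots> = Ca / p ^ 3 * ((1 + S) ^ 5 * g)" by (simp add: power2_eq_square power_numeral_reduce)
      also have "\<dots> \<le> Ca / p ^ 3 * K1"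
        using K1(2)[OF S0] Ca(1) p by (intro mult_left_mono) (auto simp: g_def)
      also have "\<dots> \<le> C / p ^ 3" using Cparts p by (simp add: C_def divide_right_mono)
      finally show ?thesis .
    next
      case False
      then have r1: "r > 1" by simp
      have r61: "1 \<le> r ^ 6" using r1 by (intro one_le_power) auto
      have r6: "r ^ 6 \<le> (1 + S) ^ 3 / p ^ 3"
      proof -
        have "r ^ 6 = (r\<^sup>2) ^ 3" by (simp flip: power_mult)
        also have "\<dots> \<le> ((1 + S) / p) ^ 3"
        proof (intro power_mono)
          have "S \<le> 1 * (1 + S)" by simp
          also have "\<dots> \<le> pi * (1 + S)" using S0 pi_gt3 by (intro mult_right_mono) auto
          finally have "S \<le> pi * (1 + S)" .
          then show "r\<^sup>2 \<le> (1 + S) / p" unfolding r2 using p by (simp add: field_simps)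
        qed simp
        finally show ?thesis by (simp add: power_divide)
      qed
      define D where "D = exp (- (\<epsilon>\<^sup>2 * S / 2)) * norm \<phi>"
      have nX: "norm X \<le> D + g * (1 + norm P)"
      proof -
        have "norm X \<le> norm (of_real (exp (- (\<epsilon>\<^sup>2 * S / 2))) * \<phi>) + norm (of_real g * (1 + P))"
          unfolding X_def by (rule norm_triangle_ineq4)
        also have "\<dots> \<le> D + g * (1 + norm P)"
          unfolding D_def norm_mult norm_of_real using norm_triangle_ineq[of 1 P] g by (intro add_mono mult_mono) auto
        finally show ?thesis .
      qed
      have D2: "g * (1 + norm P) * (1 + S)\<^sup>2 \<le> (1 + K) * K1 / p ^ 3"
      proof -
        have "1 + norm P \<le> r ^ 6 + K * r ^ 6"
          by (rule add_mono[OF r61]) (use K(2)[of t] r1 in \<open>simp add: P_def r_def\<close>)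
        also have "\<dots> = (1 + K) * r ^ 6" by (simp add: algebra_simps)
        also have "\<dots> \<le> (1 + K) * ((1 + S) ^ 3 / p ^ 3)" using r6 K by (intro mult_left_mono) auto
        finally have "g * (1 + norm P) * (1 + S)\<^sup>2 \<le> g * ((1 + K) * ((1 + S) ^ 3 / p ^ 3)) * (1 + S)\<^sup>2"
          using g by (intro mult_right_mono mult_left_mono) auto
        also have "\<dots> = (1 + K) / p ^ 3 * ((1 + S) ^ 5 * g)" by (simp add: power2_eq_square power_numeral_reduce)
        also have "\<dots> \<le> (1 + K) / p ^ 3 * K1" using K1(2)[OF S0] K p by (intro mult_left_mono) (auto simp: g_def)
        finally show ?thesis by simp
      qed
      have D1: "D * (1 + S)\<^sup>2 \<le> (K2 + K3) / p ^ 3"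
      proof (cases "r \<le> p ^ 10")
        case True
        \<comment> \<open>\<open>r \<le> p ^ 10\<close> bounds \<open>8 * (1 + r + r ^ 2)\<close> by
          \<open>24 * p ^ 20\<close>; rounding up costs at most one further
          \<open>p ^ 20\<close>.\<close>
        define Y where "Y = nat \<lceil>24 * p ^ 20\<rceil>"
        have p20: "p ^ 20 \<ge> 1" using p by (intro one_le_power) auto
        have Y: "24 * p ^ 20 \<le> real Y" "real Y \<le> 25 * p ^ 20"
        proof -
          show "24 * p ^ 20 \<le> real Y" unfolding Y_def by (rule real_nat_ceiling_ge)
          have "real Y \<le> 24 * p ^ 20 + 1" unfolding Y_def using p20 by (simp add: of_nat_ceiling) 
          then show "real Y \<le> 25 * p ^ 20" using p20 by linarith
        qed
        have Y1: "Y \<ge> 1" using Y(1) p20 by (cases Y) auto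
        have rY: "8 * (1 + norm t + (norm t)\<^sup>2) \<le> real Y"
        proof -
          have "r\<^sup>2 \<le> (p ^ 10)\<^sup>2" using True r0 by (intro power_mono) auto
          then have a1: "r\<^sup>2 \<le> p ^ 20" by (simp flip: power_mult)
          have "p ^ 10 \<le> p ^ 20" using p by (intro power_increasing) auto
          then have "r \<le> p ^ 20" using True by linarith
          then have "8 * (1 + r + r\<^sup>2) \<le> 8 * (p ^ 20 + p ^ 20 + p ^ 20)"
            using a1 p20 by (intro mult_left_mono add_mono) auto
          then have "8 * (1 + r + r\<^sup>2) \<le> 24 * p ^ 20" by simp
          then show ?thesis using Y(1) by (simp add: r_def)
        qed
        have "ln (real Y) \<le> ln (25 * p ^ 20)" using Y Y1 by (intro ln_mono) auto
        also have "\<dots> = ln 25 + 20 * ln p" using p by (simp add: ln_mult ln_realpow)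
        finally have lnY: "Cd + ln (real Y) \<le> p / 2" using \<Psi>0[OF p(2)] by linarith
        have "norm \<phi> \<le> exp (- (r\<^sup>2 / 8) * (p - Cd - ln (real Y)))"
          using Cd[OF s(1) limt Y1 rY] by (simp add: r_def p_def)
        also have "\<dots> \<le> exp (- (1 / (16 * pi) * S))"
        proof -
          have "r\<^sup>2 / 8 * (p / 2) \<le> r\<^sup>2 / 8 * (p - Cd - ln (real Y))" using lnY by (intro mult_left_mono) auto
          moreover have "r\<^sup>2 / 8 * (p / 2) = 1 / (16 * pi) * S" unfolding r2 using p by simp
          ultimately show ?thesis
            by (simp only: exp_le_cancel_iff minus_mult_left[symmetric] neg_le_iff_le)
        qed
        finally have f: "norm \<phi> \<le> exp (- (1 / (16 * pi) * S))" .
        have "D \<le> 1 * exp (- (1 / (16 * pi) * S))"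
          unfolding D_def by (intro mult_mono f) (use S0 in auto)
        also have "\<dots> \<le> (1 + S) ^ 3 / p ^ 3 * exp (- (1 / (16 * pi) * S))"
          using r6 r61 by (intro mult_right_mono) auto
        finally have "D * (1 + S)\<^sup>2 \<le> (1 + S) ^ 3 / p ^ 3 * exp (- (1 / (16 * pi) * S)) * (1 + S)\<^sup>2"
          by (rule mult_right_mono) simp
        also have "\<dots> = (1 + S) ^ 5 * exp (- (1 / (16 * pi) * S)) / p ^ 3" by (simp add: power2_eq_square power_numeral_reduce)
        also have "\<dots> \<le> K2 / p ^ 3" using K2(2)[OF S0] p3 by (intro divide_right_mono) auto
        also have "\<dots> \<le> (K2 + K3) / p ^ 3" using Cparts p3 by (intro divide_right_mono) auto
        finally show ?thesis .
      next
        case False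
        define w where "w = sqrt S"
        have w0: "w \<ge> 0" using S0 by (simp add: w_def)
        have wS: "w\<^sup>2 = S" using S0 by (simp add: w_def)
        have wp: "p ^ 10 \<le> w"
        proof -
          have "r\<^sup>2 * 1 \<le> r\<^sup>2 * (pi * p)" using p pi_gt3 mult_mono[of 1 pi 1 p] by (intro mult_left_mono) auto
          then have "r\<^sup>2 \<le> w\<^sup>2" unfolding wS using Sr by (simp add: mult_ac)
          then have "r \<le> w" using w0 power2_le_imp_le by blast
          then show ?thesis using False by simp
        qed
        have p10: "p ^ 10 > 0" using p by simp
        \<comment> \<open>Here the width \<open>p powr (- 5)\<close> meets the cutoff
          \<open>p ^ 10\<close>: \<open>\<epsilon> ^ 2 * S\<close> is
          \<open>w * (w / p ^ 10)\<close>. The damping is thus exponential in \<open>w\<close>, the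
          square root of \<open>S\<close>, and the last constant \<open>K3\<close> is applied to
          \<open>w\<close>, where \<open>1 + S \<le> (1 + w) ^ 2\<close>.\<close>
        have e: "w \<le> \<epsilon>\<^sup>2 * S"
        proof -
          have "\<epsilon>\<^sup>2 * S = w * (w / p ^ 10)" unfolding wS[symmetric] by (simp add: \<epsilon>_def power_divide power2_eq_square flip: power_add)
          moreover have "w * 1 \<le> w * (w / p ^ 10)" using wp p10 w0 by (intro mult_left_mono) auto
          ultimately show ?thesis by simp
        qed
        have "p ^ 3 \<le> p ^ 10" using p by (intro power_increasing) auto
        then have wp3: "1 \<le> (1 + w) / p ^ 3" using wp p3 by simp
        have "D \<le> exp (- (1 / 2 * w)) * 1"
          unfolding D_def using e phi1 by (intro mult_mono) auto
        also have "\<dots> \<le> exp (- (1 / 2 * w)) * ((1 + w) / p ^ 3)" using wp3 by (intro mult_left_mono) auto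
        finally have "D * (1 + S)\<^sup>2 \<le> exp (- (1 / 2 * w)) * ((1 + w) / p ^ 3) * (1 + S)\<^sup>2"
          by (rule mult_right_mono) simp
        also have "\<dots> \<le> exp (- (1 / 2 * w)) * ((1 + w) / p ^ 3) * ((1 + w)\<^sup>2)\<^sup>2"
        proof (intro mult_left_mono power_mono)
          show "1 + S \<le> (1 + w)\<^sup>2" unfolding wS[symmetric] using w0 by (simp add: power2_eq_square algebra_simps)
        qed (use S0 w0 p3 in auto)
        also have "\<dots> = (1 + w) ^ 5 * exp (- (1 / 2 * w)) / p ^ 3" by (simp add: power2_eq_square power_numeral_reduce)
        also have "\<dots> \<le> K3 / p ^ 3" using K3(2)[OF w0] p3 by (intro divide_right_mono) auto
        also have "\<dots> \<le> (K2 + K3) / p ^ 3" using Cparts p3 by (intro divide_right_mono) auto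
        finally show ?thesis .
      qed
      have "norm X * (1 + S)\<^sup>2 \<le> (D + g * (1 + norm P)) * (1 + S)\<^sup>2" using nX by (intro mult_right_mono) auto
      also have "\<dots> = D * (1 + S)\<^sup>2 + g * (1 + norm P) * (1 + S)\<^sup>2" by (simp add: algebra_simps)
      also have "\<dots> \<le> (K2 + K3) / p ^ 3 + (1 + K) * K1 / p ^ 3" by (rule add_mono[OF D1 D2])
      also have "\<dots> \<le> C / p ^ 3"
        using Cparts p3 unfolding add_divide_distrib[symmetric] by (intro divide_right_mono) (auto simp: C_def)
      finally show ?thesis .
    qed
    have uv: "(1 + u\<^sup>2) * (1 + v\<^sup>2) \<le> (1 + S)\<^sup>2"
    proof -
      have "(1 + u\<^sup>2) * (1 + v\<^sup>2) \<le> (1 + S) * (1 + S)" unfolding S_def by (intro mult_mono) auto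
      then show ?thesis by (simp add: power2_eq_square)
    qed
    have pos: "0 < (1 + u\<^sup>2) * (1 + v\<^sup>2)" by (intro mult_pos_pos add_pos_nonneg) auto
    have "norm X * ((1 + u\<^sup>2) * (1 + v\<^sup>2)) \<le> C / p ^ 3"
      using mult_left_mono[OF uv norm_ge_zero[of X]] main by linarith
    then have "norm X \<le> C / p ^ 3 / ((1 + u\<^sup>2) * (1 + v\<^sup>2))"
      by (simp only: pos_le_divide_eq[OF pos])
    also have "\<dots> = C / p ^ 3 * (inverse (1 + u\<^sup>2) * inverse (1 + v\<^sup>2))"
      by (simp only: divide_inverse inverse_mult_distrib)
    finally show "norm (of_real (damp (1 / psi \<sigma> ^ 5) u * damp (1 / psi \<sigma> ^ 5) v) * \<phi>
      - of_real (exp (- ((u\<^sup>2 + v\<^sup>2) / (4 * pi)))) * (1 + limit_poly (u / sqrt (pi * psi \<sigma>)) ((u\<^sup>2 + v\<^sup>2) / (4 * pi * psi \<sigma>))))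
      \<le> C / psi \<sigma> ^ 3 * (inverse (1 + u\<^sup>2) * inverse (1 + v\<^sup>2))"
      unfolding p_def[symmetric] \<epsilon>_def[symmetric] dd X_def P_def g_def Ret r24 S_def .
  qed simp
qed

section \<open>The polynomials of the expansion and the limiting density\<close>

text \<open>The coefficient of \<open>(\<i> * u) ^ (k - j) * (\<i> * v) ^ j\<close>, obtained by
  inserting \<open>b = (u ^ 2 + v ^ 2) / 4\<close> into \<open>limit_poly\<close>. Powers of
  \<open>\<i> * u\<close> and \<open>\<i> * v\<close>, rather than of \<open>u\<close> and
  \<open>v\<close>, make all coefficients real and match the Fourier integrals of Hermite functions;
  they cause the sign for \<open>k = 3\<close>. The power of \<open>1 / sqrt pi\<close> comes from
  the normalisation by \<open>sqrt (pi * psi)\<close>.\<close>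

definition edge_coef :: "nat \<Rightarrow> nat \<Rightarrow> real" where
  "edge_coef k j = (1 / sqrt pi) ^ k *
    (if k = 0 \<and> j = 0 then 1
     else if k = 3 \<and> (j = 0 \<or> j = 2) then - edge_const cf1 / 4
     else if k = 4 \<and> j = 0 then edge_const cf2 / 4 + edge_const cf3 / 16
     else if k = 4 \<and> j = 2 then edge_const cf2 / 4 + edge_const cf3 / 8
     else if k = 4 \<and> j = 4 then edge_const cf3 / 16
     else if k = 5 \<and> j = 0 then edge_const cf4 / 4 + edge_const cf5 / 16
     else if k = 5 \<and> j = 2 then edge_const cf4 / 4 + edge_const cf5 / 8
     else if k = 5 \<and> j = 4 then edge_const cf5 / 16
     else 0)"

lemma limit_poly_expansion:
  assumes p: "p > 0"
  shows "1 + limit_poly (u / sqrt (pi * p)) ((u\<^sup>2 + v\<^sup>2) / (4 * pi * p)) =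
    (\<Sum>k\<le>5. of_real (1 / sqrt p ^ k) * (\<Sum>j\<le>k. of_real (edge_coef k j) * ((\<i> * of_real u) ^ (k - j) * (\<i> * of_real v) ^ j)))"
proof -
  define s where "s = 1 / sqrt pi"
  define z where "z = 1 / sqrt p"
  have 1: "u / sqrt (pi * p) = u * (s * z)" by (simp add: s_def z_def real_sqrt_mult)
  have s2: "s\<^sup>2 = 1 / pi" by (simp add: s_def power_divide)
  have z2: "z\<^sup>2 = 1 / p" using p by (simp add: z_def power_divide)
  have 2: "(u\<^sup>2 + v\<^sup>2) / (4 * pi * p) = (u\<^sup>2 + v\<^sup>2) / 4 * (s * z)\<^sup>2"
    unfolding power_mult_distrib s2 z2 by simp
  have zk: "1 / sqrt p ^ k = z ^ k" for k by (simp add: z_def power_divide)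
  have ip: "(\<i> * of_real w)\<^sup>2 = - (of_real w)\<^sup>2" "(\<i> * of_real w) ^ 3 = - \<i> * of_real w ^ 3" "(\<i> * of_real w) ^ 4 = of_real w ^ 4"
    "(\<i> * of_real w) ^ 5 = \<i> * of_real w ^ 5" for w
  proof -
    have i: "\<i> ^ 3 = - \<i>" "\<i> ^ 4 = 1" by (simp_all add: power3_eq_cube power4_eq_xxxx)
    then have i5: "\<i> ^ 5 = \<i>" using power_add[of \<i> 4 1] by simp
    show "(\<i> * of_real w)\<^sup>2 = - (of_real w)\<^sup>2" "(\<i> * of_real w) ^ 3 = - \<i> * of_real w ^ 3" "(\<i> * of_real w) ^ 4 = of_real w ^ 4"
      "(\<i> * of_real w) ^ 5 = \<i> * of_real w ^ 5"
      unfolding power_mult_distrib i i5 by simp_all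
  qed
  have "(\<Sum>k\<le>5. of_real (z ^ k) * (\<Sum>j\<le>k. of_real (edge_coef k j) * ((\<i> * of_real u) ^ (k - j) * (\<i> * of_real v) ^ j)))
    = 1 + of_real (z ^ 3 * (s ^ 3 * (- edge_const cf1 / 4))) * ((\<i> * of_real u) ^ 3 + (\<i> * of_real u) * (\<i> * of_real v)\<^sup>2)
      + of_real (z ^ 4) * (of_real (s ^ 4 * (edge_const cf2 / 4 + edge_const cf3 / 16)) * (\<i> * of_real u) ^ 4
         + of_real (s ^ 4 * (edge_const cf2 / 4 + edge_const cf3 / 8)) * ((\<i> * of_real u)\<^sup>2 * (\<i> * of_real v)\<^sup>2)
         + of_real (s ^ 4 * (edge_const cf3 / 16)) * (\<i> * of_real v) ^ 4)
      + of_real (z ^ 5) * (of_real (s ^ 5 * (edge_const cf4 / 4 + edge_const cf5 / 16)) * (\<i> * of_real u) ^ 5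
         + of_real (s ^ 5 * (edge_const cf4 / 4 + edge_const cf5 / 8)) * ((\<i> * of_real u) ^ 3 * (\<i> * of_real v)\<^sup>2)
         + of_real (s ^ 5 * (edge_const cf5 / 16)) * ((\<i> * of_real u) * (\<i> * of_real v) ^ 4))"
    unfolding edge_coef_def s_def[symmetric]
    by (simp add: numeral_eq_Suc algebra_simps del: power_Suc)
  also have "\<dots> = 1 + limit_poly (u * (s * z)) ((u\<^sup>2 + v\<^sup>2) / 4 * (s * z)\<^sup>2)"
    unfolding limit_poly_def edge_poly_def ip
    by (simp add: field_simps power2_eq_square power_numeral_reduce)
  finally show ?thesis unfolding 1 2 zk by simp
qed

definition herm_gauss :: "nat \<Rightarrow> real \<Rightarrow> real" where
  "herm_gauss m x = poly (herm m) x * exp (- (pi * x\<^sup>2))"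

text \<open>A Fourier integral is at most the integral of the modulus, which gives a bound uniform
  in \<open>x\<close> without estimating the polynomial.\<close>

lemma herm_gauss_bound: "\<bar>herm_gauss m x\<bar> \<le> (\<integral>w. gauss w * \<bar>w - 0\<bar> ^ m \<partial>lborel)"
proof -
  have "\<bar>herm_gauss m x\<bar> = norm (gauss_int m x)" by (simp add: gauss_int_eq herm_gauss_def norm_of_real del: of_real_mult)
  also have "\<dots> \<le> (\<integral>w. norm (gauss_term m x w) \<partial>lborel)" unfolding gauss_int_def by (rule integral_norm_bound)
  also have "\<dots> = (\<integral>w. gauss w * \<bar>w - 0\<bar> ^ m \<partial>lborel)" by (simp add: gauss_term_def norm_mult norm_power)
  finally show ?thesis .
qed

text \<open>A sum of tensor products \<open>herm (k - j)\<close> in \<open>x\<close> times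
  \<open>herm j\<close> in \<open>y\<close>: mapping over the coefficients of the outer polynomial
  in \<open>y\<close> replaces each number by that multiple of a polynomial in \<open>x\<close>. The
  total degree is then visibly at most \<open>(k - j) + j\<close>.\<close>

definition edge_g :: "nat \<Rightarrow> real poly poly" where
  "edge_g k = (\<Sum>j\<le>k. map_poly (\<lambda>c. smult (edge_coef k j * c) (herm (k - j))) (herm j))"

lemma poly_poly_map_poly:
  "poly (poly (map_poly (\<lambda>c. smult (h * c) r) p) [:y:]) x = h * poly p y * poly r x" for h x y :: real
  by (induction p) (simp_all add: map_poly_pCons algebra_simps)

lemma eval2_edge_g:
  "eval2 (edge_g k) x y * exp (- pi * (x\<^sup>2 + y\<^sup>2)) = (\<Sum>j\<le>k. edge_coef k j * (herm_gauss (k - j) x * herm_gauss j y))"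
proof -
  have e: "exp (- pi * (x\<^sup>2 + y\<^sup>2)) = exp (- (pi * x\<^sup>2)) * exp (- (pi * y\<^sup>2))"
    by (simp add: algebra_simps flip: exp_add)
  have "eval2 (edge_g k) x y = (\<Sum>j\<le>k. edge_coef k j * poly (herm j) y * poly (herm (k - j)) x)"
    unfolding eval2_def edge_g_def poly_sum poly_poly_map_poly ..
  then show ?thesis unfolding e herm_gauss_def by (simp add: sum_distrib_left sum_distrib_right mult_ac)
qed

lemma edge_g_0: "edge_g 0 = 1"
proof -
  have "edge_g 0 = map_poly (\<lambda>c. smult c 1) 1" by (simp add: edge_g_def edge_coef_def)
  also have "\<dots> = 1" unfolding one_pCons by (simp add: map_poly_pCons)
  finally show ?thesis .
qed

lemma total_degree_edge_g: "total_degree_le (edge_g k) k"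
  unfolding total_degree_le_def
proof (intro allI impI)
  fix i j' assume nz: "coeff (coeff (edge_g k) j') i \<noteq> 0"
  have "coeff (coeff (edge_g k) j') i = (\<Sum>j\<le>k. edge_coef k j * coeff (herm j) j' * coeff (herm (k - j)) i)"
    unfolding edge_g_def by (simp add: coeff_sum coeff_map_poly)
  with nz obtain j where j: "j \<le> k" "edge_coef k j * coeff (herm j) j' * coeff (herm (k - j)) i \<noteq> 0"
    using sum.neutral by (metis (no_types, lifting) atMost_iff)
  then have "j' \<le> degree (herm j)" "i \<le> degree (herm (k - j))" by (auto intro: le_degree)
  then have "j' \<le> j" "i \<le> k - j" using degree_herm order_trans by blast+
  then show "i + j' \<le> k" using j(1) by linarith
qed

definition edge_density :: "real \<Rightarrow> real \<Rightarrow> real \<Rightarrow> real" where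
  "edge_density p x y = (\<Sum>k\<le>5. 1 / sqrt p ^ k * (\<Sum>j\<le>k. edge_coef k j * (herm_gauss (k - j) x * herm_gauss j y)))"

text \<open>The integrand of the Fourier inversion of \<open>edge_density\<close>, kept as a finite
  sum of products of one-variable terms so that the double integral separates. That it is the
  oscillating factor times the approximant of \<open>char_approx\<close> is
  \<open>edge_kernel_eq\<close>.\<close>

definition edge_kernel :: "real \<Rightarrow> real \<Rightarrow> real \<Rightarrow> real \<Rightarrow> real \<Rightarrow> complex" where
  "edge_kernel p x y u v = (\<Sum>k\<le>5. \<Sum>j\<le>k. of_real (4 * pi\<^sup>2 * (1 / sqrt p ^ k * edge_coef k j)) * (gauss_term (k - j) x u * gauss_term j y v))"

lemma edge_kernel_eq:
  assumes "p > 0"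
  shows "edge_kernel p x y u v = cis (- (u * x + v * y)) *
    (of_real (exp (- ((u\<^sup>2 + v\<^sup>2) / (4 * pi)))) * (1 + limit_poly (u / sqrt (pi * p)) ((u\<^sup>2 + v\<^sup>2) / (4 * pi * p))))"
proof -
  have g: "4 * pi\<^sup>2 * (gauss u * gauss v) = exp (- ((u\<^sup>2 + v\<^sup>2) / (4 * pi)))"
    unfolding gauss_eq by (simp add: power2_eq_square add_divide_distrib flip: exp_add)
  have c: "cis (- (u * x + v * y)) = cis (- (u * x)) * cis (- (v * y))" by (simp add: cis_mult)
  show ?thesis
    unfolding limit_poly_expansion[OF assms] edge_kernel_def g[symmetric] c gauss_term_def
    by (simp add: sum_distrib_left scaleR_conv_of_real mult_ac)
qed

lemma edge_kernel_integral:
  "integrable lborel (\<lambda>u. edge_kernel p x y u v)"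
  "(\<integral>u. edge_kernel p x y u v \<partial>lborel) = (\<Sum>k\<le>5. \<Sum>j\<le>k. of_real (4 * pi\<^sup>2 * (1 / sqrt p ^ k * edge_coef k j)) * (gauss_int (k - j) x * gauss_term j y v))"
  "integrable lborel (\<lambda>v. \<integral>u. edge_kernel p x y u v \<partial>lborel)"
  "(\<integral>v. (\<integral>u. edge_kernel p x y u v \<partial>lborel) \<partial>lborel) = of_real (4 * pi\<^sup>2 * edge_density p x y)"
proof -
  have i: "integrable lborel (\<lambda>u. c * (gauss_term a x u * d))" for c d a
    using integrable_gauss_term by (intro integrable_mult_right integrable_mult_left) auto
  have i': "integrable lborel (\<lambda>v. c * (d * gauss_term a y v))" for c d a
    using integrable_gauss_term by (intro integrable_mult_right) auto
  show "integrable lborel (\<lambda>u. edge_kernel p x y u v)" for v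
    unfolding edge_kernel_def by (intro Bochner_Integration.integrable_sum i)
  show e: "(\<integral>u. edge_kernel p x y u v \<partial>lborel) = (\<Sum>k\<le>5. \<Sum>j\<le>k. of_real (4 * pi\<^sup>2 * (1 / sqrt p ^ k * edge_coef k j)) * (gauss_int (k - j) x * gauss_term j y v))" for v
    unfolding edge_kernel_def
    by (subst Bochner_Integration.integral_sum, intro Bochner_Integration.integrable_sum i,
        subst Bochner_Integration.integral_sum, rule i) (simp add: gauss_int_def)
  show "integrable lborel (\<lambda>v. \<integral>u. edge_kernel p x y u v \<partial>lborel)"
    unfolding e by (intro Bochner_Integration.integrable_sum i')
  have "(\<integral>v. (\<integral>u. edge_kernel p x y u v \<partial>lborel) \<partial>lborel)
    = (\<Sum>k\<le>5. \<Sum>j\<le>k. of_real (4 * pi\<^sup>2 * (1 / sqrt p ^ k * edge_coef k j)) * (gauss_int (k - j) x * gauss_int j y))"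
    unfolding e
    by (subst Bochner_Integration.integral_sum, intro Bochner_Integration.integrable_sum i',
        subst Bochner_Integration.integral_sum, rule i') (simp add: gauss_int_def)
  also have "\<dots> = of_real (4 * pi\<^sup>2 * edge_density p x y)"
    unfolding edge_density_def gauss_int_eq herm_gauss_def[symmetric]
    by (simp add: sum_distrib_left mult_ac)
  finally show "(\<integral>v. (\<integral>u. edge_kernel p x y u v \<partial>lborel) \<partial>lborel) = of_real (4 * pi\<^sup>2 * edge_density p x y)" .
qed

lemma edge_density_bound:
  obtains Q where "Q \<ge> 0" "\<And>p x y. p \<ge> 1 \<Longrightarrow> \<bar>edge_density p x y\<bar> \<le> Q"
proof -
  define A where "A m = (\<integral>w. gauss w * \<bar>w - 0\<bar> ^ m \<partial>lborel)" for m
  define Q where "Q = (\<Sum>k\<le>5. \<Sum>j\<le>k. \<bar>edge_coef k j\<bar> * (A (k - j) * A j))"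
  have A: "\<bar>herm_gauss m x\<bar> \<le> A m" "0 \<le> A m" for m x
    using herm_gauss_bound[of m x] by (auto simp: A_def)
  have b: "\<bar>edge_density p x y\<bar> \<le> Q" if p: "p \<ge> 1" for p x y
    unfolding edge_density_def Q_def
  proof (rule order_trans[OF sum_abs sum_mono])
    fix k :: nat
    have "\<bar>1 / sqrt p ^ k * (\<Sum>j\<le>k. edge_coef k j * (herm_gauss (k - j) x * herm_gauss j y))\<bar>
      \<le> 1 * (\<Sum>j\<le>k. \<bar>edge_coef k j\<bar> * (A (k - j) * A j))"
      unfolding abs_mult
    proof (intro mult_mono)
      have "1 \<le> sqrt p ^ k" using p by (intro one_le_power) simp
      then show "\<bar>1 / sqrt p ^ k\<bar> \<le> 1" using p by simp
      show "\<bar>\<Sum>j\<le>k. edge_coef k j * (herm_gauss (k - j) x * herm_gauss j y)\<bar> \<le> (\<Sum>j\<le>k. \<bar>edge_coef k j\<bar> * (A (k - j) * A j))"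
        by (rule order_trans[OF sum_abs sum_mono]) (auto simp: abs_mult intro!: mult_left_mono mult_mono A)
    qed auto
    then show "\<bar>1 / sqrt p ^ k * (\<Sum>j\<le>k. edge_coef k j * (herm_gauss (k - j) x * herm_gauss j y))\<bar>
      \<le> (\<Sum>j\<le>k. \<bar>edge_coef k j\<bar> * (A (k - j) * A j))" by simp
  qed
  have "0 \<le> Q" using b[of 1 0 0] by linarith
  then show ?thesis by (rule that) (rule b)
qed

lemma herm_gauss_continuous: "continuous_on S (\<lambda>z. herm_gauss m (f z))" if "continuous_on S f"
  unfolding herm_gauss_def by (intro continuous_intros that)

lemma edge_term_continuous: "continuous_on S (\<lambda>(y, x). \<Sum>j\<le>k. edge_coef k j * (herm_gauss (k - j) x * herm_gauss j y))"
  unfolding split_beta by (intro continuous_intros herm_gauss_continuous)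

lemma edge_density_continuous: "continuous_on S (\<lambda>(y, x). edge_density p x y)"
  unfolding edge_density_def split_beta by (intro continuous_intros herm_gauss_continuous)

lemma edge_density_integral:
  fixes a b c d :: real
  shows "integral {c..d} (\<lambda>y. integral {a..b} (\<lambda>x. edge_density p x y)) =
   (\<Sum>k\<le>5. 1 / sqrt p ^ k * integral {c..d} (\<lambda>y. integral {a..b} (\<lambda>x. eval2 (edge_g k) x y * exp (- pi * (x\<^sup>2 + y\<^sup>2)))))"
proof -
  define G where "G k x y = (\<Sum>j\<le>k. edge_coef k j * (herm_gauss (k - j) x * herm_gauss j y))" for k x y
  have i1: "(\<lambda>x. G k x y) integrable_on {a..b}" for k y
    unfolding G_def by (intro integrable_continuous_interval continuous_intros herm_gauss_continuous)
  have c2: "continuous_on UNIV (\<lambda>y. integral (cbox a b) (\<lambda>x. G k x y))" for k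
    by (rule integral_continuous_on_param) (use edge_term_continuous in \<open>auto simp: G_def\<close>)
  have i2: "(\<lambda>y. integral {a..b} (\<lambda>x. G k x y)) integrable_on {c..d}" for k
    using c2[of k] by (intro integrable_continuous_interval) (auto intro: continuous_on_subset)
  have e: "integral {a..b} (\<lambda>x. edge_density p x y) = (\<Sum>k\<le>5. 1 / sqrt p ^ k * integral {a..b} (\<lambda>x. G k x y))" for y
    unfolding edge_density_def G_def[symmetric]
    by (subst Henstock_Kurzweil_Integration.integral_sum)
       (auto intro!: integrable_on_mult_right i1 simp del: times_divide_eq_left)
  show ?thesis
    unfolding e eval2_edge_g G_def[symmetric]
    by (subst Henstock_Kurzweil_Integration.integral_sum)
       (auto intro!: integrable_on_mult_right i2 simp del: times_divide_eq_left)
qed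


section \<open>Rectangle probabilities in terms of psi\<close>

context random_primes
begin

text \<open>Smoothing with \<open>\<epsilon> = 1 / psi ^ 5\<close> and
  \<open>\<delta> = 1 / psi ^ 3\<close>: the density error and the boundary strips both cost
  \<open>psi powr (- 3)\<close>, and \<open>\<epsilon> ^ 2 / \<delta> ^ 2 = psi powr (- 4)\<close>.
  The thresholds \<open>2 / (b - a)\<close> and \<open>2 / (d - c)\<close> leave room to shrink the
  rectangle by \<delta> on each side.\<close>

lemma edge_estimate_large:
  assumes ab: "a < b" "c < d"
  obtains C \<Psi> where "C \<ge> 0" "\<Psi> \<ge> 1" "\<And>\<sigma>. 1/2 < \<sigma> \<Longrightarrow> \<sigma> \<le> 3/2 \<Longrightarrow> psi \<sigma> \<ge> \<Psi> \<Longrightarrow>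
    \<bar>measure M {\<omega>\<in>space M. Re (log_zeta_X \<sigma> \<omega> / of_real (sqrt (pi * psi \<sigma>))) \<in> {a..b} \<and>
        Im (log_zeta_X \<sigma> \<omega> / of_real (sqrt (pi * psi \<sigma>))) \<in> {c..d}}
      - integral {c..d} (\<lambda>y. integral {a..b} (\<lambda>x. edge_density (psi \<sigma>) x y))\<bar> \<le> C / psi \<sigma> ^ 3"
proof -
  obtain C \<Psi> where C: "C \<ge> 0" "\<Psi> \<ge> 1" "\<And>\<sigma> u v \<phi>. 1/2 < \<sigma> \<Longrightarrow> \<sigma> \<le> 3/2 \<Longrightarrow> psi \<sigma> \<ge> \<Psi> \<Longrightarrow>
    Phi \<sigma> (Complex u v / of_real (sqrt (pi * psi \<sigma>))) \<longlonglongrightarrow> \<phi> \<Longrightarrow> norm \<phi> \<le> 1 \<Longrightarrow>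
    norm (of_real (damp (1 / psi \<sigma> ^ 5) u * damp (1 / psi \<sigma> ^ 5) v) * \<phi>
      - of_real (exp (- ((u\<^sup>2 + v\<^sup>2) / (4 * pi)))) * (1 + limit_poly (u / sqrt (pi * psi \<sigma>)) ((u\<^sup>2 + v\<^sup>2) / (4 * pi * psi \<sigma>))))
    \<le> C / psi \<sigma> ^ 3 * (inverse (1 + u\<^sup>2) * inverse (1 + v\<^sup>2))"
    by (rule char_approx) (rule that)
  obtain Q where Q: "Q \<ge> 0" "\<And>p x y. p \<ge> 1 \<Longrightarrow> \<bar>edge_density p x y\<bar> \<le> Q"
    by (rule edge_density_bound) (rule that)
  define L where "L = (b - a + 2) + (d - c + 2)"
  have L: "L > 0" using ab by (simp add: L_def)
  define D where "D = C * (b - a + 2) * (d - c + 2) + 2 * Q * L + 2"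
  show ?thesis
  proof (rule that[of D "max \<Psi> (max (2 / (b - a)) (2 / (d - c)))"])
    show "D \<ge> 0" using C Q L ab by (simp add: D_def)
    fix \<sigma> :: real
    assume s: "1/2 < \<sigma>" "\<sigma> \<le> 3/2" and psi0: "psi \<sigma> \<ge> max \<Psi> (max (2 / (b - a)) (2 / (d - c)))"
    define p where "p = psi \<sigma>"
    have p: "p \<ge> \<Psi>" "p \<ge> 1" "p \<ge> 2 / (b - a)" "p \<ge> 2 / (d - c)" using psi0 C(2) by (auto simp: p_def)
    define Z where "Z \<omega> = log_zeta_X \<sigma> \<omega> / of_real (sqrt (pi * p))" for \<omega>
    have Zm [measurable]: "Z \<in> borel_measurable M" unfolding Z_def[abs_def] by measurable
    have p3: "p ^ 3 \<ge> p" using p(2) power_increasing[of 1 3 p] by simp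
    have charZ: "Phi \<sigma> (Complex u v / of_real (sqrt (pi * p))) \<longlonglongrightarrow> charf Z u v" for u v
    proof -
      have "Re (cnj (Complex u v / of_real (sqrt (pi * p))) * L) = u * Re (L / of_real (sqrt (pi * p))) + v * Im (L / of_real (sqrt (pi * p)))" for L
        by (simp add: add_divide_distrib)
      then show ?thesis
        using char_log_zeta_X[OF s(1), of "Complex u v / of_real (sqrt (pi * p))"] unfolding charf_def Z_def by simp
    qed
    have dens: "\<bar>smooth_density (1 / p ^ 5) Z x y - edge_density p x y\<bar> \<le> C / p ^ 3" for x y
    proof (rule smooth_density_approx[OF Zm _ edge_kernel_integral(4)[symmetric] edge_kernel_integral(1) edge_kernel_integral(3)])
      show "1 / p ^ 5 > 0" using p by simp
      fix u v
      define E where "E = of_real (damp (1 / p ^ 5) u * damp (1 / p ^ 5) v) * charf Z u v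
        - of_real (exp (- ((u\<^sup>2 + v\<^sup>2) / (4 * pi)))) * (1 + limit_poly (u / sqrt (pi * p)) ((u\<^sup>2 + v\<^sup>2) / (4 * pi * p)))"
      have "of_real (damp (1 / p ^ 5) u * damp (1 / p ^ 5) v) * (cis (- (u * x + v * y)) * charf Z u v) - edge_kernel p x y u v
        = cis (- (u * x + v * y)) * E"
        unfolding edge_kernel_eq[OF less_le_trans[OF zero_less_one p(2)]] E_def by (simp only: right_diff_distrib mult.left_commute)
      also have "norm \<dots> = norm E" by (simp add: norm_mult)
      also have "norm E \<le> C / p ^ 3 * (inverse (1 + u\<^sup>2) * inverse (1 + v\<^sup>2))"
        unfolding E_def p_def by (rule C(3)[OF s p(1)[unfolded p_def] charZ[unfolded p_def] norm_charf_le_1])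
      finally show "norm (of_real (damp (1 / p ^ 5) u * damp (1 / p ^ 5) v) * (cis (- (u * x + v * y)) * charf Z u v) - edge_kernel p x y u v)
        \<le> C / p ^ 3 * (inverse (1 + u\<^sup>2) * inverse (1 + v\<^sup>2))" .
    qed
    have d2: "2 * (1 / p ^ 3) \<le> w" if "w > 0" "p \<ge> 2 / w" for w
    proof -
      have "2 / w \<le> p ^ 3" using that p3 by linarith
      then have "2 \<le> p ^ 3 * w" using that by (simp add: pos_divide_le_eq)
      moreover have "p ^ 3 > 0" using p by simp
      ultimately show ?thesis by (simp add: pos_divide_le_eq mult.commute)
    qed
    have "\<bar>measure M {\<omega>\<in>space M. Re (Z \<omega>) \<in> {a..b} \<and> Im (Z \<omega>) \<in> {c..d}}
      - integral {c..d} (\<lambda>y. integral {a..b} (\<lambda>x. edge_density p x y))\<bar>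
      \<le> C / p ^ 3 * (b - a + 2) * (d - c + 2) + 2 * (1 / p ^ 3) * Q * L + 2 * ((1 / p ^ 5)\<^sup>2 / (1 / p ^ 3)\<^sup>2)"
      unfolding L_def
    proof (rule smoothing_inequality[OF Zm _ _ _ _ _ edge_density_continuous _ dens])
      show "1 / p ^ 3 \<le> 1" using p p3 by simp
      show "2 * (1 / p ^ 3) \<le> b - a" "2 * (1 / p ^ 3) \<le> d - c" using p ab by (auto intro!: d2 simp del: times_divide_eq_right)
    qed (use p Q(2)[OF p(2)] in auto)
    also have "(1 / p ^ 5)\<^sup>2 / (1 / p ^ 3)\<^sup>2 \<le> 1 / p ^ 3"
    proof -
      have "(1 / p ^ 5)\<^sup>2 / (1 / p ^ 3)\<^sup>2 = p ^ 6 / p ^ 10" by (simp add: power_divide flip: power_mult)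
      also have "\<dots> = 1 / p ^ 4" using p by (simp add: field_simps flip: power_add)
      also have "\<dots> \<le> 1 / p ^ 3" using p by (intro divide_left_mono power_increasing) auto
      finally show ?thesis .
    qed
    also have "C / p ^ 3 * (b - a + 2) * (d - c + 2) + 2 * (1 / p ^ 3) * Q * L + 2 * (1 / p ^ 3) = D / p ^ 3"
      by (simp add: D_def add_divide_distrib)
    finally show "\<bar>measure M {\<omega>\<in>space M. Re (log_zeta_X \<sigma> \<omega> / of_real (sqrt (pi * psi \<sigma>))) \<in> {a..b} \<and>
        Im (log_zeta_X \<sigma> \<omega> / of_real (sqrt (pi * psi \<sigma>))) \<in> {c..d}}
      - integral {c..d} (\<lambda>y. integral {a..b} (\<lambda>x. edge_density (psi \<sigma>) x y))\<bar> \<le> D / psi \<sigma> ^ 3"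
      unfolding Z_def p_def by simp
  qed (use C in auto)
qed

text \<open>For \<open>psi\<close> below the threshold \<Psi> nothing is to be proved beyond
  boundedness: both sides are at most a constant \<open>B\<close>, and
  \<open>B \<le> B * \<Psi> ^ 3 / psi ^ 3\<close>.\<close>

theorem edge_estimate:
  assumes ab: "a < b" "c < d"
  obtains C where "C \<ge> 0" "\<And>\<sigma>. 1/2 < \<sigma> \<Longrightarrow> \<sigma> \<le> 3/2 \<Longrightarrow>
    \<bar>measure M {\<omega>\<in>space M. Re (log_zeta_X \<sigma> \<omega> / of_real (sqrt (pi * psi \<sigma>))) \<in> {a..b} \<and>
        Im (log_zeta_X \<sigma> \<omega> / of_real (sqrt (pi * psi \<sigma>))) \<in> {c..d}}
      - (\<Sum>k\<le>5. 1 / sqrt (psi \<sigma>) ^ k * integral {c..d} (\<lambda>y. integral {a..b} (\<lambda>x.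
           eval2 (edge_g k) x y * exp (- pi * (x\<^sup>2 + y\<^sup>2)))))\<bar> \<le> C / psi \<sigma> ^ 3"
proof -
  obtain C \<Psi> where C: "C \<ge> 0" "\<Psi> \<ge> 1" "\<And>\<sigma>. 1/2 < \<sigma> \<Longrightarrow> \<sigma> \<le> 3/2 \<Longrightarrow> psi \<sigma> \<ge> \<Psi> \<Longrightarrow>
    \<bar>measure M {\<omega>\<in>space M. Re (log_zeta_X \<sigma> \<omega> / of_real (sqrt (pi * psi \<sigma>))) \<in> {a..b} \<and>
        Im (log_zeta_X \<sigma> \<omega> / of_real (sqrt (pi * psi \<sigma>))) \<in> {c..d}}
      - integral {c..d} (\<lambda>y. integral {a..b} (\<lambda>x. edge_density (psi \<sigma>) x y))\<bar> \<le> C / psi \<sigma> ^ 3"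
    by (rule edge_estimate_large[OF ab]) (rule that)
  define I where "I k = integral {c..d} (\<lambda>y. integral {a..b} (\<lambda>x. eval2 (edge_g k) x y * exp (- pi * (x\<^sup>2 + y\<^sup>2))))" for k
  define B where "B = 1 + (\<Sum>k\<le>5. 3 ^ k * \<bar>I k\<bar>)"
  have B: "B \<ge> 0" unfolding B_def by (intro add_nonneg_nonneg sum_nonneg) auto
  show ?thesis
  proof (rule that[of "C + B * \<Psi> ^ 3"])
    show "0 \<le> C + B * \<Psi> ^ 3" using C B by simp
    fix \<sigma> :: real assume s: "1/2 < \<sigma>" "\<sigma> \<le> 3/2"
    define p where "p = psi \<sigma>"
    define P where "P = measure M {\<omega>\<in>space M. Re (log_zeta_X \<sigma> \<omega> / of_real (sqrt (pi * psi \<sigma>))) \<in> {a..b} \<and>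
        Im (log_zeta_X \<sigma> \<omega> / of_real (sqrt (pi * psi \<sigma>))) \<in> {c..d}}"
    have p8: "p \<ge> 1/8" using psi_ge[OF s] by (simp add: p_def)
    then have p3: "p ^ 3 > 0" by simp
    have "\<bar>P - (\<Sum>k\<le>5. 1 / sqrt p ^ k * I k)\<bar> \<le> (C + B * \<Psi> ^ 3) / p ^ 3"
    proof (cases "p \<ge> \<Psi>")
      case True
      have "\<bar>P - (\<Sum>k\<le>5. 1 / sqrt p ^ k * I k)\<bar> \<le> C / p ^ 3"
        using C(3)[OF s] True unfolding P_def p_def I_def edge_density_integral by simp
      also have "\<dots> \<le> (C + B * \<Psi> ^ 3) / p ^ 3" using C B p3 by (intro divide_right_mono) auto
      finally show ?thesis .
    next
      case False
      \<comment> \<open>The lower bound \<open>p \<ge> 1/8\<close> exceeds 1/9, whose square root is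
        rational.\<close>
      have sq: "1 / sqrt p \<le> 3"
      proof -
        have "sqrt (1/9) \<le> sqrt p" using p8 by (intro real_sqrt_le_mono) simp
        moreover have "sqrt (1/9) = 1/3" by (rule real_sqrt_unique) (auto simp: power2_eq_square)
        ultimately have "1 / sqrt p \<le> 1 / (1/3)" using p8 by (intro divide_left_mono) auto
        then show ?thesis by simp
      qed
      have "\<bar>P - (\<Sum>k\<le>5. 1 / sqrt p ^ k * I k)\<bar> \<le> \<bar>P\<bar> + \<bar>\<Sum>k\<le>5. 1 / sqrt p ^ k * I k\<bar>" by (rule abs_triangle_ineq4)
      also have "\<dots> \<le> 1 + (\<Sum>k\<le>5. 3 ^ k * \<bar>I k\<bar>)"
      proof (intro add_mono order_trans[OF sum_abs sum_mono])
        show "\<bar>P\<bar> \<le> 1" by (simp add: P_def)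
        fix k
        have "(1 / sqrt p) ^ k \<le> 3 ^ k" using sq p8 by (intro power_mono) auto
        then have "\<bar>1 / sqrt p ^ k\<bar> \<le> 3 ^ k" using p8 by (simp add: power_divide)
        then show "\<bar>1 / sqrt p ^ k * I k\<bar> \<le> 3 ^ k * \<bar>I k\<bar>" unfolding abs_mult by (rule mult_right_mono) simp
      qed
      also have "\<dots> = B" by (simp add: B_def)
      also have "B \<le> B * \<Psi> ^ 3 / p ^ 3"
      proof -
        have "p ^ 3 \<le> \<Psi> ^ 3" using False p8 by (intro power_mono) auto
        then have "B * p ^ 3 \<le> B * \<Psi> ^ 3" using B by (intro mult_left_mono)
        then show ?thesis using p3 by (simp add: pos_le_divide_eq)
      qed
      also have "\<dots> \<le> (C + B * \<Psi> ^ 3) / p ^ 3" using C p3 by (intro divide_right_mono) auto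
      finally show ?thesis .
    qed
    then show "\<bar>measure M {\<omega>\<in>space M. Re (log_zeta_X \<sigma> \<omega> / of_real (sqrt (pi * psi \<sigma>))) \<in> {a..b} \<and>
        Im (log_zeta_X \<sigma> \<omega> / of_real (sqrt (pi * psi \<sigma>))) \<in> {c..d}}
      - (\<Sum>k\<le>5. 1 / sqrt (psi \<sigma>) ^ k * integral {c..d} (\<lambda>y. integral {a..b} (\<lambda>x.
           eval2 (edge_g k) x y * exp (- pi * (x\<^sup>2 + y\<^sup>2)))))\<bar> \<le> (C + B * \<Psi> ^ 3) / psi \<sigma> ^ 3"
      unfolding P_def p_def I_def .
  qed
qed

end

section \<open>Translation from \<sigma> to T\<close>

lemma sigmaT_range:
  assumes "\<theta> > 0" "T \<ge> 10"
  shows "1/2 < sigmaT \<theta> T" "sigmaT \<theta> T \<le> 3/2" "ln T > 1"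
proof -
  have "exp 1 < (10::real)" using exp_le by linarith
  then have "exp 1 < exp (ln T)" using assms by simp
  then show l: "ln T > 1" by (rule exp_less_cancel)
  then have "1 \<le> ln T powr \<theta>" using assms by (intro ge_one_powr_ge_zero) auto
  moreover from this have "1 / ln T powr \<theta> \<le> 1 / 1" by (intro divide_left_mono) auto
  ultimately show "1/2 < sigmaT \<theta> T" "sigmaT \<theta> T \<le> 3/2" unfolding sigmaT_def by auto
qed

text \<open>\<open>2 * sigmaT \<theta> T - 1\<close> equals \<open>2 / (ln T) powr \<theta>\<close>,
  so the logarithm of its reciprocal is \<open>\<theta> * ln (ln T) - ln 2\<close>.\<close>

lemma psiT_asymp:
  assumes t: "\<theta> > 0"
  shows "\<exists>C. \<forall>T\<ge>10. \<bar>psiT \<theta> T - \<theta> * ln (ln T)\<bar> \<le> C"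
proof -
  obtain C where C: "\<And>\<sigma>. 1/2 < \<sigma> \<Longrightarrow> \<sigma> \<le> 3/2 \<Longrightarrow> \<bar>psi \<sigma> - ln (1 / (2 * \<sigma> - 1))\<bar> \<le> C"
    using psi_asymp by blast
  have "\<bar>psiT \<theta> T - \<theta> * ln (ln T)\<bar> \<le> C + ln 2" if T: "T \<ge> 10" for T
  proof -
    note s = sigmaT_range[OF t T]
    have "1 / (2 * sigmaT \<theta> T - 1) = ln T powr \<theta> / 2" using s(3) by (simp add: sigmaT_def)
    also have "ln \<dots> = \<theta> * ln (ln T) - ln 2" using s(3) by (simp add: ln_div ln_powr)
    finally have "ln (1 / (2 * sigmaT \<theta> T - 1)) = \<theta> * ln (ln T) - ln 2" .
    moreover have "(0::real) < ln 2" by simp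
    ultimately show ?thesis using C[OF s(1,2)] psiT_eq[OF s(1) refl] by linarith
  qed
  then show ?thesis by blast
qed

theorem theorem1p4:
  fixes M :: "'a measure" and X :: "nat \<Rightarrow> 'a \<Rightarrow> complex" and \<theta> a b c d :: real
  assumes "prob_space M"
    and "prob_space.indep_vars M (\<lambda>_. borel) X {p. prime p}"
    and "\<And>p. prime p \<Longrightarrow> distr M borel (X p) = uniform_circle"
    and "\<theta> > 0" and "a < b" and "c < d"
  shows "(\<exists>C. \<forall>T\<ge>10. \<bar>psiT \<theta> T - \<theta> * ln (ln T)\<bar> \<le> C) \<and>
    (\<exists>g :: nat \<Rightarrow> real poly poly.
       g 0 = 1 \<and> (\<forall>k\<le>5. total_degree_le (g k) k) \<and>
       (\<exists>C. \<forall>T\<ge>10.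
          \<bar>measure M {\<omega> \<in> space M. Re (kappa \<theta> T (\<lambda>p. X p \<omega>)) \<in> {a..b} \<and>
                                   Im (kappa \<theta> T (\<lambda>p. X p \<omega>)) \<in> {c..d}}
            - (\<Sum>k\<le>5. 1 / sqrt (psiT \<theta> T) ^ k *
                 integral {c..d} (\<lambda>y. integral {a..b} (\<lambda>x.
                   eval2 (g k) x y * exp (- pi * (x\<^sup>2 + y\<^sup>2)))))\<bar>
          \<le> C * (1 / (ln (ln T)) ^ 3)))"
proof (intro conjI exI[of _ edge_g])
  show "\<exists>C. \<forall>T\<ge>10. \<bar>psiT \<theta> T - \<theta> * ln (ln T)\<bar> \<le> C" by (rule psiT_asymp[OF assms(4)])
  show "edge_g 0 = 1" by (rule edge_g_0)
  show "\<forall>k\<le>5. total_degree_le (edge_g k) k" by (simp add: total_degree_edge_g)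
  interpret prob_space M by (rule assms(1))
  interpret random_primes M X
    by unfold_locales (use assms in auto)
  obtain C where C: "C \<ge> 0" "\<And>\<sigma>. 1/2 < \<sigma> \<Longrightarrow> \<sigma> \<le> 3/2 \<Longrightarrow>
    \<bar>measure M {\<omega>\<in>space M. Re (log_zeta_X \<sigma> \<omega> / of_real (sqrt (pi * psi \<sigma>))) \<in> {a..b} \<and>
        Im (log_zeta_X \<sigma> \<omega> / of_real (sqrt (pi * psi \<sigma>))) \<in> {c..d}}
      - (\<Sum>k\<le>5. 1 / sqrt (psi \<sigma>) ^ k * integral {c..d} (\<lambda>y. integral {a..b} (\<lambda>x.
           eval2 (edge_g k) x y * exp (- pi * (x\<^sup>2 + y\<^sup>2)))))\<bar> \<le> C / psi \<sigma> ^ 3"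
    by (rule edge_estimate[OF assms(5,6)]) (rule that)
  obtain C1 where C1: "\<And>T. T \<ge> 10 \<Longrightarrow> \<bar>psiT \<theta> T - \<theta> * ln (ln T)\<bar> \<le> C1"
    using psiT_asymp[OF assms(4)] by blast
  define R where "R = (1 + 8 * C1) / \<theta>"
  show "\<exists>C. \<forall>T\<ge>10.
          \<bar>measure M {\<omega> \<in> space M. Re (kappa \<theta> T (\<lambda>p. X p \<omega>)) \<in> {a..b} \<and>
                                   Im (kappa \<theta> T (\<lambda>p. X p \<omega>)) \<in> {c..d}}
            - (\<Sum>k\<le>5. 1 / sqrt (psiT \<theta> T) ^ k *
                 integral {c..d} (\<lambda>y. integral {a..b} (\<lambda>x.
                   eval2 (edge_g k) x y * exp (- pi * (x\<^sup>2 + y\<^sup>2)))))\<bar>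
          \<le> C * (1 / (ln (ln T)) ^ 3)"
  proof (intro exI[of _ "C * R ^ 3"] allI impI)
    fix T :: real assume T: "10 \<le> T"
    note s = sigmaT_range[OF assms(4) T]
    have psi: "psiT \<theta> T = psi (sigmaT \<theta> T)" by (rule psiT_eq[OF s(1) refl])
    define p where "p = psi (sigmaT \<theta> T)"
    define l where "l = ln (ln T)"
    have l: "l > 0" using s(3) by (simp add: l_def)
    have p8: "p \<ge> 1/8" using psi_ge[OF s(1,2)] by (simp add: p_def)
    have C10: "C1 \<ge> 0" using C1[OF T] by linarith
    have "\<theta> * l \<le> p + C1" using C1[OF T] by (simp add: psi p_def l_def abs_le_iff)
    \<comment> \<open>Since \<open>p \<ge> 1/8\<close>, the additive error in the asymptotics of
      \<open>psiT\<close> becomes multiplicative; so \<open>ln (ln T) \<le> R * p\<close> holds for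
      every \<open>T \<ge> 10\<close>, and \<open>psi\<close> may be replaced by
      \<open>ln (ln T)\<close> in the error term.\<close>
    also have "C1 \<le> 8 * C1 * p" using mult_left_mono[OF p8, of "8 * C1"] C10 by simp
    finally have "\<theta> * l \<le> (1 + 8 * C1) * p" by (simp add: algebra_simps)
    then have "l \<le> R * p" using assms(4) by (simp add: R_def field_simps)
    then have "l ^ 3 \<le> (R * p) ^ 3" using l by (intro power_mono) auto
    then have "1 / p ^ 3 \<le> R ^ 3 * (1 / l ^ 3)"
      using l p8 by (simp add: power_mult_distrib field_simps)
    then have "C / p ^ 3 \<le> C * R ^ 3 * (1 / l ^ 3)"
      using mult_left_mono[of "1 / p ^ 3" "R ^ 3 * (1 / l ^ 3)" C] C(1) by (simp add: mult.assoc)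
    then show "\<bar>measure M {\<omega> \<in> space M. Re (kappa \<theta> T (\<lambda>p. X p \<omega>)) \<in> {a..b} \<and>
                                   Im (kappa \<theta> T (\<lambda>p. X p \<omega>)) \<in> {c..d}}
            - (\<Sum>k\<le>5. 1 / sqrt (psiT \<theta> T) ^ k *
                 integral {c..d} (\<lambda>y. integral {a..b} (\<lambda>x.
                   eval2 (edge_g k) x y * exp (- pi * (x\<^sup>2 + y\<^sup>2)))))\<bar>
          \<le> C * R ^ 3 * (1 / (ln (ln T)) ^ 3)"
      using C(2)[OF s(1,2)] unfolding kappa_def psi log_zeta_X_def p_def l_def by linarith
  qed
qed

end
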